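(* Let $L/K$ be an exceptional extension of local fields of degree $n$, and let $\mathbb{F}_q$ be the residue field of $K$. Then $\gcd(n,q-1)=1$.
   Context: A local field is a field complete with respect to a discrete valuation and having finite residue field. For a finite separable extension $L/K$ of local fields, let $N$ be the Galois closure of $L/K$. The extension $L/K$ is called exceptional if (a) $L/K$ is totally ramified, and (b) for every $\sigma\in \mathrm{Gal}(N/K)\setminus\mathrm{Gal}(N/L)$, the compositum $L.\sigma(L)$ (taken inside $N$) is not totally ramified over $K$. *)

theory Defs
  imports Complex_Main "HOL-Library.FuncSet" "HOL-Computational_Algebra.Computational_Algebra"
begin

text \<open>
  The base field is a type \<open>'k\<close>, embedded by \<open>\<iota>\<close> into the type \<open>'n\<close>, the Galois closure; the
  fields between them are subsets of \<open>'n\<close>.  Valuations are normalised (value group \<open>\<int>\<close>), with an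
  irrelevant value at \<open>0\<close>.
\<close>

section \<open>Local fields\<close>

definition is_subfield :: "'a::field set \<Rightarrow> bool" where
  "is_subfield F \<longleftrightarrow> 0 \<in> F \<and> 1 \<in> F \<and>
     (\<forall>x\<in>F. \<forall>y\<in>F. x - y \<in> F \<and> x * y \<in> F) \<and> (\<forall>x\<in>F. inverse x \<in> F)"

definition discrete_valuation_on :: "'a::field set \<Rightarrow> ('a \<Rightarrow> int) \<Rightarrow> bool" where
  "discrete_valuation_on F v \<longleftrightarrow>
     v ` (F - {0}) = UNIV \<and>
     (\<forall>x\<in>F - {0}. \<forall>y\<in>F - {0}. v (x * y) = v x + v y) \<and>
     (\<forall>x\<in>F - {0}. \<forall>y\<in>F - {0}. x + y \<noteq> 0 \<longrightarrow> min (v x) (v y) \<le> v (x + y))"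

text \<open>The disjuncts \<open>x = y\<close> and \<open>x = 0\<close> below stand for the usual convention \<open>v 0 = \<infinity>\<close>.\<close>

definition val_dist_ge :: "('a::field \<Rightarrow> int) \<Rightarrow> int \<Rightarrow> 'a \<Rightarrow> 'a \<Rightarrow> bool" where
  "val_dist_ge v m x y \<longleftrightarrow> x = y \<or> m \<le> v (x - y)"

definition val_complete_on :: "'a::field set \<Rightarrow> ('a \<Rightarrow> int) \<Rightarrow> bool" where
  "val_complete_on F v \<longleftrightarrow>
     (\<forall>X::nat \<Rightarrow> 'a. range X \<subseteq> F \<and> (\<forall>m. \<exists>n0. \<forall>i\<ge>n0. \<forall>j\<ge>n0. val_dist_ge v m (X i) (X j)) \<longrightarrow>
        (\<exists>l\<in>F. \<forall>m. \<exists>n0. \<forall>i\<ge>n0. val_dist_ge v m (X i) l))"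

definition val_ring :: "'a::field set \<Rightarrow> ('a \<Rightarrow> int) \<Rightarrow> 'a set" where
  "val_ring F v = {x \<in> F. x = 0 \<or> 0 \<le> v x}"

definition residue_field :: "'a::field set \<Rightarrow> ('a \<Rightarrow> int) \<Rightarrow> 'a set set" where
  "residue_field F v =
     val_ring F v // {(x, y). x \<in> val_ring F v \<and> y \<in> val_ring F v \<and> val_dist_ge v 1 x y}"

definition local_field_on :: "'a::field set \<Rightarrow> ('a \<Rightarrow> int) \<Rightarrow> bool" where
  "local_field_on F v \<longleftrightarrow> is_subfield F \<and> discrete_valuation_on F v \<and>
     val_complete_on F v \<and> finite (residue_field F v)"

section \<open>Field extensions\<close>

definition field_embedding :: "('k::field \<Rightarrow> 'n::field) \<Rightarrow> bool" where
  "field_embedding \<iota> \<longleftrightarrow> \<iota> 1 = 1 \<and> (\<forall>x y. \<iota> (x + y) = \<iota> x + \<iota> y \<and> \<iota> (x * y) = \<iota> x * \<iota> y)"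

definition intermediate_field :: "('k::field \<Rightarrow> 'n::field) \<Rightarrow> 'n set \<Rightarrow> bool" where
  "intermediate_field \<iota> M \<longleftrightarrow> is_subfield M \<and> range \<iota> \<subseteq> M"

definition finite_ext :: "('k::field \<Rightarrow> 'n::field) \<Rightarrow> 'n set \<Rightarrow> bool" where
  "finite_ext \<iota> M \<longleftrightarrow> (\<exists>B. finite B \<and> M = module.span (\<lambda>c x. \<iota> c * x) B)"

definition ext_degree :: "('k::field \<Rightarrow> 'n::field) \<Rightarrow> 'n set \<Rightarrow> nat" where
  "ext_degree \<iota> M = vector_space.dim (\<lambda>c x. \<iota> c * x) M"

definition separable_ext :: "('k::field \<Rightarrow> 'n::field) \<Rightarrow> 'n set \<Rightarrow> bool" where
  "separable_ext \<iota> M \<longleftrightarrow>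
     (\<forall>x\<in>M. \<exists>p. irreducible p \<and> poly (map_poly \<iota> p) x = 0 \<and> coprime p (pderiv p))"

text \<open>
  \<open>Gal B M\<close> is the group of automorphisms of \<open>M\<close> fixing \<open>B\<close> pointwise; \<open>extensional\<close> makes each
  automorphism of \<open>M\<close> correspond to exactly one function, and is vacuous for \<open>M = UNIV\<close>.
\<close>

definition Gal :: "'n::field set \<Rightarrow> 'n set \<Rightarrow> ('n \<Rightarrow> 'n) set" where
  "Gal B M = {\<sigma> \<in> extensional M. bij_betw \<sigma> M M \<and>
     (\<forall>x\<in>M. \<forall>y\<in>M. \<sigma> (x + y) = \<sigma> x + \<sigma> y \<and> \<sigma> (x * y) = \<sigma> x * \<sigma> y) \<and> (\<forall>b\<in>B. \<sigma> b = b)}"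

text \<open>A finite extension is Galois if the base field is the fixed field of its automorphism group.\<close>

definition galois_ext :: "('k::field \<Rightarrow> 'n::field) \<Rightarrow> 'n set \<Rightarrow> bool" where
  "galois_ext \<iota> M \<longleftrightarrow> intermediate_field \<iota> M \<and> finite_ext \<iota> M \<and>
     {x \<in> M. \<forall>\<sigma>\<in>Gal (range \<iota>) M. \<sigma> x = x} = range \<iota>"

text \<open>The whole type \<open>'n\<close> is the smallest Galois extension of the base field containing \<open>L\<close>.\<close>

definition galois_closure :: "('k::field \<Rightarrow> 'n::field) \<Rightarrow> 'n set \<Rightarrow> bool" where
  "galois_closure \<iota> L \<longleftrightarrow> galois_ext \<iota> (UNIV :: 'n set) \<and>
     (\<forall>M. galois_ext \<iota> M \<and> L \<subseteq> M \<longrightarrow> M = UNIV)"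

definition compositum :: "'n::field set \<Rightarrow> 'n set \<Rightarrow> 'n set" where
  "compositum L L' = \<Inter>{M. is_subfield M \<and> L \<subseteq> M \<and> L' \<subseteq> M}"

section \<open>Ramification and exceptional extensions\<close>

text \<open>
  \<open>w\<close> is a normalised discrete valuation on \<open>M\<close> prolonging \<open>v\<close>, with ramification index \<open>e\<close>.  When
  \<open>v\<close> is complete and the extension is finite, \<open>w\<close> and \<open>e\<close> exist and are unique, so the existential
  quantifiers over \<open>w\<close> and \<open>e\<close> below involve no choice.
\<close>

definition prolongs :: "('k::field \<Rightarrow> int) \<Rightarrow> ('k \<Rightarrow> 'n::field) \<Rightarrow> 'n set \<Rightarrow> ('n \<Rightarrow> int) \<Rightarrow> nat \<Rightarrow> bool" where
  "prolongs v \<iota> M w e \<longleftrightarrow> discrete_valuation_on M w \<and> 0 < e \<and>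
     (\<forall>c. c \<noteq> 0 \<longrightarrow> w (\<iota> c) = int e * v c)"

definition local_field_ext :: "('k::field \<Rightarrow> int) \<Rightarrow> ('k \<Rightarrow> 'n::field) \<Rightarrow> 'n set \<Rightarrow> bool" where
  "local_field_ext v \<iota> L \<longleftrightarrow> local_field_on UNIV v \<and> field_embedding \<iota> \<and> intermediate_field \<iota> L \<and>
     (\<exists>w e. local_field_on L w \<and> prolongs v \<iota> L w e)"

definition totally_ramified :: "('k::field \<Rightarrow> int) \<Rightarrow> ('k \<Rightarrow> 'n::field) \<Rightarrow> 'n set \<Rightarrow> bool" where
  "totally_ramified v \<iota> M \<longleftrightarrow> finite_ext \<iota> M \<and> (\<exists>w. prolongs v \<iota> M w (ext_degree \<iota> M))"

definition exceptional :: "('k::field \<Rightarrow> int) \<Rightarrow> ('k \<Rightarrow> 'n::field) \<Rightarrow> 'n set \<Rightarrow> bool" where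
  "exceptional v \<iota> L \<longleftrightarrow> totally_ramified v \<iota> L \<and>
     (\<forall>\<sigma> \<in> Gal (range \<iota>) UNIV - Gal L UNIV. \<not> totally_ramified v \<iota> (compositum L (\<sigma> ` L)))"

end

(* Let G be the Galois group of the Galois closure N, X the set of conjugates of a uniformizer pi of
L, and T the coset of the inertia group whose elements induce the Frobenius of the residue field of
K on that of N.  Because L is totally ramified, the stabiliser of each point of X meets T and
inertia is transitive on X; counting fixed points, the elements of T have one fixed point in X on
average.  If some element of T fixes two conjugates, then the compositum of the two conjugate fields
has the residue field of K, so it is totally ramified and L is not exceptional.  Hence every element
of T has a fixed point.  If d divides n and q - 1, then g |-> g(rho)/rho with rho = pi^(n/d) is, modulo
the maximal ideal, a homomorphism from G to an abelian group, trivial on the stabilisers of all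
conjugates; so it is trivial on T, and therefore on G, which forces the ramification index d of rho
over K to be a power of the residue characteristic, i.e. d = 1.

The absolute value of N is constructed as that of the norm: by compactness it is equivalent to a
submultiplicative lattice norm, and the ultrametric inequality follows from the boundedness of the
powers of 1 + x. *)

theory Submission
  imports Defs "HOL-Algebra.Multiplicative_Group" "HOL-Algebra.Sylow"
    "HOL-Analysis.Abstract_Metric_Spaces"
begin

hide_const (open) UnivPoly.coeff UnivPoly.monom

section \<open>Nonarchimedean absolute values\<close>

text \<open>Total ramification is stated through an unspecified prolongation \<open>w\<close>, so
  different fields cannot be compared until every \<open>w\<close> is tied to one Galois-invariant
  absolute value on N; the norm provides it. That absolute value is left unnormalised: it restricts
  to the \<open>card G\<close>-th power of the one on K, and a uniformizer of ramification index e
  is an element z with \<open>e * lg z = - card G\<close>. Total ramification is both used and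
  proved in one form: every integral element of the field is congruent to one of K. A compositum
  fixed by an element of T has this property because the elements of a finite extension of the field
  of q elements that are fixed by the q-power map are those of that field; completeness turns the
  property back into equality of degree and ramification index. That d divides q - 1 puts the d-th
  roots of unity into the residue field of K, where G acts trivially; this makes g(rho)/rho
  multiplicative in g. Its value depends only on g(pi), and each g agrees at pi with an element of
  T.\<close>

locale nonarch_abs =
  fixes A :: "'a::field \<Rightarrow> real"
  assumes A_nonneg [simp]: "0 \<le> A x"
    and A_eq_0_iff [simp]: "A x = 0 \<longleftrightarrow> x = 0"
    and A_mult: "A (x * y) = A x * A y"
    and A_add_le: "A (x + y) \<le> max (A x) (A y)"
begin

lemma A_0 [simp]: "A 0 = 0"
  by simp

lemma A_pos_iff [simp]: "0 < A x \<longleftrightarrow> x \<noteq> 0"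
  using A_nonneg[of x] A_eq_0_iff[of x] by linarith

lemma A_1 [simp]: "A 1 = 1"
proof -
  have "A 1 * A 1 = A 1" by (metis A_mult mult_1)
  moreover have "A 1 \<noteq> 0" by simp
  ultimately show ?thesis by simp
qed

lemma A_uminus [simp]: "A (- x) = A x"
proof -
  have "A (-1) * A (-1) = 1" by (metis A_1 A_mult mult_minus1 minus_minus)
  then have "A (-1) = 1"
    using A_nonneg[of "-1"] by (metis abs_of_nonneg real_sqrt_abs2 real_sqrt_one)
  then show ?thesis by (metis A_mult mult_1 mult_minus1)
qed

lemma A_diff_le: "A (x - y) \<le> max (A x) (A y)"
  using A_add_le[of x "- y"] by simp

lemma A_diff_commute: "A (x - y) = A (y - x)"
  by (metis A_uminus minus_diff_eq)

lemma A_power: "A (x ^ n) = A x ^ n"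
  by (induction n) (simp_all add: A_mult)

lemma A_inverse: "A (inverse x) = inverse (A x)"
proof (cases "x = 0")
  case False
  then have "A x * A (inverse x) = 1" by (metis A_1 A_mult right_inverse)
  then show ?thesis by (metis inverse_unique)
qed simp

lemma A_divide: "A (x / y) = A x / A y"
  by (simp add: divide_inverse A_mult A_inverse)

lemma A_prod: "A (prod f S) = (\<Prod>i\<in>S. A (f i))"
  by (induction S rule: infinite_finite_induct) (simp_all add: A_mult)

lemma A_sum_le: "(\<And>i. i \<in> S \<Longrightarrow> A (f i) \<le> r) \<Longrightarrow> 0 \<le> r \<Longrightarrow> A (sum f S) \<le> r"
proof (induction S rule: infinite_finite_induct)
  case (insert x S)
  then have "A (f x) \<le> r" "A (sum f S) \<le> r" by auto
  then show ?case using A_add_le[of "f x" "sum f S"] insert.hyps by auto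
qed auto

lemma A_sum_less: "(\<And>i. i \<in> S \<Longrightarrow> A (f i) < r) \<Longrightarrow> 0 < r \<Longrightarrow> A (sum f S) < r"
proof (induction S rule: infinite_finite_induct)
  case (insert x S)
  then have "A (f x) < r" "A (sum f S) < r" by auto
  then show ?case using A_add_le[of "f x" "sum f S"] insert.hyps by auto
qed auto

lemma A_of_nat_le_1: "A (of_nat n) \<le> 1"
proof (induction n)
  case (Suc n)
  then show ?case using A_add_le[of 1 "of_nat n"] by simp
qed simp

lemma A_of_int_le_1: "A (of_int n) \<le> 1"
  by (cases n) (simp_all only: of_int_of_nat_eq of_int_minus A_uminus A_of_nat_le_1)

lemma A_add_eq_max: "A x \<noteq> A y \<Longrightarrow> A (x + y) = max (A x) (A y)"
  using A_add_le[of x y] A_diff_le[of "x + y" x] A_diff_le[of "x + y" y] by auto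

lemma A_eq_of_diff_less: "A (x - y) < A x \<Longrightarrow> A y = A x"
  using A_add_eq_max[of "y - x" x] A_diff_commute[of x y] by auto

text \<open>In each induction step the new nonzero term and the partial sum differ in absolute
  value, so the larger one determines the sum. Zero terms all share the value 0, hence the separate
  disjunct.\<close>

lemma A_sum_distinct:
  assumes "finite S" "\<And>i j. i \<in> S \<Longrightarrow> j \<in> S \<Longrightarrow> i \<noteq> j \<Longrightarrow> f i \<noteq> 0 \<Longrightarrow> f j \<noteq> 0 \<Longrightarrow> A (f i) \<noteq> A (f j)"
  shows "(\<forall>i\<in>S. f i = 0) \<or> (\<exists>j\<in>S. f j \<noteq> 0 \<and> A (sum f S) = A (f j) \<and> (\<forall>i\<in>S. A (f i) \<le> A (f j)))"
  using assms
proof (induction S rule: finite_induct)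
  case (insert x S)
  have IH: "(\<forall>i\<in>S. f i = 0) \<or> (\<exists>j\<in>S. f j \<noteq> 0 \<and> A (sum f S) = A (f j) \<and> (\<forall>i\<in>S. A (f i) \<le> A (f j)))"
    using insert.prems by (intro insert.IH) blast
  show ?case
  proof (cases "f x = 0")
    case True
    then show ?thesis using IH insert.hyps by auto
  next
    case fx: False
    from IH show ?thesis
    proof
      assume "\<forall>i\<in>S. f i = 0"
      then show ?thesis using fx insert.hyps by auto
    next
      assume "\<exists>j\<in>S. f j \<noteq> 0 \<and> A (sum f S) = A (f j) \<and> (\<forall>i\<in>S. A (f i) \<le> A (f j))"
      then obtain j where j: "j \<in> S" "f j \<noteq> 0" "A (sum f S) = A (f j)" "\<forall>i\<in>S. A (f i) \<le> A (f j)"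
        by blast
      have ne: "A (f x) \<noteq> A (f j)" using insert.prems[of x j] insert.hyps j fx by auto
      then have eq: "A (sum f (insert x S)) = max (A (f x)) (A (f j))"
        using A_add_eq_max[of "f x" "sum f S"] insert.hyps j by simp
      show ?thesis
      proof (cases "A (f x) < A (f j)")
        case True
        then show ?thesis using eq j by (intro disjI2 bexI[of _ j]) auto
      next
        case False
        then show ?thesis using eq j fx by (intro disjI2 bexI[of _ x]) auto
      qed
    qed
  qed
qed simp

text \<open>In this form a small sum has small terms; it will control the coefficients of an
  expansion in powers of a uniformizer.\<close>

lemma A_sum_distinct_ge:
  assumes "finite S" "\<And>i j. i \<in> S \<Longrightarrow> j \<in> S \<Longrightarrow> i \<noteq> j \<Longrightarrow> f i \<noteq> 0 \<Longrightarrow> f j \<noteq> 0 \<Longrightarrow> A (f i) \<noteq> A (f j)"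
    and "i \<in> S"
  shows "A (f i) \<le> A (sum f S)"
proof -
  have "(\<forall>i\<in>S. f i = 0) \<or> (\<exists>j\<in>S. f j \<noteq> 0 \<and> A (sum f S) = A (f j) \<and> (\<forall>i\<in>S. A (f i) \<le> A (f j)))"
    by (rule A_sum_distinct[OF assms(1,2)])
  then show ?thesis using assms(3) by auto
qed

section \<open>Congruence modulo the maximal ideal\<close>

definition cong :: "'a \<Rightarrow> 'a \<Rightarrow> bool" (infix "\<doteq>" 50) where
  "x \<doteq> y \<longleftrightarrow> A (x - y) < 1"

lemma cong_refl [simp]: "x \<doteq> x"
  by (simp add: cong_def)

lemma cong_sym: "x \<doteq> y \<Longrightarrow> y \<doteq> x"
  by (simp add: cong_def A_diff_commute)

lemma cong_trans [trans]: "x \<doteq> y \<Longrightarrow> y \<doteq> z \<Longrightarrow> x \<doteq> z"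
  using A_add_le[of "x - y" "y - z"] by (simp add: cong_def)

lemma cong_0_iff: "x \<doteq> 0 \<longleftrightarrow> A x < 1"
  by (simp add: cong_def)

lemma cong_add: "x \<doteq> x' \<Longrightarrow> y \<doteq> y' \<Longrightarrow> x + y \<doteq> x' + y'"
  using A_add_le[of "x - x'" "y - y'"] by (simp add: cong_def algebra_simps)

lemma cong_integral: "x \<doteq> y \<Longrightarrow> A y \<le> 1 \<Longrightarrow> A x \<le> 1"
  using A_add_le[of "x - y" y] by (simp add: cong_def)

lemma cong_unit: "x \<doteq> y \<Longrightarrow> A y = 1 \<Longrightarrow> A x = 1"
  using A_eq_of_diff_less[of y x] by (simp add: cong_def A_diff_commute)

lemma integral_mult: "A x \<le> 1 \<Longrightarrow> A y \<le> 1 \<Longrightarrow> A (x * y) \<le> 1"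
  by (simp add: A_mult mult_le_one)

lemma integral_power: "A x \<le> 1 \<Longrightarrow> A (x ^ n) \<le> 1"
  by (simp add: A_power power_le_one)

lemma integral_add: "A x \<le> 1 \<Longrightarrow> A y \<le> 1 \<Longrightarrow> A (x + y) \<le> 1"
  using A_add_le[of x y] by simp

lemma cong_mult:
  assumes "x \<doteq> x'" "y \<doteq> y'" "A x' \<le> 1" "A y' \<le> 1"
  shows "x * y \<doteq> x' * y'"
proof -
  have "A ((x - x') * y) < 1" 
    using assms(1) mult_left_le[OF cong_integral[OF assms(2,4)] A_nonneg[of "x - x'"]]
    by (simp add: cong_def A_mult)
  moreover have "A (x' * (y - y')) < 1"
    using assms(2) mult_left_le_one_le[OF A_nonneg[of "y - y'"] A_nonneg[of x'] assms(3)]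
    by (simp add: cong_def A_mult)
  moreover have "x * y - x' * y' = (x - x') * y + x' * (y - y')" by (simp add: algebra_simps)
  ultimately show ?thesis unfolding cong_def using A_add_le[of "(x - x') * y" "x' * (y - y')"] by simp
qed

lemma cong_power: "x \<doteq> x' \<Longrightarrow> A x' \<le> 1 \<Longrightarrow> x ^ n \<doteq> x' ^ n"
  by (induction n) (auto intro!: cong_mult integral_power)

lemma cong_sum: "(\<And>i. i \<in> S \<Longrightarrow> f i \<doteq> g i) \<Longrightarrow> sum f S \<doteq> sum g S"
  by (induction S rule: infinite_finite_induct) (auto intro!: cong_add)

lemma cong_prod_0D: "prod f S \<doteq> 0 \<Longrightarrow> (\<And>i. i \<in> S \<Longrightarrow> A (f i) \<le> 1) \<Longrightarrow> \<exists>i\<in>S. f i \<doteq> 0"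
proof (rule ccontr)
  assume *: "prod f S \<doteq> 0" "\<And>i. i \<in> S \<Longrightarrow> A (f i) \<le> 1" "\<not> (\<exists>i\<in>S. f i \<doteq> 0)"
  then have "A (f i) = 1" if "i \<in> S" for i using that by (force simp: cong_0_iff not_less)
  then have "A (prod f S) = 1" by (simp add: A_prod)
  then show False using *(1) by (simp add: cong_0_iff)
qed

subsection \<open>The residue field\<close>

definition res :: "'a \<Rightarrow> 'a set" where
  "res x = {y. y \<doteq> x}"

definition rep :: "'a set \<Rightarrow> 'a" where
  "rep X = (SOME x. X = res x)"

text \<open>A record of HOL-Algebra, so that cyclicity of the multiplicative group, the bound on the
  number of roots and Sylow's theorem apply to the residue field. The operations go through chosen
  representatives, which are congruent but not equal to the given elements.\<close>

definition residue_ring :: "'a set ring" where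
  "residue_ring = \<lparr>carrier = res ` {x. A x \<le> 1}, mult = (\<lambda>X Y. res (rep X * rep Y)),
     one = res 1, zero = res 0, add = (\<lambda>X Y. res (rep X + rep Y))\<rparr>"

lemma res_eq_iff: "res x = res y \<longleftrightarrow> x \<doteq> y"
  unfolding res_def by (auto intro: cong_sym cong_trans)

lemma rep_res: "rep (res x) \<doteq> x"
proof -
  have "res x = res (rep (res x))" unfolding rep_def by (rule someI[of _ x]) simp
  then show ?thesis by (metis res_eq_iff)
qed

lemma residue_ring_mult: "A x \<le> 1 \<Longrightarrow> A y \<le> 1 \<Longrightarrow> res x \<otimes>\<^bsub>residue_ring\<^esub> res y = res (x * y)"
  by (simp add: residue_ring_def res_eq_iff cong_mult rep_res)

lemma residue_ring_add: "res x \<oplus>\<^bsub>residue_ring\<^esub> res y = res (x + y)"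
  by (simp add: residue_ring_def res_eq_iff cong_add rep_res)

lemma residue_ring_one: "\<one>\<^bsub>residue_ring\<^esub> = res 1"
  by (simp add: residue_ring_def)

lemma residue_ring_zero: "\<zero>\<^bsub>residue_ring\<^esub> = res 0"
  by (simp add: residue_ring_def)

lemma residue_ring_carrier: "carrier residue_ring = res ` {x. A x \<le> 1}"
  by (simp add: residue_ring_def)

lemmas residue_ring_ops = residue_ring_mult residue_ring_add residue_ring_one residue_ring_zero

lemma residue_ring_cring: "cring residue_ring"
proof (rule cringI)
  show "abelian_group residue_ring"
  proof (rule abelian_groupI)
    fix X assume "X \<in> carrier residue_ring"
    then obtain x where x: "A x \<le> 1" "X = res x" by (auto simp: residue_ring_carrier)
    have "res (- x) \<oplus>\<^bsub>residue_ring\<^esub> X = \<zero>\<^bsub>residue_ring\<^esub>" by (simp add: x residue_ring_ops)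
    moreover have "res (- x) \<in> carrier residue_ring" using x by (simp add: residue_ring_carrier)
    ultimately show "\<exists>Y\<in>carrier residue_ring. Y \<oplus>\<^bsub>residue_ring\<^esub> X = \<zero>\<^bsub>residue_ring\<^esub>" by blast
  qed (auto simp: residue_ring_carrier residue_ring_ops algebra_simps integral_add)
  show "comm_monoid residue_ring"
    by (rule comm_monoidI) (auto simp: residue_ring_carrier residue_ring_ops algebra_simps integral_mult)
qed (auto simp: residue_ring_carrier residue_ring_ops algebra_simps integral_mult integral_add)

lemma residue_ring_field: "field residue_ring"
proof (rule cring.cring_fieldI2[OF residue_ring_cring])
  show "\<zero>\<^bsub>residue_ring\<^esub> \<noteq> \<one>\<^bsub>residue_ring\<^esub>"
    by (simp add: residue_ring_ops res_eq_iff cong_def)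
next
  fix X assume "X \<in> carrier residue_ring" and nz: "X \<noteq> \<zero>\<^bsub>residue_ring\<^esub>"
  then obtain x where x: "A x \<le> 1" "X = res x" by (auto simp: residue_ring_carrier)
  with nz have 1: "A x = 1" by (simp add: residue_ring_ops res_eq_iff cong_0_iff)
  then have "res (inverse x) \<in> carrier residue_ring"
    by (auto simp: residue_ring_carrier A_inverse)
  moreover have "X \<otimes>\<^bsub>residue_ring\<^esub> res (inverse x) = res (x * inverse x)"
    using 1 unfolding x(2) by (intro residue_ring_mult) (simp_all add: A_inverse)
  moreover have "x * inverse x = 1" using 1 by (metis A_0 right_inverse zero_neq_one)
  ultimately have "res (inverse x) \<in> carrier residue_ring"
    "X \<otimes>\<^bsub>residue_ring\<^esub> res (inverse x) = \<one>\<^bsub>residue_ring\<^esub>"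
    by (simp_all add: residue_ring_one)
  then show "\<exists>b\<in>carrier residue_ring. X \<otimes>\<^bsub>residue_ring\<^esub> b = \<one>\<^bsub>residue_ring\<^esub>" by blast
qed

lemma res_in_carrier_iff: "res x \<in> carrier residue_ring \<longleftrightarrow> A x \<le> 1"
proof
  assume "res x \<in> carrier residue_ring"
  then obtain y where "A y \<le> 1" "res x = res y" unfolding residue_ring_carrier by blast
  then show "A x \<le> 1" using cong_integral[of x y] by (simp only: res_eq_iff)
qed (simp add: residue_ring_carrier)

lemma residue_ring_pow: "A x \<le> 1 \<Longrightarrow> res x [^]\<^bsub>residue_ring\<^esub> (n::nat) = res (x ^ n)"
proof (induction n)
  case 0
  then show ?case by (simp add: residue_ring_one)
next
  case (Suc n)
  then show ?case by (simp add: residue_ring_mult integral_power mult.commute)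
qed

text \<open>A lift of a generator of the multiplicative group of the residue field. A map compatible
  with congruence and powers is determined modulo the maximal ideal, on units, by its value at
  \<open>a\<close>.\<close>

lemma units_cyclic:
  assumes "finite (carrier residue_ring)"
  obtains a where "A a = 1" "\<And>x. A x = 1 \<Longrightarrow> \<exists>i. x \<doteq> a ^ i"
proof -
  interpret R: field residue_ring by (rule residue_ring_field)
  from R.finite_field_mult_group_has_gen[OF assms] obtain X where
    X: "X \<in> carrier (mult_of residue_ring)"
    "carrier (mult_of residue_ring) = {X [^]\<^bsub>residue_ring\<^esub> i | i::nat. i \<in> UNIV}" by blast
  have unit: "res x \<in> carrier (mult_of residue_ring) \<longleftrightarrow> A x = 1" for x
    using res_in_carrier_iff[of x] res_eq_iff[of x 0] cong_0_iff[of x] by (auto simp: residue_ring_zero)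
  obtain a where a: "X = res a" using X(1) by (auto simp: residue_ring_carrier)
  then have a1: "A a = 1" using X(1) unit by blast
  have "\<exists>i. x \<doteq> a ^ i" if "A x = 1" for x
  proof -
    have "res x \<in> carrier (mult_of residue_ring)" using unit that by blast
    then obtain i where "res x = X [^]\<^bsub>residue_ring\<^esub> (i::nat)" using X(2) by blast
    then show ?thesis using a a1 by (auto simp: residue_ring_pow res_eq_iff)
  qed
  with a1 that show thesis by blast
qed

text \<open>Pairwise incongruent elements inject into the residue field, where the d-th roots of
  unity number at most d.\<close>

lemma card_roots_of_unity_le:
  assumes "finite (carrier residue_ring)" and "d \<noteq> 0"
    and "\<And>x. x \<in> S \<Longrightarrow> A x \<le> 1" and "\<And>x. x \<in> S \<Longrightarrow> x ^ d \<doteq> 1"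
    and "\<And>x y. x \<in> S \<Longrightarrow> y \<in> S \<Longrightarrow> x \<doteq> y \<Longrightarrow> x = y"
  shows "card S \<le> d"
proof -
  interpret R: field residue_ring by (rule residue_ring_field)
  have "card S = card (res ` S)"
    using assms(5) by (intro card_image[symmetric] inj_onI) (simp add: res_eq_iff)
  also have "\<dots> \<le> card {X \<in> carrier residue_ring. X [^]\<^bsub>residue_ring\<^esub> d = \<one>\<^bsub>residue_ring\<^esub>}"
  proof (rule card_mono)
    have "res x [^]\<^bsub>residue_ring\<^esub> d = \<one>\<^bsub>residue_ring\<^esub>" if "x \<in> S" for x
      using assms(3,4)[OF that] by (simp only: residue_ring_pow residue_ring_one res_eq_iff)
    then show "res ` S \<subseteq> {X \<in> carrier residue_ring. X [^]\<^bsub>residue_ring\<^esub> d = \<one>\<^bsub>residue_ring\<^esub>}"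
      using assms(3) by (auto simp: res_in_carrier_iff)
  qed (use assms(1) in auto)
  also have "\<dots> \<le> d" by (rule R.num_roots_le_deg[OF assms(1,2)])
  finally show ?thesis .
qed

lemma fermat:
  assumes "finite (carrier residue_ring)" and "A x \<le> 1"
  shows "x ^ card (carrier residue_ring) \<doteq> x"
proof -
  interpret R: field residue_ring by (rule residue_ring_field)
  interpret M: group "mult_of residue_ring" by (rule R.field_mult_group)
  have fin: "finite (carrier (mult_of residue_ring))" using assms(1) by simp
  let ?q = "card (carrier residue_ring)"
  have q: "?q > 0" using assms(1) by (auto simp: card_gt_0_iff)
  show ?thesis
  proof (cases "A x < 1")
    case True
    then have "A (x ^ ?q) < 1"
      using power_strict_decreasing[of 0 ?q "A x"] q by (cases "x = 0") (auto simp: A_power zero_power)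
    then show ?thesis using True by (meson cong_0_iff cong_sym cong_trans)
  next
    case False
    then have x: "res x \<in> carrier (mult_of residue_ring)"
      using assms(2) res_eq_iff[of x 0] cong_0_iff[of x]
      by (auto simp: res_in_carrier_iff residue_ring_zero)
    have "res x [^]\<^bsub>mult_of residue_ring\<^esub> (Coset.order (mult_of residue_ring)) = \<one>\<^bsub>mult_of residue_ring\<^esub>"
      using M.pow_order_eq_1[OF x] .
    then have "res (x ^ (?q - 1)) = res 1"
      using assms by (simp add: R.order_mult_of nat_pow_mult_of residue_ring_pow residue_ring_one Coset.order_def)
    then have "x ^ (?q - 1) * x \<doteq> 1 * x" using assms(2) by (intro cong_mult) (auto simp: res_eq_iff)
    then show ?thesis using power_minus_mult[OF q, of x] by simp
  qed
qed

section \<open>The residue characteristic\<close>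

lemma A_of_nat_eq_1:
  assumes "prime p" "A (of_nat p) < 1" "\<not> p dvd n"
  shows "A (of_nat n) = 1"
proof (rule ccontr)
  assume "A (of_nat n) \<noteq> 1"
  then have n: "A (of_nat n) < 1" using A_of_nat_le_1[of n] by simp
  have "coprime p n" using assms by (simp add: prime_imp_coprime)
  then obtain a b :: int where ab: "a * int p + b * int n = 1"
    using bezout_int[of "int p" "int n"] by auto
  have "(1::'a) = of_int a * of_nat p + of_int b * of_nat n"
    using arg_cong[OF ab, of "of_int :: int \<Rightarrow> 'a"] by simp
  moreover have "A (of_int a * of_nat p) < 1" "A (of_int b * of_nat n) < 1"
    using assms n A_of_int_le_1[of a] A_of_int_le_1[of b]
    by (simp_all add: A_mult) (meson A_nonneg mult_left_le_one_le order_le_less_trans)+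
  ultimately have "A 1 < 1" using A_add_le[of "of_int a * of_nat p" "of_int b * of_nat n"]
    by (metis max_less_iff_conj order_le_less_trans)
  then show False by simp
qed

text \<open>For a prime r dividing the order, Sylow gives an additive subgroup of order r; a nonzero
  element of it is killed by r, so r vanishes in the residue field. By Bezout no two distinct primes
  vanish there, so only one prime divides the order.\<close>

lemma card_residue_ring_prime_power:
  assumes "finite (carrier residue_ring)"
  obtains p s where "prime p" "0 < s" "card (carrier residue_ring) = p ^ s" "A (of_nat p) < 1"
proof -
  interpret R: field residue_ring by (rule residue_ring_field)
  have M: "group (add_monoid residue_ring)" by (rule R.a_group)
  let ?q = "card (carrier residue_ring)"
  have ord: "Coset.order (add_monoid residue_ring) = ?q" by (simp add: Coset.order_def)
  have pow: "res x [^]\<^bsub>add_monoid residue_ring\<^esub> (n::nat) = res (of_nat n * x)" for x n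
    by (induction n) (simp_all add: residue_ring_ops algebra_simps)
  have "\<zero>\<^bsub>residue_ring\<^esub> \<noteq> \<one>\<^bsub>residue_ring\<^esub>" by simp
  moreover have "{\<zero>\<^bsub>residue_ring\<^esub>, \<one>\<^bsub>residue_ring\<^esub>} \<subseteq> carrier residue_ring" by simp
  ultimately have q2: "2 \<le> ?q" by (metis assms card_2_iff card_mono)
  have dvd: "r dvd n" if r: "prime r" "r dvd ?q" and n: "A (of_nat n) < 1" for r n :: nat
  proof -
    have "finite (carrier (add_monoid residue_ring))" using assms by simp
    moreover obtain m where "?q = r ^ 1 * m" using r by auto
    ultimately obtain H where H: "subgroup H (add_monoid residue_ring)" "card H = r ^ 1"
      using sylow_thm[OF r(1) M, of 1 m] ord by auto
    have fH: "finite H" using H r by (metis card.infinite not_prime_0 power_one_right)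
    have "H \<noteq> {\<zero>\<^bsub>residue_ring\<^esub>}" using H(2) r(1) by auto
    moreover have "\<zero>\<^bsub>residue_ring\<^esub> \<in> H" using subgroup.one_closed[OF H(1)] by simp
    ultimately obtain X where X: "X \<in> H" "X \<noteq> \<zero>\<^bsub>residue_ring\<^esub>" by blast
    have XC: "X \<in> carrier (add_monoid residue_ring)" using subgroup.subset[OF H(1)] X by blast
    then obtain x where x: "X = res x" "A x \<le> 1" by (auto simp: residue_ring_carrier)
    with X have x1: "A x = 1" by (simp add: residue_ring_zero res_eq_iff cong_0_iff)
    interpret HG: group "(add_monoid residue_ring)\<lparr>carrier := H\<rparr>"
      by (rule subgroup.subgroup_is_group[OF H(1) M])
    have "X [^]\<^bsub>(add_monoid residue_ring)\<lparr>carrier := H\<rparr>\<^esub> r = \<zero>\<^bsub>residue_ring\<^esub>"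
      using HG.pow_order_eq_1[of X] X(1) H(2) by (simp add: Coset.order_def)
    then have "X [^]\<^bsub>add_monoid residue_ring\<^esub> r = \<zero>\<^bsub>residue_ring\<^esub>"
      by (simp add: nat_pow_def)
    then have "of_nat r * x \<doteq> 0" unfolding x(1) pow by (simp only: residue_ring_zero res_eq_iff)
    then have r1: "A (of_nat r) < 1" using x1 by (simp add: cong_0_iff A_mult)
    show "r dvd n" using A_of_nat_eq_1[OF r(1) r1, of n] n by auto
  qed
  obtain p where p: "prime p" "p dvd ?q" using q2 by (metis One_nat_def Suc_1 not_less_eq_eq prime_factor_nat le_refl)
  \<comment> \<open>Lagrange in the additive group: the order of the field vanishes in it. The
    cofactor \<open>m\<close>, being prime to \<open>p\<close>, does not, so \<open>p\<close>
    does.\<close>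
  have "res 1 [^]\<^bsub>add_monoid residue_ring\<^esub> ?q = \<zero>\<^bsub>residue_ring\<^esub>"
    using group.pow_order_eq_1[OF M, of "res 1"] ord by (auto simp: residue_ring_carrier)
  then have Aq: "A (of_nat ?q) < 1" unfolding pow by (simp only: residue_ring_zero res_eq_iff cong_0_iff mult_1_right)
  obtain s m where sm: "?q = p ^ s * m" "\<not> p dvd m"
    using p q2 by (metis multiplicity_decompose' not_prime_unit not_numeral_le_zero)
  have "s > 0" using sm p by (cases s) auto
  have "A (of_nat p) ^ s * A (of_nat m) < 1" using Aq by (simp add: sm A_mult A_power)
  moreover have "\<not> A (of_nat m) < 1" using dvd[OF p, of m] sm by blast
  ultimately have Ap: "A (of_nat p) < 1"
    using A_of_nat_le_1[of p] A_of_nat_le_1[of m] by (metis antisym_conv2 mult_1 power_one order_less_irrefl)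
  have "m = 1"
  proof (rule ccontr)
    assume "m \<noteq> 1"
    then obtain r where r: "prime r" "r dvd m" using prime_factor_nat by blast
    then have "r dvd p" using dvd[OF r(1) _ Ap] sm by auto
    then have "r = p" using p(1) r(1) by (simp add: primes_dvd_imp_eq)
    then show False using r sm by simp
  qed
  then show thesis using that[OF p(1) \<open>s > 0\<close> _ Ap] sm by simp
qed

lemma frobenius_add:
  assumes "prime p" "A (of_nat p) < 1" "A x \<le> 1" "A y \<le> 1"
  shows "(x + y) ^ (p ^ s) \<doteq> x ^ (p ^ s) + y ^ (p ^ s)"
proof (induction s)
  case (Suc s)
  have *: "(u + w) ^ p \<doteq> u ^ p + w ^ p" if "A u \<le> 1" "A w \<le> 1" for u w
  proof -
    have p0: "p > 0" using assms(1) prime_gt_0_nat by blast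
    have "(u + w) ^ p = (\<Sum>k\<le>p. of_nat (p choose k) * u ^ k * w ^ (p - k))" by (rule binomial_ring)
    also have "\<dots> = (\<Sum>k\<in>{1..<p}. of_nat (p choose k) * u ^ k * w ^ (p - k)) + (u ^ p + w ^ p)"
    proof -
      have "{..p} = insert 0 (insert p {1..<p})" using p0 by auto
      then show ?thesis using p0 by (simp add: algebra_simps)
    qed
    also have "\<dots> \<doteq> 0 + (u ^ p + w ^ p)"
    proof (rule cong_add)
      have "of_nat (p choose k) * u ^ k * w ^ (p - k) \<doteq> 0" if k: "k \<in> {1..<p}" for k
      proof -
        have "p dvd (p choose k)" using k assms(1) by (intro dvd_choose_prime) auto
        then obtain m where "p choose k = p * m" by blast
        then have "A (of_nat (p choose k)) < 1"
          using assms(2) A_of_nat_le_1[of m]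
          by (simp add: A_mult) (meson A_nonneg mult_right_le_one_le order_le_less_trans)
        moreover have "A (u ^ k * w ^ (p - k)) \<le> 1"
          using \<open>A u \<le> 1\<close> \<open>A w \<le> 1\<close> by (intro integral_mult integral_power)
        ultimately show ?thesis unfolding cong_0_iff mult.assoc
          by (simp add: A_mult) (metis A_mult A_nonneg mult_right_le_one_le order_le_less_trans)
      qed
      then show "(\<Sum>k\<in>{1..<p}. of_nat (p choose k) * u ^ k * w ^ (p - k)) \<doteq> 0"
        using cong_sum[of "{1..<p}" _ "\<lambda>_. 0"] by simp
    qed simp
    finally show ?thesis by simp
  qed
  have "(x + y) ^ (p ^ Suc s) = ((x + y) ^ (p ^ s)) ^ p"
    by (simp only: power_mult[symmetric] power_Suc mult.commute)
  also have "\<dots> \<doteq> (x ^ (p ^ s) + y ^ (p ^ s)) ^ p"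
    using assms Suc by (intro cong_power integral_add integral_power)
  also have "\<dots> \<doteq> (x ^ (p ^ s)) ^ p + (y ^ (p ^ s)) ^ p"
    using assms by (intro * integral_power)
  finally show ?case by (simp only: power_mult[symmetric] power_Suc mult.commute)
qed simp

end

section \<open>Complete discretely valued fields with finite residue field\<close>

lemma two_powi_less_iff: "(2::real) powi a < 2 powi b \<longleftrightarrow> a < b"
  using power_int_strict_increasing[of a b "2::real"] power_int_strict_increasing[of b a "2::real"]
  by (cases a b rule: linorder_cases) auto

lemma two_powi_le_iff: "(2::real) powi a \<le> 2 powi b \<longleftrightarrow> a \<le> b"
  using two_powi_less_iff[of b a] by (simp add: not_less flip: not_le)

locale local_base =
  fixes v :: "'k::field \<Rightarrow> int"
  assumes local_field: "local_field_on UNIV v"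
begin

text \<open>Any base above 1 gives the same topology; with base 2 an absolute value below another
  one is at most half of it.\<close>

definition nv :: "'k \<Rightarrow> real" where
  "nv c = (if c = 0 then 0 else 2 powi (- v c))"

lemma v_mult: "x \<noteq> 0 \<Longrightarrow> y \<noteq> 0 \<Longrightarrow> v (x * y) = v x + v y"
  using local_field by (auto simp: local_field_on_def discrete_valuation_on_def)

lemma v_add: "x \<noteq> 0 \<Longrightarrow> y \<noteq> 0 \<Longrightarrow> x + y \<noteq> 0 \<Longrightarrow> min (v x) (v y) \<le> v (x + y)"
  using local_field by (auto simp: local_field_on_def discrete_valuation_on_def)

lemma nv_le_iff: "nv c \<le> 2 powi (- m) \<longleftrightarrow> c = 0 \<or> m \<le> v c"
  by (auto simp: nv_def two_powi_le_iff)

lemma nv_less_iff: "nv c < 2 powi (- m) \<longleftrightarrow> c = 0 \<or> m < v c"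
  by (auto simp: nv_def two_powi_less_iff)

sublocale K: nonarch_abs nv
proof
  fix x y :: 'k
  show "nv (x * y) = nv x * nv y"
    by (auto simp: nv_def v_mult power_int_add[symmetric])
  show "nv (x + y) \<le> max (nv x) (nv y)"
  proof (cases "x = 0 \<or> y = 0 \<or> x + y = 0")
    case False
    then have "2 powi (- v (x + y)) \<le> (2 powi max (- v x) (- v y) :: real)"
      using v_add[of x y] by (intro power_int_increasing) auto
    also have "\<dots> = max (2 powi (- v x)) (2 powi (- v y))"
      by (auto simp: max_def two_powi_le_iff)
    finally show ?thesis using False by (simp add: nv_def)
  qed (auto simp: nv_def le_max_iff_disj)
qed (auto simp: nv_def)

lemma ex_nv: "\<exists>c. c \<noteq> 0 \<and> nv c = 2 powi k"
proof -
  have "v ` (UNIV - {0}) = UNIV"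
    using local_field by (auto simp: local_field_on_def discrete_valuation_on_def)
  then obtain c where "c \<noteq> 0" "v c = - k" by (metis DiffE UNIV_I imageE singletonI)
  then show ?thesis by (intro exI[of _ c]) (simp add: nv_def)
qed

text \<open>The value group consists of all powers of 2, so a scalar moves any positive real into
  the interval from 1 to 2. This replaces normalisation to length 1 in the compactness
  argument.\<close>

lemma ex_scale:
  assumes "0 < (r::real)"
  obtains c where "c \<noteq> 0" "1 \<le> nv c * r" "nv c * r < 2"
proof -
  define k where "k = \<lfloor>log 2 r\<rfloor>"
  obtain c where c: "c \<noteq> 0" "nv c = 2 powi (- k)" using ex_nv by blast
  have k: "real_of_int k \<le> log 2 r" "log 2 r < real_of_int k + 1"
    unfolding k_def by linarith+
  have "2 powr k \<le> r" "r < 2 powr (k + 1)"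
    using k assms by (simp_all add: le_log_iff less_log_iff log_less_iff)
  then have pk: "2 powi k \<le> r" "r < 2 powi (k + 1)"
    by (simp_all flip: powr_real_of_int')
  then have "1 \<le> nv c * r" "nv c * r < 2"
    unfolding c by (simp_all add: power_int_minus power_int_add field_simps)
  with c that show thesis by blast
qed

lemma nv_values: "c \<noteq> 0 \<Longrightarrow> nv c = 2 powi (- v c)"
  by (simp add: nv_def)

lemma nv_less_1: "nv c < 1 \<Longrightarrow> nv c \<le> 1 / 2"
  using nv_less_iff[of c 0] nv_le_iff[of c 1] by (auto simp: power_int_minus)

lemma residue_field_eq: "residue_field UNIV v = carrier K.residue_ring"
proof -
  have O: "val_ring UNIV v = {x. nv x \<le> 1}"
    using nv_le_iff[of _ 0] by (auto simp: val_ring_def)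
  have D: "val_dist_ge v 1 x y \<longleftrightarrow> K.cong x y" for x y
    using nv_less_iff[of "x - y" 0] by (auto simp: val_dist_ge_def K.cong_def)
  have "{(x, y). x \<in> val_ring UNIV v \<and> y \<in> val_ring UNIV v \<and> val_dist_ge v 1 x y} `` {x} = K.res x"
    if "nv x \<le> 1" for x
    using that unfolding O D K.res_def
    by (auto intro: K.cong_sym K.cong_integral)
  then show ?thesis unfolding residue_field_def K.residue_ring_carrier quotient_def O by auto
qed

lemma finite_residue: "finite (carrier K.residue_ring)"
  using local_field residue_field_eq by (auto simp: local_field_on_def)

section \<open>Completeness and compactness of balls\<close>

lemma complete:
  assumes "\<And>e. 0 < e \<Longrightarrow> \<exists>N. \<forall>i\<ge>N. \<forall>j\<ge>N. nv (X i - X j) < e"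
  shows "\<exists>l. (\<lambda>n. nv (X n - l)) \<longlonglongrightarrow> 0"
proof -
  have D: "val_dist_ge v m x y \<longleftrightarrow> nv (x - y) \<le> 2 powi (- m)" for m x y
    by (auto simp: val_dist_ge_def nv_le_iff)
  have "\<exists>n0. \<forall>i\<ge>n0. \<forall>j\<ge>n0. val_dist_ge v m (X i) (X j)" for m
    using assms[of "2 powi (- m)"] unfolding D by (auto intro: less_imp_le)
  moreover have "val_complete_on UNIV v" using local_field by (auto simp: local_field_on_def)
  ultimately obtain l where l: "\<And>m. \<exists>n0. \<forall>i\<ge>n0. nv (X i - l) \<le> 2 powi (- m)"
    unfolding val_complete_on_def D by (metis subset_UNIV)
  have "(\<lambda>n. nv (X n - l)) \<longlonglongrightarrow> 0"
  proof (rule LIMSEQ_I)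
    fix e :: real assume "0 < e"
    then obtain m where m: "(1 / 2) ^ m < e" using real_arch_pow_inv[of e "1/2"] by auto
    obtain n0 where "\<forall>i\<ge>n0. nv (X i - l) \<le> 2 powi (- int m)" using l by blast
    moreover have "(2::real) powi (- int m) = (1 / 2) ^ m"
      by (simp add: power_int_minus power_one_over inverse_eq_divide)
    ultimately show "\<exists>n0. \<forall>n\<ge>n0. norm (nv (X n - l) - 0) < e" using m by force
  qed
  then show ?thesis by blast
qed

text \<open>Expansion in powers of a uniformizer \<open>w\<close> with digits among finitely many
  residue representatives: m digits leave finitely many truncations, with error at most 2 to the
  power -m.\<close>

lemma totally_bounded:
  assumes "0 < (e::real)"
  shows "\<exists>F. finite F \<and> (\<forall>x. nv x \<le> R \<longrightarrow> (\<exists>y\<in>F. nv (x - y) < e))"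
proof -
  obtain w where w: "w \<noteq> 0" "nv w = 1 / 2" using ex_nv[of "-1"] by (auto simp: power_int_minus)
  have unit: "\<exists>F. finite F \<and> (\<forall>x. nv x \<le> 1 \<longrightarrow> (\<exists>y\<in>F. nv (x - y) \<le> (1 / 2) ^ m))" for m
  proof (induction m)
    case 0
    then show ?case by (intro exI[of _ "{0}"]) auto
  next
    case (Suc m)
    then obtain F where F: "finite F" "\<And>x. nv x \<le> 1 \<Longrightarrow> \<exists>y\<in>F. nv (x - y) \<le> (1 / 2) ^ m" by blast
    define F' where "F' = (\<lambda>(f, r). f + w ^ m * r) ` (F \<times> K.rep ` carrier K.residue_ring)"
    have "\<exists>y\<in>F'. nv (x - y) \<le> (1 / 2) ^ Suc m" if x: "nv x \<le> 1" for x
    proof -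
      obtain f where f: "f \<in> F" "nv (x - f) \<le> nv w ^ m" using F(2)[OF x] unfolding w(2) by blast
      define z where "z = (x - f) / w ^ m"
      have "nv z \<le> 1" using f(2) w(1) by (simp add: z_def K.A_divide K.A_power divide_le_eq_1)
      then have r: "K.rep (K.res z) \<in> K.rep ` carrier K.residue_ring"
        by (simp add: K.res_in_carrier_iff)
      have "nv (z - K.rep (K.res z)) \<le> 1 / 2"
        using K.rep_res[of z] by (intro nv_less_1) (simp add: K.cong_def K.A_diff_commute)
      then have "nv (w ^ m * (z - K.rep (K.res z))) \<le> (1 / 2) ^ Suc m"
        unfolding K.A_mult K.A_power w(2) by (simp add: field_simps)
      moreover have "w ^ m * (z - K.rep (K.res z)) = x - (f + w ^ m * K.rep (K.res z))"
      proof -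
        have "w ^ m * z = x - f" using w(1) by (simp add: z_def)
        then show ?thesis by (simp add: right_diff_distrib diff_diff_eq)
      qed
      moreover have "f + w ^ m * K.rep (K.res z) \<in> F'"
        unfolding F'_def using f(1) r by (intro image_eqI[of _ _ "(f, K.rep (K.res z))"]) auto
      ultimately show ?thesis by metis
    qed
    moreover have "finite F'" unfolding F'_def using F finite_residue by auto
    ultimately show ?case by blast
  qed
  \<comment> \<open>Multiplication by \<open>w ^ k\<close> carries the ball of radius R into the
    valuation ring. Undoing it magnifies the error by \<open>2 ^ k\<close>, hence the target
    \<open>e / 2 ^ k\<close>.\<close>
  obtain k :: nat where k: "max R 1 < 2 ^ k" using real_arch_pow[of 2 "max R 1"] by auto
  obtain m where m: "(1 / 2) ^ m < e / 2 ^ k" using real_arch_pow_inv[of "e / 2 ^ k" "1 / 2"] assms by auto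
  obtain F where F: "finite F" "\<And>x. nv x \<le> 1 \<Longrightarrow> \<exists>y\<in>F. nv (x - y) \<le> (1 / 2) ^ m" using unit by blast
  have "\<exists>y\<in>(\<lambda>y. y / w ^ k) ` F. nv (x - y) < e" if x: "nv x \<le> R" for x
  proof -
    have "nv (w ^ k * x) \<le> 1"
      using x k unfolding K.A_mult K.A_power w(2) by (simp add: field_simps)
    then obtain y where y: "y \<in> F" "nv (w ^ k * x - y) \<le> (1 / 2) ^ m" using F by blast
    have "nv (x - y / w ^ k) = nv ((w ^ k * x - y) / w ^ k)" using w by (simp add: diff_divide_distrib)
    also have "\<dots> = nv (w ^ k * x - y) * 2 ^ k"
      unfolding K.A_divide K.A_power w(2) by (simp add: power_one_over)
    also have "\<dots> < e"
    proof -
      have "nv (w ^ k * x - y) < e / 2 ^ k" using y(2) m by linarith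
      then show ?thesis by (simp add: pos_less_divide_eq)
    qed
    finally show ?thesis using y by blast
  qed
  with F show ?thesis by (intro exI[of _ "(\<lambda>y. y / w ^ k) ` F"]) auto
qed

lemma convergent_subseq:
  fixes X :: "nat \<Rightarrow> 'k"
  assumes "\<And>n. nv (X n) \<le> R"
  shows "\<exists>r l. strict_mono r \<and> (\<lambda>n. nv (X (r n) - l)) \<longlonglongrightarrow> 0"
proof -
  interpret M: Metric_space UNIV "\<lambda>x y. nv (x - y)"
  proof
    fix x y z
    show "nv (x - z) \<le> nv (x - y) + nv (y - z)"
      using K.A_add_le[of "x - y" "y - z"] K.A_nonneg[of "x - y"] K.A_nonneg[of "y - z"]
      unfolding diff_add_cancel add_diff_eq by linarith
  qed (auto simp: K.A_diff_commute)
  define S where "S = {x. nv x \<le> R}"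
  have "M.mtotally_bounded S"
    unfolding M.mtotally_bounded_def
  proof (intro allI impI)
    fix e :: real assume "0 < e"
    then obtain F where F: "finite F" "\<And>x. nv x \<le> R \<Longrightarrow> \<exists>y\<in>F. nv (x - y) < e"
      using totally_bounded by blast
    \<comment> \<open>The centres in \<open>F\<close> need not lie in \<open>S\<close>, as total
      boundedness requires. Each ball that meets \<open>S\<close> is recentred at a point of
      \<open>S\<close>; the ultrametric inequality keeps its radius.\<close>
    define c where "c f = (SOME s. s \<in> S \<and> nv (s - f) < e)" for f
    define F' where "F' = {f \<in> F. \<exists>s\<in>S. nv (s - f) < e}"
    have c: "c f \<in> S \<and> nv (c f - f) < e" if "f \<in> F'" for f
    proof -
      have "\<exists>s. s \<in> S \<and> nv (s - f) < e" using that by (auto simp: F'_def)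
      from someI_ex[OF this] show ?thesis by (simp only: c_def)
    qed
    have "\<exists>f\<in>F'. nv (c f - x) < e" if "x \<in> S" for x
    proof -
      obtain f where f: "f \<in> F" "nv (x - f) < e" using F(2)[of x] \<open>x \<in> S\<close> by (auto simp: S_def)
      then have "f \<in> F'" using \<open>x \<in> S\<close> by (auto simp: F'_def)
      moreover have "nv (c f - x) < e"
        using c[OF \<open>f \<in> F'\<close>] f(2) K.A_diff_le[of "c f - f" "x - f"]
        by (auto simp: max_def split: if_splits)
      ultimately show ?thesis by blast
    qed
    then have "S \<subseteq> (\<Union>x\<in>c ` F'. M.mball x e)" by auto
    moreover have "finite (c ` F')" using F by (simp add: F'_def)
    ultimately show "\<exists>K. finite K \<and> K \<subseteq> S \<and> S \<subseteq> (\<Union>x\<in>K. M.mball x e)" using c by blast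
  qed
  then have seq: "\<forall>\<sigma>::nat \<Rightarrow> 'k. range \<sigma> \<subseteq> S \<longrightarrow> (\<exists>r. strict_mono r \<and> M.MCauchy (\<sigma> \<circ> r))"
    unfolding M.mtotally_bounded_sequentially by (rule conjunct2)
  have "range X \<subseteq> S" using assms by (auto simp: S_def)
  from seq[rule_format, OF this] obtain r where r: "strict_mono r" "M.MCauchy (X \<circ> r)"
    by (elim exE conjE)
  have "\<exists>N. \<forall>i\<ge>N. \<forall>j\<ge>N. nv ((X \<circ> r) i - (X \<circ> r) j) < e" if "0 < e" for e
    using r(2)[unfolded M.MCauchy_def, THEN conjunct2, rule_format, OF that] by (rule ex_forward) auto
  then have "\<exists>l. (\<lambda>n. nv ((X \<circ> r) n - l)) \<longlonglongrightarrow> 0" by (rule complete)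
  with r(1) show ?thesis by auto
qed

lemma convergent_subseq_finite:
  fixes X :: "'b \<Rightarrow> nat \<Rightarrow> 'k"
  assumes "finite S" "\<And>b n. b \<in> S \<Longrightarrow> nv (X b n) \<le> R"
  shows "\<exists>r. strict_mono r \<and> (\<forall>b\<in>S. \<exists>l. (\<lambda>n. nv (X b (r n) - l)) \<longlonglongrightarrow> 0)"
  using assms
proof (induction S rule: finite_induct)
  case empty
  show ?case by (intro exI[of _ "\<lambda>n. n"]) (auto simp: strict_mono_def)
next
  case (insert a S)
  then obtain r where r: "strict_mono r" "\<And>b. b \<in> S \<Longrightarrow> \<exists>l. (\<lambda>n. nv (X b (r n) - l)) \<longlonglongrightarrow> 0" by auto
  obtain s m where s: "strict_mono s" "(\<lambda>n. nv (X a (r (s n)) - m)) \<longlonglongrightarrow> 0"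
    using convergent_subseq[of "\<lambda>n. X a (r n)" R] insert.prems by auto
  have "\<exists>l. (\<lambda>n. nv (X b ((r \<circ> s) n) - l)) \<longlonglongrightarrow> 0" if "b \<in> insert a S" for b
  proof (cases "b = a")
    case True
    then show ?thesis using s by auto
  next
    case False
    then have "b \<in> S" using that by simp
    from r(2)[OF this] obtain l where "(\<lambda>n. nv (X b (r n) - l)) \<longlonglongrightarrow> 0" by blast
    from LIMSEQ_subseq_LIMSEQ[OF this s(1)] show ?thesis by (auto simp: o_def)
  qed
  then show ?case using r(1) s(1) strict_mono_o by blast
qed

end

section \<open>The absolute value on a finite Galois extension\<close>

locale local_galois = local_base v for v :: "'k::field \<Rightarrow> int" +
  fixes \<iota> :: "'k \<Rightarrow> 'n::field"
  assumes embedding: "field_embedding \<iota>"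
    and galois: "galois_ext \<iota> (UNIV :: 'n set)"
begin

lemma \<iota>_add: "\<iota> (x + y) = \<iota> x + \<iota> y"
  and \<iota>_mult: "\<iota> (x * y) = \<iota> x * \<iota> y"
  and \<iota>_1 [simp]: "\<iota> 1 = 1"
  using embedding by (auto simp: field_embedding_def)

lemma \<iota>_0 [simp]: "\<iota> 0 = 0"
  by (metis \<iota>_add add_cancel_left_left)

lemma \<iota>_uminus: "\<iota> (- x) = - \<iota> x"
  by (metis \<iota>_0 \<iota>_add add.right_inverse add_eq_0_iff)

lemma \<iota>_diff: "\<iota> (x - y) = \<iota> x - \<iota> y"
  by (metis \<iota>_add \<iota>_uminus diff_conv_add_uminus)

lemma \<iota>_eq_0_iff [simp]: "\<iota> x = 0 \<longleftrightarrow> x = 0"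
  by (metis \<iota>_0 \<iota>_1 \<iota>_mult mult_zero_left right_inverse zero_neq_one)

lemma \<iota>_inj: "inj \<iota>"
  by (rule injI) (metis \<iota>_diff \<iota>_eq_0_iff eq_iff_diff_eq_0)

lemma \<iota>_power: "\<iota> (x ^ n) = \<iota> x ^ n"
  by (induction n) (simp_all add: \<iota>_mult)

lemma \<iota>_of_nat: "\<iota> (of_nat n) = of_nat n"
  by (induction n) (simp_all add: \<iota>_add)

sublocale V: vector_space "\<lambda>c x. \<iota> c * x"
  by unfold_locales (simp_all add: \<iota>_add \<iota>_mult algebra_simps)

abbreviation G :: "('n \<Rightarrow> 'n) set" where
  "G \<equiv> Gal (range \<iota>) UNIV"

lemma G_iff: "g \<in> G \<longleftrightarrow> bij g \<and> (\<forall>x y. g (x + y) = g x + g y \<and> g (x * y) = g x * g y) \<and> (\<forall>c. g (\<iota> c) = \<iota> c)"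
  by (auto simp: Gal_def extensional_def)

lemma G_bij: "g \<in> G \<Longrightarrow> bij g"
  and G_add: "g \<in> G \<Longrightarrow> g (x + y) = g x + g y"
  and G_mult: "g \<in> G \<Longrightarrow> g (x * y) = g x * g y"
  and G_\<iota>: "g \<in> G \<Longrightarrow> g (\<iota> c) = \<iota> c"
  by (auto simp: G_iff)

lemma G_0 [simp]: "g \<in> G \<Longrightarrow> g 0 = 0"
  and G_1 [simp]: "g \<in> G \<Longrightarrow> g 1 = 1"
  using G_\<iota>[of g 0] G_\<iota>[of g 1] by simp_all

lemma G_inj: "g \<in> G \<Longrightarrow> g x = g y \<longleftrightarrow> x = y"
  using G_bij[of g] by (meson bij_is_inj injD)

lemma G_eq_0_iff [simp]: "g \<in> G \<Longrightarrow> g x = 0 \<longleftrightarrow> x = 0"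
  using G_inj[of g x 0] by simp

lemma G_uminus: "g \<in> G \<Longrightarrow> g (- x) = - g x"
  by (metis G_0 G_add add.right_inverse add_eq_0_iff)

lemma G_diff: "g \<in> G \<Longrightarrow> g (x - y) = g x - g y"
  by (metis G_add G_uminus diff_conv_add_uminus)

lemma G_inverse: "g \<in> G \<Longrightarrow> g (inverse x) = inverse (g x)"
  by (cases "x = 0") (simp, metis G_1 G_mult inverse_unique right_inverse)

lemma G_divide: "g \<in> G \<Longrightarrow> g (x / y) = g x / g y"
  by (simp add: divide_inverse G_mult G_inverse)

lemma G_power: "g \<in> G \<Longrightarrow> g (x ^ n) = g x ^ n"
  by (induction n) (simp_all add: G_mult)

lemma G_sum: "g \<in> G \<Longrightarrow> g (sum f S) = (\<Sum>i\<in>S. g (f i))"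
  by (induction S rule: infinite_finite_induct) (simp_all add: G_add)

lemma G_prod: "g \<in> G \<Longrightarrow> g (prod f S) = (\<Prod>i\<in>S. g (f i))"
  by (induction S rule: infinite_finite_induct) (simp_all add: G_mult)

lemma G_id: "(\<lambda>x. x) \<in> G"
  by (auto simp: G_iff bij_def surj_def inj_def)

lemma G_comp: "g \<in> G \<Longrightarrow> h \<in> G \<Longrightarrow> g \<circ> h \<in> G"
  by (auto simp: G_iff bij_comp)

lemma G_inv:
  assumes "g \<in> G"
  shows "inv_into UNIV g \<in> G"
proof -
  have *: "g (inv_into UNIV g x) = x" for x using G_bij[OF assms] by (simp add: bij_is_surj surj_f_inv_f)
  have "inv_into UNIV g (x + y) = inv_into UNIV g x + inv_into UNIV g y" "inv_into UNIV g (x * y) = inv_into UNIV g x * inv_into UNIV g y" for x y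
    by (subst G_inj[OF assms, symmetric], simp add: * G_add[OF assms] G_mult[OF assms])+
  moreover have "inv_into UNIV g (\<iota> c) = \<iota> c" for c
    by (subst G_inj[OF assms, symmetric], simp add: * G_\<iota>[OF assms])
  ultimately show ?thesis using G_bij[OF assms] by (simp add: G_iff bij_imp_bij_inv)
qed

lemma G_inv_left [simp]: "g \<in> G \<Longrightarrow> inv_into UNIV g (g x) = x"
  and G_inv_right [simp]: "g \<in> G \<Longrightarrow> g (inv_into UNIV g x) = x"
  using G_bij[of g] by (simp_all add: bij_is_inj bij_is_surj surj_f_inv_f)

lemma fixed_by_G: "(\<And>g. g \<in> G \<Longrightarrow> g x = x) \<Longrightarrow> x \<in> range \<iota>"
  using galois by (auto simp: galois_ext_def)

section \<open>Coordinates, algebraic relations and finiteness of the Galois group\<close>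

lemma ex_basis: "\<exists>B. finite B \<and> V.independent B \<and> V.span B = (UNIV :: 'n set)"
proof -
  obtain B where B: "finite B" "UNIV = V.span (B :: 'n set)"
    using galois unfolding galois_ext_def finite_ext_def by blast
  obtain B' where B': "B' \<subseteq> B" "V.independent B'" "B \<subseteq> V.span B'"
    using V.maximal_independent_subset[of B] by blast
  have "V.span B' = UNIV" using B' B by (metis V.span_mono V.span_span top.extremum_uniqueI)
  then show ?thesis using B'(2) finite_subset[OF B'(1) B(1)] by (intro exI[of _ B'] conjI)
qed

definition basis :: "'n set" where
  "basis = (SOME B. finite B \<and> V.independent B \<and> V.span B = UNIV)"

lemma finite_basis [simp]: "finite basis"
  and independent_basis: "V.independent basis"
  and span_basis: "V.span basis = UNIV"
  using someI_ex[OF ex_basis] by (auto simp: basis_def)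

definition co :: "'n \<Rightarrow> 'n \<Rightarrow> 'k" where
  "co b x = V.representation basis x b"

lemma co_add: "co b (x + y) = co b x + co b y"
  by (simp add: co_def V.representation_add independent_basis span_basis)

lemma co_diff: "co b (x - y) = co b x - co b y"
  by (simp add: co_def V.representation_diff independent_basis span_basis)

lemma co_scale: "co b (\<iota> c * x) = c * co b x"
  by (simp add: co_def V.representation_scale independent_basis span_basis)

lemma sum_co: "(\<Sum>b\<in>basis. \<iota> (co b x) * b) = x"
  unfolding co_def by (rule V.sum_representation_eq) (auto simp: independent_basis span_basis)

lemma co_sum_basis:
  assumes "b \<in> basis"
  shows "co b (\<Sum>b'\<in>basis. \<iota> (l b') * b') = l b"
proof -
  have "V.representation basis (\<Sum>b'\<in>basis. \<iota> (l b') * b') b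
      = (\<Sum>b'\<in>basis. V.representation basis (\<iota> (l b') * b') b)"
    by (subst V.representation_sum) (auto simp: independent_basis span_basis)
  also have "\<dots> = (\<Sum>b'\<in>basis. if b = b' then l b' else 0)"
    by (rule sum.cong) (auto simp: V.representation_scale V.representation_basis independent_basis span_basis)
  also have "\<dots> = l b" using assms by simp
  finally show ?thesis by (simp add: co_def)
qed

text \<open>There are more powers of x than the dimension allows. Linear dependence concerns the set
  of powers rather than the family, so two coinciding powers are treated apart, with a difference of
  two monomials.\<close>

lemma algebraic:
  obtains p :: "'n poly" where "p \<noteq> 0" "\<And>i. coeff p i \<in> range \<iota>" "poly p x = 0"
proof -
  let ?d = "card basis"
  show thesis
  proof (cases "inj_on (\<lambda>i. x ^ i) {..?d}")
    case True
    let ?S = "(\<lambda>i. x ^ i) ` {..?d}"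
    have "card ?S = Suc ?d" using True by (simp add: card_image)
    moreover have "V.dim ?S \<le> ?d"
      using V.dim_le_card[of ?S basis] span_basis by simp
    ultimately have "V.dependent ?S"
      using V.dim_eq_card_independent[of ?S] by force
    then obtain u where u: "\<exists>s\<in>?S. u s \<noteq> 0" "(\<Sum>s\<in>?S. \<iota> (u s) * s) = 0"
      using V.dependent_finite[of ?S] by auto
    define p where "p = (\<Sum>i\<le>?d. monom (\<iota> (u (x ^ i))) i)"
    have cp: "coeff p i = (if i \<le> ?d then \<iota> (u (x ^ i)) else 0)" for i
      by (simp add: p_def coeff_sum)
    have "p \<noteq> 0" using u(1) cp by (metis \<iota>_eq_0_iff atMost_iff coeff_0 imageE)
    moreover have "coeff p i \<in> range \<iota>" for i using cp \<iota>_0 by (metis rangeI)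
    moreover have "poly p x = 0"
      using u(2) True by (simp add: p_def poly_sum poly_monom sum.reindex)
    ultimately show thesis by (rule that)
  next
    case False
    then obtain i j where ij: "i < j" "x ^ i = x ^ j"
      unfolding inj_on_def by (metis linorder_neqE_nat)
    define p :: "'n poly" where "p = monom 1 j - monom 1 i"
    have "coeff p j = 1" using ij by (simp add: p_def)
    then have "p \<noteq> 0" by auto
    moreover have "coeff p k \<in> range \<iota>" for k
    proof -
      have "coeff p k = \<iota> ((if j = k then 1 else 0) - (if i = k then 1 else 0))"
        by (simp add: p_def \<iota>_diff)
      then show ?thesis by blast
    qed
    moreover have "poly p x = 0" using ij by (simp add: p_def poly_monom)
    ultimately show thesis by (rule that)
  qed
qed

lemma G_poly:
  assumes "g \<in> G" "\<And>i. coeff p i \<in> range \<iota>"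
  shows "g (poly p x) = poly p (g x)"
proof -
  have "g (coeff p i) = coeff p i" for i using assms(2)[of i] G_\<iota>[OF assms(1)] by auto
  then show ?thesis using assms(1) by (simp add: poly_altdef G_sum G_mult G_power)
qed

text \<open>An automorphism is determined by its values on the basis, and each value is a root of a
  nonzero polynomial with coefficients in K.\<close>

lemma finite_G: "finite G"
proof -
  have "\<exists>R. finite R \<and> (\<forall>g\<in>G. g x \<in> R)" for x
  proof -
    obtain p :: "'n poly" where p: "p \<noteq> 0" "\<And>i. coeff p i \<in> range \<iota>" "poly p x = 0"
      using algebraic by blast
    have "finite {z. poly p z = 0}" using p by (simp add: poly_roots_finite)
    moreover have "poly p (g x) = 0" if "g \<in> G" for g
      using G_poly[OF that p(2), of x] p(3) that by simp
    ultimately show ?thesis by blast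
  qed
  then obtain R where R: "\<And>x. finite (R x)" "\<And>x g. g \<in> G \<Longrightarrow> g x \<in> R x" by metis
  let ?r = "\<lambda>g. restrict g basis"
  have "inj_on ?r G"
  proof (rule inj_onI)
    fix g h assume gh: "g \<in> G" "h \<in> G" "?r g = ?r h"
    have "g x = h x" for x
    proof -
      have "g x = g (\<Sum>b\<in>basis. \<iota> (co b x) * b)" by (simp add: sum_co)
      also have "\<dots> = (\<Sum>b\<in>basis. \<iota> (co b x) * g b)" using gh by (simp add: G_sum G_mult G_\<iota>)
      also have "\<dots> = (\<Sum>b\<in>basis. \<iota> (co b x) * h b)"
        using gh(3) by (intro sum.cong) (auto dest: fun_cong split: if_splits simp: restrict_def)
      also have "\<dots> = h (\<Sum>b\<in>basis. \<iota> (co b x) * b)" using gh by (simp add: G_sum G_mult G_\<iota>)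
      finally show ?thesis by (simp add: sum_co)
    qed
    then show "g = h" by blast
  qed
  moreover have "?r ` G \<subseteq> PiE basis R" using R by auto
  moreover have "finite (PiE basis R)" using R by (intro finite_PiE) auto
  ultimately show ?thesis by (meson finite_imageD finite_subset)
qed

lemma card_G: "0 < card G"
  using finite_G G_id by (auto simp: card_gt_0_iff)

lemma G_reindex:
  assumes "h \<in> G"
  shows "bij_betw (\<lambda>g. h \<circ> g) G G" "bij_betw (\<lambda>g. g \<circ> h) G G"
proof -
  have "inv_into UNIV h \<in> G" by (rule G_inv[OF assms])
  then show "bij_betw (\<lambda>g. h \<circ> g) G G"
    using assms
    by (intro bij_betwI[where g = "\<lambda>g. inv_into UNIV h \<circ> g"]) (auto intro: G_comp simp: fun_eq_iff)
  show "bij_betw (\<lambda>g. g \<circ> h) G G"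
    using assms \<open>inv_into UNIV h \<in> G\<close>
    by (intro bij_betwI[where g = "\<lambda>g. g \<circ> inv_into UNIV h"]) (auto intro: G_comp simp: fun_eq_iff)
qed

section \<open>The norm from N to K\<close>

definition nr :: "'n \<Rightarrow> 'n" where
  "nr x = (\<Prod>g\<in>G. g x)"

lemma nr_in_range: "nr x \<in> range \<iota>"
proof (rule fixed_by_G)
  fix h assume h: "h \<in> G"
  have "h (nr x) = (\<Prod>g\<in>G. (h \<circ> g) x)" using h by (simp add: nr_def G_prod)
  also have "\<dots> = nr x" unfolding nr_def
    by (rule prod.reindex_bij_betw[OF G_reindex(1)[OF h], of "\<lambda>g. g x"])
  finally show "h (nr x) = nr x" .
qed

lemma nr_G: "h \<in> G \<Longrightarrow> nr (h x) = nr x"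
  unfolding nr_def using prod.reindex_bij_betw[OF G_reindex(2), of h "\<lambda>g. g x"] by simp

definition knr :: "'n \<Rightarrow> 'k" where
  "knr x = inv_into UNIV \<iota> (nr x)"

lemma \<iota>_knr: "\<iota> (knr x) = nr x"
  using nr_in_range by (simp add: knr_def f_inv_into_f)

lemma knr_eqI: "nr x = \<iota> c \<Longrightarrow> knr x = c"
  by (simp add: knr_def \<iota>_inj)

lemma knr_mult: "knr (x * y) = knr x * knr y"
  by (rule knr_eqI) (simp add: \<iota>_mult \<iota>_knr, simp add: nr_def G_mult prod.distrib)

lemma knr_\<iota>: "knr (\<iota> c) = c ^ card G"
  by (rule knr_eqI) (simp add: \<iota>_power nr_def G_\<iota>)

lemma knr_eq_0_iff: "knr x = 0 \<longleftrightarrow> x = 0"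
proof -
  have "knr x = 0 \<longleftrightarrow> nr x = 0" by (metis \<iota>_eq_0_iff \<iota>_knr)
  also have "\<dots> \<longleftrightarrow> x = 0" using finite_G G_id by (auto simp: nr_def)
  finally show ?thesis .
qed

text \<open>The extension of the absolute value of the base field, up to the normalising
  exponent \<open>1 / card G\<close>.\<close>

definition av :: "'n \<Rightarrow> real" where
  "av x = nv (knr x)"

lemma av_mult: "av (x * y) = av x * av y"
  by (simp add: av_def knr_mult K.A_mult)

lemma av_eq_0_iff: "av x = 0 \<longleftrightarrow> x = 0"
  by (simp add: av_def knr_eq_0_iff)

lemma av_0 [simp]: "av 0 = 0"
  by (simp add: av_eq_0_iff)

lemma av_nonneg: "0 \<le> av x"
  by (simp add: av_def)

lemma av_\<iota>: "av (\<iota> c) = nv c ^ card G"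
  by (simp add: av_def knr_\<iota> K.A_power)

lemma av_G: "g \<in> G \<Longrightarrow> av (g x) = av x"
  by (simp add: av_def knr_def nr_G)

lemma av_power: "av (x ^ n) = av x ^ n"
proof (induction n)
  case 0
  then show ?case using av_\<iota>[of 1] by simp
qed (simp add: av_mult)

subsection \<open>A submultiplicative norm\<close>

text \<open>The maximum norm of the coordinates. The inserted 0 makes the set nonempty and the norm
  nonnegative without a further look at \<open>basis\<close>.\<close>

definition cn :: "'n \<Rightarrow> real" where
  "cn x = Max (insert 0 ((\<lambda>b. nv (co b x)) ` basis))"

lemma cn_le_iff: "cn x \<le> r \<longleftrightarrow> 0 \<le> r \<and> (\<forall>b\<in>basis. nv (co b x) \<le> r)"
  unfolding cn_def by (subst Max_le_iff) auto

lemma cn_less_iff: "cn x < r \<longleftrightarrow> 0 < r \<and> (\<forall>b\<in>basis. nv (co b x) < r)"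
  unfolding cn_def by (subst Max_less_iff) auto

lemma cn_nonneg: "0 \<le> cn x"
  using cn_le_iff[of x "cn x"] by simp

lemma nv_co_le: "b \<in> basis \<Longrightarrow> nv (co b x) \<le> cn x"
  using cn_le_iff[of x "cn x"] by simp

lemma cn_eq_0_iff: "cn x = 0 \<longleftrightarrow> x = 0"
proof
  assume "cn x = 0"
  then have "nv (co b x) = 0" if "b \<in> basis" for b
    using nv_co_le[OF that, of x] K.A_nonneg[of "co b x"] by linarith
  then have "(\<Sum>b\<in>basis. \<iota> (co b x) * b) = 0" by (intro sum.neutral) auto
  then show "x = 0" by (simp add: sum_co)
next
  assume "x = 0"
  then show "cn x = 0" using cn_le_iff[of 0 0] co_scale[of _ 0 0] cn_nonneg[of x] by auto
qed

lemma cn_0 [simp]: "cn 0 = 0"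
  by (simp add: cn_eq_0_iff)

lemma cn_add_le: "cn (x + y) \<le> max (cn x) (cn y)"
proof -
  have "nv (co b (x + y)) \<le> max (cn x) (cn y)" if "b \<in> basis" for b
    using K.A_add_le[of "co b x" "co b y"] nv_co_le[OF that, of x] nv_co_le[OF that, of y]
    unfolding co_add by linarith
  moreover have "0 \<le> max (cn x) (cn y)" using cn_nonneg[of x] by simp
  ultimately show ?thesis unfolding cn_le_iff[of "x + y"] by blast
qed

lemma cn_scale: "cn (\<iota> c * x) = nv c * cn x"
proof -
  have le: "cn (\<iota> c * x) \<le> nv c * cn x" for c x
    by (simp add: cn_le_iff cn_nonneg co_scale K.A_mult mult_left_mono nv_co_le)
  show ?thesis
  proof (cases "c = 0")
    case False
    have "cn x = cn (\<iota> (inverse c) * (\<iota> c * x))" using False by (simp add: mult.assoc[symmetric] \<iota>_mult[symmetric])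
    also have "\<dots> \<le> cn (\<iota> c * x) / nv c" using le[of "inverse c" "\<iota> c * x"]
      by (simp only: K.A_inverse divide_inverse mult.commute[of "inverse (nv c)"])
    finally have "nv c * cn x \<le> cn (\<iota> c * x)" using False by (simp add: field_simps)
    with le[of c x] show ?thesis by linarith
  qed (simp add: cn_eq_0_iff)
qed

lemma cn_sum_le: "(\<And>i. i \<in> S \<Longrightarrow> cn (f i) \<le> r) \<Longrightarrow> 0 \<le> r \<Longrightarrow> cn (sum f S) \<le> r"
proof (induction S rule: infinite_finite_induct)
  case (insert x S)
  then have "cn (f x) \<le> r" "cn (sum f S) \<le> r" by auto
  then show ?case using cn_add_le[of "f x" "sum f S"] insert.hyps by auto
qed (auto simp: cn_eq_0_iff)

text \<open>Serves for multiplication by a basis element and for the automorphisms in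
  \<open>G\<close>. The summand 1 in the constant only ensures positivity.\<close>

lemma cn_linear_bound:
  assumes add: "\<And>x y. f (x + y) = f x + f y" and scale: "\<And>c x. f (\<iota> c * x) = \<iota> c * f x"
  shows "\<exists>C>0. \<forall>x. cn (f x) \<le> C * cn x"
proof -
  define C where "C = 1 + (\<Sum>b\<in>basis. cn (f b))"
  have C: "0 < C" unfolding C_def by (intro add_pos_nonneg sum_nonneg) (auto simp: cn_nonneg)
  have f0: "f 0 = 0" using scale[of 0 0] by simp
  have fsum: "f (sum h S) = (\<Sum>i\<in>S. f (h i))" for h and S :: "'n set"
    by (induction S rule: infinite_finite_induct) (simp_all add: f0 add)
  have "cn (f x) \<le> C * cn x" for x
  proof -
    have "f x = f (\<Sum>b\<in>basis. \<iota> (co b x) * b)" by (simp add: sum_co)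
    also have "\<dots> = (\<Sum>b\<in>basis. \<iota> (co b x) * f b)" by (simp add: fsum scale)
    also have "cn \<dots> \<le> C * cn x"
    proof (rule cn_sum_le)
      fix b assume b: "b \<in> basis"
      have "cn (f b) \<le> (\<Sum>b\<in>basis. cn (f b))" using b by (intro member_le_sum) (auto simp: cn_nonneg)
      then have "cn (f b) \<le> C" by (simp add: C_def)
      then show "cn (\<iota> (co b x) * f b) \<le> C * cn x"
        unfolding cn_scale mult.commute[of C]
        using b by (intro mult_mono nv_co_le cn_nonneg) auto
    qed (use C cn_nonneg[of x] in simp)
    finally show ?thesis .
  qed
  with C show ?thesis by blast
qed

lemma cn_mult_bound: "\<exists>C>0. \<forall>x y. cn (x * y) \<le> C * (cn x * cn y)"
proof -
  have "\<exists>C>0. \<forall>y. cn (b * y) \<le> C * cn y" for b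
    by (rule cn_linear_bound) (auto simp: algebra_simps)
  then obtain C where C: "\<And>b. C b > 0" "\<And>b y. cn (b * y) \<le> C b * cn y" by metis
  define D where "D = 1 + (\<Sum>b\<in>basis. C b)"
  have D: "0 < D" unfolding D_def using C by (intro add_pos_nonneg sum_nonneg) (auto intro: less_imp_le)
  have "cn (x * y) \<le> D * (cn x * cn y)" for x y
  proof -
    have "x * y = (\<Sum>b\<in>basis. \<iota> (co b x) * b) * y" by (simp add: sum_co)
    also have "\<dots> = (\<Sum>b\<in>basis. \<iota> (co b x) * (b * y))" by (simp add: sum_distrib_right mult.assoc)
    also have "cn \<dots> \<le> D * (cn x * cn y)"
    proof (rule cn_sum_le)
      fix b assume b: "b \<in> basis"
      have "C b \<le> (\<Sum>b\<in>basis. C b)" using b C by (intro member_le_sum) (auto intro: less_imp_le)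
      then have "C b \<le> D" by (simp add: D_def)
      then have "cn (b * y) \<le> D * cn y"
        using C(2)[of b y] cn_nonneg[of y] by (meson mult_right_mono order_trans)
      then have "nv (co b x) * cn (b * y) \<le> cn x * (D * cn y)"
        using b by (intro mult_mono nv_co_le cn_nonneg) auto
      then show "cn (\<iota> (co b x) * (b * y)) \<le> D * (cn x * cn y)"
        unfolding cn_scale by (simp only: mult.left_commute[of D])
    qed (use D cn_nonneg[of x] cn_nonneg[of y] in simp)
    finally show ?thesis .
  qed
  with D show ?thesis by blast
qed

definition cmul :: real where
  "cmul = (SOME C. C > 0 \<and> (\<forall>x y. cn (x * y) \<le> C * (cn x * cn y)))"

lemma cmul: "cmul > 0" "cn (x * y) \<le> cmul * (cn x * cn y)"
  using someI_ex[OF cn_mult_bound] by (auto simp: cmul_def)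

text \<open>Rescaling by the constant of bilinearity makes the norm submultiplicative. The price is
  that \<open>bn 1\<close> need not be 1, so this factor accompanies scalars below.\<close>

definition bn :: "'n \<Rightarrow> real" where
  "bn x = cmul * cn x"

lemma bn_nonneg [simp]: "0 \<le> bn x"
  using cmul(1) by (simp add: bn_def cn_nonneg)

lemma bn_eq_0_iff [simp]: "bn x = 0 \<longleftrightarrow> x = 0"
  using cmul(1) by (simp add: bn_def cn_eq_0_iff)

lemma bn_0 [simp]: "bn 0 = 0"
  by (simp add: bn_def)

lemma bn_mult: "bn (x * y) \<le> bn x * bn y"
  using cmul(1) mult_left_mono[OF cmul(2)[of x y], of cmul] by (simp add: bn_def algebra_simps)

lemma bn_add_le: "bn (x + y) \<le> max (bn x) (bn y)"
  using mult_left_mono[OF cn_add_le[of x y], of cmul] cmul(1) by (simp add: bn_def max_mult_distrib_left)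

lemma bn_scale: "bn (\<iota> c * x) = nv c * bn x"
  by (simp add: bn_def cn_scale)

lemma bn_\<iota>: "bn (\<iota> c) = nv c * bn 1"
  using bn_scale[of c 1] by simp

lemma bn_sum_le: "(\<And>i. i \<in> S \<Longrightarrow> bn (f i) \<le> r) \<Longrightarrow> 0 \<le> r \<Longrightarrow> bn (sum f S) \<le> r"
proof (induction S rule: infinite_finite_induct)
  case (insert x S)
  then have "bn (f x) \<le> r" "bn (sum f S) \<le> r" by auto
  then show ?case using bn_add_le[of "f x" "sum f S"] insert.hyps by auto
qed auto

section \<open>Equivalence of the norm absolute value with the lattice norm\<close>

lemma bn_G_bound: "\<exists>C>0. \<forall>g\<in>G. \<forall>x. bn (g x) \<le> C * bn x"
proof -
  have "\<exists>C>0. \<forall>x. cn (g x) \<le> C * cn x" if "g \<in> G" for g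
    by (rule cn_linear_bound) (simp_all add: G_add G_mult G_\<iota> that)
  then obtain C where C: "\<And>g. g \<in> G \<Longrightarrow> C g > 0" "\<And>g x. g \<in> G \<Longrightarrow> cn (g x) \<le> C g * cn x" by metis
  define D where "D = 1 + (\<Sum>g\<in>G. C g)"
  have D: "0 < D" unfolding D_def using C by (intro add_pos_nonneg sum_nonneg) (auto intro: less_imp_le)
  have "bn (g x) \<le> D * bn x" if g: "g \<in> G" for g x
  proof -
    have "C g \<le> (\<Sum>g\<in>G. C g)" using g C finite_G by (intro member_le_sum) (auto intro: less_imp_le)
    then have "C g \<le> D" by (simp add: D_def)
    then have "cn (g x) \<le> D * cn x"
      using C(2)[OF g, of x] cn_nonneg[of x] by (meson mult_right_mono order_trans)
    then show ?thesis using cmul(1) by (simp add: bn_def mult.left_commute)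
  qed
  with D show ?thesis by blast
qed

text \<open>The norm is a product of \<open>card G\<close> conjugates, each bounded by a multiple of
  \<open>bn x\<close>; this explains the exponent.\<close>

lemma av_le_bn: "\<exists>C>0. \<forall>x. av x \<le> C * bn x ^ card G"
proof -
  obtain C where C: "C > 0" "\<And>g x. g \<in> G \<Longrightarrow> bn (g x) \<le> C * bn x" using bn_G_bound by blast
  have b1: "0 < bn 1" using bn_nonneg[of 1] bn_eq_0_iff[of 1] by (metis less_le zero_neq_one)
  have prod: "bn (prod f S) \<le> bn 1 * (\<Prod>i\<in>S. bn (f i))" for f :: "('n \<Rightarrow> 'n) \<Rightarrow> 'n" and S
  proof (induction S rule: infinite_finite_induct)
    case (insert x S)
    have "bn (prod f (insert x S)) \<le> bn (f x) * bn (prod f S)" using insert.hyps bn_mult by simp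
    also have "\<dots> \<le> bn (f x) * (bn 1 * (\<Prod>i\<in>S. bn (f i)))" using insert.IH by (intro mult_left_mono) auto
    finally show ?case using insert.hyps by (simp add: mult.left_commute)
  qed auto
  have "av x \<le> C ^ card G * bn x ^ card G" for x
  proof -
    have "av x * bn 1 = bn (nr x)" by (simp add: av_def bn_\<iota>[symmetric] \<iota>_knr)
    also have "\<dots> \<le> bn 1 * (\<Prod>g\<in>G. bn (g x))" unfolding nr_def by (rule prod)
    also have "\<dots> \<le> bn 1 * (\<Prod>g\<in>G. C * bn x)" using b1 C by (intro mult_left_mono prod_mono) auto
    finally show ?thesis using b1 by (simp add: power_mult_distrib mult.commute)
  qed
  then show ?thesis using C by (intro exI[of _ "C ^ card G"]) auto
qed

text \<open>Continuity of the norm, by splitting ab - a'b' into (a - a')b + a'(b - b'). Partial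
  products are needed for the induction.\<close>

lemma prod_tendsto:
  assumes "(\<lambda>m. bn (X m - y)) \<longlonglongrightarrow> 0" and "finite S" "S \<subseteq> G"
  shows "(\<lambda>m. bn ((\<Prod>g\<in>S. g (X m)) - (\<Prod>g\<in>S. g y))) \<longlonglongrightarrow> 0"
  using assms(2,3)
proof (induction S rule: finite_induct)
  case (insert g S)
  obtain C where C: "C > 0" "\<And>g x. g \<in> G \<Longrightarrow> bn (g x) \<le> C * bn x" using bn_G_bound by blast
  define P where "P m = (\<Prod>g\<in>S. g (X m))" for m
  define Q where "Q = (\<Prod>g\<in>S. g y)"
  have IH: "(\<lambda>m. bn (P m - Q)) \<longlonglongrightarrow> 0" using insert by (simp add: P_def Q_def)
  have g: "g \<in> G" using insert.prems by simp
  have bound: "bn ((\<Prod>g\<in>insert g S. g (X m)) - (\<Prod>g\<in>insert g S. g y))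
      \<le> C * bn (X m - y) * (bn (P m - Q) + bn Q) + bn (g y) * bn (P m - Q)" for m
  proof -
    have "(\<Prod>g\<in>insert g S. g (X m)) - (\<Prod>g\<in>insert g S. g y) = g (X m - y) * P m + g y * (P m - Q)"
      using insert.hyps g by (simp add: P_def Q_def G_diff algebra_simps)
    also have "bn \<dots> \<le> bn (g (X m - y) * P m) + bn (g y * (P m - Q))"
      using bn_add_le[of "g (X m - y) * P m" "g y * (P m - Q)"]
        bn_nonneg[of "g (X m - y) * P m"] bn_nonneg[of "g y * (P m - Q)"] by linarith
    also have "\<dots> \<le> bn (g (X m - y)) * bn (P m) + bn (g y) * bn (P m - Q)"
      by (intro add_mono bn_mult)
    also have "bn (g (X m - y)) * bn (P m) \<le> (C * bn (X m - y)) * (bn (P m - Q) + bn Q)"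
    proof (intro mult_mono C(2) g)
      show "bn (P m) \<le> bn (P m - Q) + bn Q"
        using bn_add_le[of "P m - Q" Q] bn_nonneg[of "P m - Q"] bn_nonneg[of Q] 
        unfolding diff_add_cancel by linarith
    qed (use C in auto)
    finally show ?thesis by simp
  qed
  have "(\<lambda>m. C * bn (X m - y) * (bn (P m - Q) + bn Q) + bn (g y) * bn (P m - Q))
      \<longlonglongrightarrow> C * 0 * (0 + bn Q) + bn (g y) * 0"
    by (intro tendsto_intros assms(1) IH)
  then show ?case using bound
    by (intro Lim_null_comparison[where f = "\<lambda>m. bn (_ m)", OF always_eventually]) auto
qed simp

text \<open>Otherwise some elements with \<open>bn\<close> between 1 and 2 have norms tending to 0.
  By compactness a subsequence converges to some \<open>y\<close>, nonzero because \<open>bn\<close>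
  stays at least 1, and by continuity the norm of \<open>y\<close> vanishes, which is
  impossible.\<close>

lemma bn_le_av: "\<exists>e>0. \<forall>x. e * bn x ^ card G \<le> av x"
proof (rule ccontr)
  let ?d = "card G"
  assume "\<not> ?thesis"
  then have "\<exists>x. av x < inverse (Suc m) * bn x ^ ?d" for m :: nat
    by (metis inverse_positive_iff_positive not_le of_nat_0_less_iff zero_less_Suc)
  then obtain Y where Y: "\<And>m. av (Y m) < inverse (Suc m) * bn (Y m) ^ ?d" by metis
  \<comment> \<open>Both sides are homogeneous of degree \<open>card G\<close> under scalars of K,
    so rescaling preserves the violated inequality; the factor \<open>2 ^ ?d\<close> bounds the
    rescaled \<open>bn\<close>.\<close>
  have "\<exists>x. 1 \<le> bn x \<and> bn x < 2 \<and> av x \<le> 2 ^ ?d * inverse (Suc m)" for m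
  proof -
    have "Y m \<noteq> 0" using Y[of m] av_nonneg[of "Y m"] card_G by (auto simp: zero_power)
    then have "0 < bn (Y m)" using bn_nonneg[of "Y m"] by (simp add: less_le)
    then obtain c where c: "c \<noteq> 0" "1 \<le> nv c * bn (Y m)" "nv c * bn (Y m) < 2" by (rule ex_scale)
    have "av (\<iota> c * Y m) = nv c ^ ?d * av (Y m)" by (simp add: av_mult av_\<iota>)
    also have "\<dots> \<le> nv c ^ ?d * (inverse (Suc m) * bn (Y m) ^ ?d)"
      using Y[of m] by (intro mult_left_mono) auto
    also have "\<dots> = (nv c * bn (Y m)) ^ ?d * inverse (Suc m)" by (simp add: power_mult_distrib)
    also have "\<dots> \<le> 2 ^ ?d * inverse (Suc m)"
      using c by (intro mult_right_mono power_mono) auto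
    finally show ?thesis using c by (intro exI[of _ "\<iota> c * Y m"]) (auto simp: bn_scale)
  qed
  then obtain X where X: "\<And>m. 1 \<le> bn (X m)" "\<And>m. bn (X m) < 2" "\<And>m. av (X m) \<le> 2 ^ ?d * inverse (Suc m)"
    by metis
  have "nv (co b (X m)) \<le> 2 / cmul" if "b \<in> basis" for b m
    using nv_co_le[OF that, of "X m"] X(2)[of m] cmul(1) by (simp add: bn_def field_simps) 
      (smt (verit) mult_left_mono)
  from convergent_subseq_finite[where X = "\<lambda>b m. co b (X m)", OF finite_basis this]
  obtain r where r: "strict_mono r"
    and "\<forall>b\<in>basis. \<exists>l. (\<lambda>m. nv (co b (X (r m)) - l)) \<longlonglongrightarrow> 0" by blast
  from bchoice[OF this(2)] obtain l where
    l: "\<And>b. b \<in> basis \<Longrightarrow> (\<lambda>m. nv (co b (X (r m)) - l b)) \<longlonglongrightarrow> 0" by blast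
  define y where "y = (\<Sum>b\<in>basis. \<iota> (l b) * b)"
  have lim: "(\<lambda>m. bn (X (r m) - y)) \<longlonglongrightarrow> 0"
  proof -
    have "bn (X (r m) - y) \<le> cmul * (\<Sum>b\<in>basis. nv (co b (X (r m)) - l b))" for m
    proof -
      have "nv (co b (X (r m)) - l b) \<le> (\<Sum>b\<in>basis. nv (co b (X (r m)) - l b))" if "b \<in> basis" for b
        by (rule member_le_sum) (use that in auto)
      then have "cn (X (r m) - y) \<le> (\<Sum>b\<in>basis. nv (co b (X (r m)) - l b))"
        by (auto simp: cn_le_iff co_diff y_def co_sum_basis sum_nonneg)
      then show ?thesis using cmul(1) by (simp add: bn_def)
    qed
    moreover have "(\<lambda>m. cmul * (\<Sum>b\<in>basis. nv (co b (X (r m)) - l b))) \<longlonglongrightarrow> cmul * (\<Sum>b\<in>basis. 0)"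
      by (intro tendsto_intros l)
    ultimately show ?thesis
      by (intro Lim_null_comparison[where f = "\<lambda>m. bn (_ m)", OF always_eventually]) auto
  qed
  have "y \<noteq> 0"
  proof
    assume "y = 0"
    then have "(\<lambda>m. bn (X (r m))) \<longlonglongrightarrow> 0" using lim by simp
    moreover have "\<forall>m. 1 \<le> bn (X (r m))" using X(1) by blast
    ultimately have "(1::real) \<le> 0" by (metis LIMSEQ_le_const)
    then show False by simp
  qed
  have "(\<lambda>m. bn (nr (X (r m)) - nr y)) \<longlonglongrightarrow> 0"
    unfolding nr_def by (rule prod_tendsto[OF lim finite_G order_refl])
  then have "(\<lambda>m. nv (knr (X (r m)) - knr y) * bn 1) \<longlonglongrightarrow> 0"
    by (simp add: bn_\<iota>[symmetric] \<iota>_diff \<iota>_knr)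
  then have "(\<lambda>m. nv (knr (X (r m)) - knr y) * bn 1 / bn 1) \<longlonglongrightarrow> 0 / bn 1"
    by (rule tendsto_divide[OF _ tendsto_const]) simp
  then have t1: "(\<lambda>m. nv (knr (X (r m)) - knr y)) \<longlonglongrightarrow> 0" by simp
  have "(\<lambda>m. 2 ^ ?d * inverse (real (Suc m))) \<longlonglongrightarrow> 2 ^ ?d * 0"
    by (intro tendsto_intros LIMSEQ_inverse_real_of_nat)
  from LIMSEQ_subseq_LIMSEQ[OF this r]
  have t2: "(\<lambda>m. 2 ^ ?d * inverse (real (Suc (r m)))) \<longlonglongrightarrow> 0" by (simp add: o_def)
  have "nv (knr y) \<le> 2 ^ ?d * inverse (real (Suc (r m))) + nv (knr (X (r m)) - knr y)" for m
  proof -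
    have "nv (knr y) \<le> max (nv (knr (X (r m)))) (nv (knr (X (r m)) - knr y))"
      using K.A_diff_le[of "knr (X (r m))" "knr (X (r m)) - knr y"] by simp
    then show ?thesis
      using X(3)[of "r m", unfolded av_def] K.A_nonneg[of "knr (X (r m))"]
        K.A_nonneg[of "knr (X (r m)) - knr y"] by linarith
  qed
  then have "nv (knr y) \<le> 0 + 0"
    using LIMSEQ_le_const[OF tendsto_add[OF t2 t1], of "nv (knr y)"] by auto
  then have "knr y = 0" using K.A_nonneg[of "knr y"] by (metis K.A_eq_0_iff add_0 antisym)
  with \<open>y \<noteq> 0\<close> show False by (simp add: knr_eq_0_iff)
qed

lemma integral_bounded: "\<exists>C\<ge>1. \<forall>x. av x \<le> 1 \<longrightarrow> bn x \<le> C"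
proof -
  obtain e where e: "e > 0" "\<And>x. e * bn x ^ card G \<le> av x" using bn_le_av by blast
  have "bn x \<le> max 1 (1 / e)" if "av x \<le> 1" for x
  proof (rule ccontr)
    assume "\<not> ?thesis"
    then have 1: "1 \<le> bn x" "1 / e < bn x" by auto
    have "bn x ^ 1 \<le> bn x ^ card G" using 1 card_G by (intro power_increasing) auto
    then have "1 / e < bn x ^ card G" using 1 by simp
    then show False using e(1) e(2)[of x] that by (simp add: field_simps)
  qed
  then show ?thesis by (intro exI[of _ "max 1 (1 / e)"]) auto
qed

text \<open>The powers of an integral \<open>x\<close> are bounded, hence so are those of \<open>1 + x\<close>.\<close>

lemma av_1_add_le:
  assumes "av x \<le> 1"
  shows "av (1 + x) \<le> 1"
proof (rule ccontr)
  assume gt: "\<not> av (1 + x) \<le> 1"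
  obtain C where C: "C \<ge> 1" "\<And>x. av x \<le> 1 \<Longrightarrow> bn x \<le> C" using integral_bounded by blast
  obtain D where D: "D > 0" "\<And>x. av x \<le> D * bn x ^ card G" using av_le_bn by blast
  have "av (1 + x) ^ m \<le> D * C ^ card G" for m
  proof -
    have "(1 + x) ^ m = (\<Sum>i\<le>m. of_nat (m choose i) * x ^ i)"
      using binomial_ring[of x 1 m] by (simp add: add.commute)
    also have "bn \<dots> \<le> C"
    proof (rule bn_sum_le)
      fix i
      have "av (x ^ i) \<le> 1" using assms av_nonneg by (simp add: av_power power_le_one)
      then have "nv (of_nat (m choose i)) * bn (x ^ i) \<le> 1 * C"
        using C by (intro mult_mono K.A_of_nat_le_1) auto
      then show "bn (of_nat (m choose i) * x ^ i) \<le> C"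
        by (simp add: \<iota>_of_nat[symmetric] bn_scale)
    qed (use C in simp)
    finally have "D * bn ((1 + x) ^ m) ^ card G \<le> D * C ^ card G"
      using D by (intro mult_left_mono power_mono) auto
    then show ?thesis using D(2)[of "(1 + x) ^ m"] by (simp add: av_power)
  qed
  moreover obtain m where "D * C ^ card G < av (1 + x) ^ m"
    using real_arch_pow[of "av (1 + x)" "D * C ^ card G"] gt by auto
  ultimately show False by (meson not_less)
qed

lemma av_add_le: "av (x + y) \<le> max (av x) (av y)"
proof -
  have *: "av (x + y) \<le> av y" if "av x \<le> av y" for x y
  proof (cases "y = 0")
    case True
    then have "x = 0" using that av_nonneg[of x] av_eq_0_iff[of x] av_eq_0_iff[of y] by simp
    then show ?thesis using True by simp
  next
    case False
    then have y: "0 < av y" using av_nonneg[of y] av_eq_0_iff[of y] by linarith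
    have xy: "av x = av (x / y) * av y" using False by (simp add: av_mult[symmetric])
    then have "av (x / y) \<le> 1" using that y by simp
    then have "av (1 + x / y) * av y \<le> 1 * av y" using y by (intro mult_right_mono av_1_add_le) auto
    moreover have "(1 + x / y) * y = x + y" using False by (simp add: field_simps)
    ultimately show ?thesis by (simp add: av_mult[symmetric])
  qed
  show ?thesis using *[of x y] *[of y x] by (auto simp: add.commute max_def)
qed

sublocale N: nonarch_abs av
  by unfold_locales (auto simp: av_nonneg av_eq_0_iff av_mult av_add_le)

text \<open>Integral elements have bounded coordinates, and these are approximated by a finite net.
  Integral elements with the same approximations are congruent, so there are at most as many
  residues as codes \<open>k x\<close>.\<close>

lemma finite_residue_N: "finite (carrier N.residue_ring)"
proof -
  obtain C where C: "C \<ge> 1" "\<And>x. av x \<le> 1 \<Longrightarrow> bn x \<le> C" using integral_bounded by blast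
  obtain D where D: "D > 0" "\<And>x. av x \<le> D * bn x ^ card G" using av_le_bn by blast
  \<comment> \<open>Chosen so that \<open>bn z < \<eta>\<close> forces \<open>av z < 1\<close>: the
    bound 1 allows the exponent \<open>card G\<close> to be dropped, and \<open>1 / D\<close>
    absorbs the constant.\<close>
  define \<eta> where "\<eta> = min 1 (1 / D)"
  have \<eta>: "0 < \<eta>" using D by (simp add: \<eta>_def)
  have small: "av z < 1" if "bn z < \<eta>" for z
  proof -
    have "bn z ^ card G \<le> bn z ^ 1" using that card_G by (intro power_decreasing) (auto simp: \<eta>_def)
    then have "bn z ^ card G < 1 / D" using that by (simp add: \<eta>_def)
    then show ?thesis using D(1) D(2)[of z] by (simp add: field_simps)
  qed
  obtain F where F: "finite F" "\<And>x. nv x \<le> C / cmul \<Longrightarrow> \<exists>y\<in>F. nv (x - y) < \<eta> / cmul"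
    using totally_bounded[of "\<eta> / cmul" "C / cmul"] \<eta> cmul(1) by auto
  then obtain \<phi> where \<phi>: "\<And>x. nv x \<le> C / cmul \<Longrightarrow> \<phi> x \<in> F \<and> nv (x - \<phi> x) < \<eta> / cmul" by metis
  define k where "k x = (\<lambda>b\<in>basis. \<phi> (co b x))" for x
  let ?O = "{x. av x \<le> 1}"
  have co: "nv (co b x) \<le> C / cmul" if "av x \<le> 1" "b \<in> basis" for x b
  proof -
    have "cmul * nv (co b x) \<le> cmul * cn x" using nv_co_le[OF that(2), of x] cmul(1) by simp
    also have "\<dots> \<le> C" using C(2)[OF that(1)] by (simp add: bn_def)
    finally show ?thesis using cmul(1) by (simp add: field_simps)
  qed
  have "k ` ?O \<subseteq> PiE basis (\<lambda>_. F)" using \<phi> co by (auto simp: k_def)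
  moreover have "finite (PiE basis (\<lambda>_. F))" using F(1) by (intro finite_PiE) auto
  ultimately have fin: "finite (k ` ?O)" by (rule finite_subset)
  have same: "N.res x = N.res y" if xy: "x \<in> ?O" "y \<in> ?O" "k x = k y" for x y
  proof -
    have "nv (co b (x - y)) < \<eta> / cmul" if b: "b \<in> basis" for b
    proof -
      have eq: "\<phi> (co b x) = \<phi> (co b y)" using fun_cong[OF xy(3), of b] b by (simp add: k_def)
      have "nv (co b x - \<phi> (co b x)) < \<eta> / cmul" "nv (co b y - \<phi> (co b x)) < \<eta> / cmul"
        using \<phi>[OF co[OF _ b, of x]] \<phi>[OF co[OF _ b, of y]] xy(1,2) eq by auto
      then show ?thesis
        using K.A_diff_le[of "co b x - \<phi> (co b x)" "co b y - \<phi> (co b x)"] by (simp add: co_diff)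
    qed
    then have "cn (x - y) < \<eta> / cmul" using \<eta> cmul(1) by (simp add: cn_less_iff)
    then have "bn (x - y) < \<eta>" using cmul(1) by (simp add: bn_def field_simps)
    then show ?thesis using small by (simp only: N.res_eq_iff N.cong_def)
  qed
  have "N.res ` ?O \<subseteq> (\<lambda>t. N.res (SOME x. x \<in> ?O \<and> k x = t)) ` (k ` ?O)"
  proof
    fix X assume "X \<in> N.res ` ?O"
    then obtain x where x: "x \<in> ?O" "X = N.res x" by blast
    define z where "z = (SOME z. z \<in> ?O \<and> k z = k x)"
    have "z \<in> ?O \<and> k z = k x" unfolding z_def by (rule someI[of _ x]) (use x in auto)
    then have "X = N.res z" using same[of x z] x by simp
    then show "X \<in> (\<lambda>t. N.res (SOME x. x \<in> ?O \<and> k x = t)) ` (k ` ?O)" using x unfolding z_def by blast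
  qed
  then show ?thesis unfolding N.residue_ring_carrier using fin finite_surj by blast
qed

end

section \<open>Totally ramified subfields\<close>

lemma subfield_closed:
  assumes "is_subfield F"
  shows "0 \<in> F" "1 \<in> F"
    and "x \<in> F \<Longrightarrow> y \<in> F \<Longrightarrow> x - y \<in> F"
    and "x \<in> F \<Longrightarrow> y \<in> F \<Longrightarrow> x + y \<in> F"
    and "x \<in> F \<Longrightarrow> y \<in> F \<Longrightarrow> x * y \<in> F"
    and "x \<in> F \<Longrightarrow> - x \<in> F"
    and "x \<in> F \<Longrightarrow> inverse x \<in> F"
    and "x \<in> F \<Longrightarrow> y \<in> F \<Longrightarrow> x / y \<in> F"
    and "x \<in> F \<Longrightarrow> x ^ n \<in> F"
    and "x \<in> F \<Longrightarrow> x powi k \<in> F"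
proof -
  show 0: "0 \<in> F" "1 \<in> F" using assms by (auto simp: is_subfield_def)
  show d: "x \<in> F \<Longrightarrow> y \<in> F \<Longrightarrow> x - y \<in> F" for x y using assms by (auto simp: is_subfield_def)
  show m: "x \<in> F \<Longrightarrow> y \<in> F \<Longrightarrow> x * y \<in> F" for x y using assms by (auto simp: is_subfield_def)
  show u: "x \<in> F \<Longrightarrow> - x \<in> F" for x using d[OF 0(1), of x] by simp
  show "x \<in> F \<Longrightarrow> y \<in> F \<Longrightarrow> x + y \<in> F" using d[of x "- y"] u[of y] by simp
  show i: "x \<in> F \<Longrightarrow> inverse x \<in> F" for x using assms by (auto simp: is_subfield_def)
  show "x \<in> F \<Longrightarrow> y \<in> F \<Longrightarrow> x / y \<in> F" using m[of x "inverse y"] i[of y] by (simp add: divide_inverse)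
  show p: "x \<in> F \<Longrightarrow> x ^ n \<in> F" for x n by (induction n) (auto simp: 0 m)
  show "x \<in> F \<Longrightarrow> x powi k \<in> F" using p i by (auto simp: power_int_def)
qed

lemma subfield_sum:
  assumes "is_subfield F" "\<And>i. i \<in> S \<Longrightarrow> f i \<in> F"
  shows "sum f S \<in> F"
  using assms(2) by (induction S rule: infinite_finite_induct) (auto simp: subfield_closed[OF assms(1)])

lemma valuation_sum:
  assumes "is_subfield F" "discrete_valuation_on F w" "\<And>i. i \<in> S \<Longrightarrow> f i \<in> F"
    and "\<And>i. i \<in> S \<Longrightarrow> f i = 0 \<or> m \<le> w (f i)"
  shows "sum f S = 0 \<or> m \<le> w (sum f S)"
  using assms(3,4)
proof (induction S rule: infinite_finite_induct)
  case (insert x S)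
  then have IH: "sum f S = 0 \<or> m \<le> w (sum f S)" and fx: "f x = 0 \<or> m \<le> w (f x)"
    and F: "f x \<in> F" "sum f S \<in> F" using subfield_sum[OF assms(1), of S f] by auto
  have "min (w (f x)) (w (sum f S)) \<le> w (f x + sum f S)"
    if "f x \<noteq> 0" "sum f S \<noteq> 0" "f x + sum f S \<noteq> 0"
    using assms(2) F that unfolding discrete_valuation_on_def by blast
  moreover have "m \<le> min (w (f x)) (w (sum f S))" if "f x \<noteq> 0" "sum f S \<noteq> 0"
    using that IH fx by simp
  ultimately have "f x + sum f S = 0 \<or> m \<le> w (f x + sum f S)"
    using IH fx by (cases "f x = 0 \<or> sum f S = 0 \<or> f x + sum f S = 0") auto
  then show ?case using insert.hyps by simp
qed auto

lemma valuation_power: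
  assumes "is_subfield F" "discrete_valuation_on F w" "x \<in> F" "x \<noteq> 0"
  shows "w (x ^ n) = int n * w x" "w (inverse x) = - w x"
proof -
  have mult: "w (x * y) = w x + w y" if "x \<in> F" "x \<noteq> 0" "y \<in> F" "y \<noteq> 0" for x y
    using assms(2) that unfolding discrete_valuation_on_def by blast
  have w1: "w 1 = 0" using mult[of 1 1] subfield_closed(2)[OF assms(1)] by simp
  show "w (x ^ n) = int n * w x"
    by (induction n) (auto simp: w1 mult subfield_closed[OF assms(1)] assms(3,4) algebra_simps)
  have "w (x * inverse x) = w x + w (inverse x)"
    by (rule mult) (auto simp: assms(3,4) subfield_closed[OF assms(1)])
  then show "w (inverse x) = - w x" using assms(4) w1 by simp
qed

context nonarch_abs
begin

lemma integral_poly_prod: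
  assumes "\<And>i k. i \<in> S \<Longrightarrow> A (coeff (P i) k) \<le> 1"
  shows "A (coeff (prod P S) k) \<le> 1"
  using assms
proof (induction S arbitrary: k rule: infinite_finite_induct)
  case (insert x S)
  then show ?case
    by (auto simp: coeff_mult intro!: A_sum_le integral_mult)
qed (auto simp: coeff_1)

end

context local_galois
begin

sublocale FV: finite_dimensional_vector_space "\<lambda>c x. \<iota> c * x" basis
  by unfold_locales (simp_all add: independent_basis span_basis)

lemma intermediate_span:
  assumes "is_subfield M" "range \<iota> \<subseteq> M" "S \<subseteq> M"
  shows "V.span S \<subseteq> M"
proof
  fix x assume "x \<in> V.span S"
  then show "x \<in> M"
    by (induction rule: V.span_induct_alt) (use assms in \<open>auto simp: subfield_closed[OF assms(1)] image_subset_iff subset_iff\<close>)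
qed

subsection \<open>Characteristic polynomials\<close>

text \<open>For S = G this is the characteristic polynomial over K, and for the stabiliser of a
  uniformizer of L the one over L.\<close>

definition cpoly :: "('n \<Rightarrow> 'n) set \<Rightarrow> 'n \<Rightarrow> 'n poly" where
  "cpoly S x = (\<Prod>g\<in>S. [:- g x, 1:])"

lemma map_poly_G_mult:
  assumes "h \<in> G"
  shows "map_poly h (p * q) = map_poly h p * map_poly h q"
  by (rule poly_eqI) (simp add: coeff_map_poly coeff_mult assms G_sum G_mult)

lemma map_poly_G_prod:
  assumes "h \<in> G"
  shows "map_poly h (prod P S) = (\<Prod>i\<in>S. map_poly h (P i))"
  by (induction S rule: infinite_finite_induct) (simp_all add: map_poly_G_mult assms)

lemma cpoly_fixed:
  assumes "h \<in> G" "bij_betw (\<lambda>g. h \<circ> g) S S"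
  shows "h (coeff (cpoly S x) k) = coeff (cpoly S x) k"
proof -
  have "map_poly h (cpoly S x) = (\<Prod>g\<in>S. [:- (h \<circ> g) x, 1:])"
    unfolding cpoly_def map_poly_G_prod[OF assms(1)]
    by (simp add: map_poly_pCons assms(1) G_uminus)
  also have "\<dots> = cpoly S x"
    unfolding cpoly_def by (rule prod.reindex_bij_betw[OF assms(2), of "\<lambda>g. [:- g x, 1:]"])
  finally show ?thesis by (metis G_0 assms(1) coeff_map_poly)
qed

lemma cpoly_integral: "(\<And>g. g \<in> S \<Longrightarrow> g \<in> G) \<Longrightarrow> av x \<le> 1 \<Longrightarrow> av (coeff (cpoly S x) k) \<le> 1"
  unfolding cpoly_def
  by (intro N.integral_poly_prod) (auto simp: coeff_pCons av_G split: nat.splits)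

lemma poly_cpoly: "poly (cpoly S x) y = (\<Prod>g\<in>S. y - g x)"
  by (simp add: cpoly_def poly_prod)

lemma degree_cpoly: "degree (cpoly S x) = card S"
  by (simp add: cpoly_def degree_prod_sum_eq)

lemma lead_coeff_cpoly: "coeff (cpoly S x) (card S) = 1"
proof -
  have "lead_coeff (cpoly S x) = 1" by (simp add: cpoly_def lead_coeff_prod)
  then show ?thesis by (simp add: degree_cpoly)
qed

subsection \<open>Uniqueness of the prolongation\<close>

text \<open>\<open>x\<close> is a root of a monic polynomial with integral coefficients in K. If
  \<open>w x\<close> were negative, the leading term would have smaller valuation than all the
  others, and the relation could not hold.\<close>

lemma av_le_1_imp_prolong_nonneg:
  assumes M: "is_subfield M" "range \<iota> \<subseteq> M" and w: "prolongs v \<iota> M w e"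
    and x: "x \<in> M" "x \<noteq> 0" "av x \<le> 1"
  shows "0 \<le> w x"
proof (rule ccontr)
  assume neg: "\<not> 0 \<le> w x"
  let ?P = "cpoly G x" and ?D = "card G"
  have dv: "discrete_valuation_on M w" and e: "\<And>c. c \<noteq> 0 \<Longrightarrow> w (\<iota> c) = int e * v c"
    using w by (auto simp: prolongs_def)
  have wmult: "w (x * y) = w x + w y" if "x \<in> M" "x \<noteq> 0" "y \<in> M" "y \<noteq> 0" for x y
    using dv that unfolding discrete_valuation_on_def by blast
  have "coeff ?P i \<in> range \<iota>" for i
    by (rule fixed_by_G) (simp add: cpoly_fixed G_reindex(1))
  then have "\<forall>i. \<exists>k. coeff ?P i = \<iota> k" by blast
  from choice[OF this] obtain k where k: "\<And>i. coeff ?P i = \<iota> (k i)" by blast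
  have kint: "nv (k i) \<le> 1" for i
  proof -
    have "nv (k i) ^ ?D \<le> 1" using cpoly_integral[of G x i] x(3) by (simp add: k av_\<iota>)
    then show ?thesis using card_G by (meson not_le one_less_power)
  qed
  have "poly ?P x = 0" using finite_G G_id by (auto simp: poly_cpoly)
  then have "(\<Sum>i\<le>?D. coeff ?P i * x ^ i) = 0" by (simp add: poly_altdef degree_cpoly)
  then have "x ^ ?D + (\<Sum>i<?D. coeff ?P i * x ^ i) = 0"
    by (simp add: lessThan_Suc_atMost[symmetric] lead_coeff_cpoly add.commute)
  then have eq: "x ^ ?D = (\<Sum>i<?D. - (coeff ?P i * x ^ i))"
    by (simp add: sum_negf eq_neg_iff_add_eq_0)
  have "(\<Sum>i<?D. - (coeff ?P i * x ^ i)) = 0 \<or> int (?D - 1) * w x \<le> w (\<Sum>i<?D. - (coeff ?P i * x ^ i))"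
  proof (rule valuation_sum[OF M(1) dv])
    fix i assume i: "i \<in> {..<?D}"
    have kM: "\<iota> (k i) \<in> M" using M by auto
    show "- (coeff ?P i * x ^ i) \<in> M" using kM x by (simp add: k subfield_closed[OF M(1)])
    show "- (coeff ?P i * x ^ i) = 0 \<or> int (?D - 1) * w x \<le> w (- (coeff ?P i * x ^ i))"
    proof (cases "k i = 0")
      case False
      have 1: "- (coeff ?P i * x ^ i) = \<iota> (- k i) * x ^ i" by (simp add: k \<iota>_uminus)
      have 2: "w (\<iota> (- k i) * x ^ i) = int e * v (- k i) + int i * w x"
        using False x M by (subst wmult) (auto simp: e valuation_power[OF M(1) dv] subfield_closed[OF M(1)])
      have 3: "0 \<le> int e * v (- k i)" using kint[of i] False nv_le_iff[of "- k i" 0] by simp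
      have 4: "int (?D - 1) * w x \<le> int i * w x"
        using i neg by (intro mult_right_mono_neg) auto
      show ?thesis unfolding 1 using 2 3 4 by (intro disjI2) linarith
    qed (simp add: k)
  qed
  then have "int (?D - 1) * w x \<le> int ?D * w x"
    using x unfolding eq[symmetric] by (simp add: valuation_power[OF M(1) dv])
  moreover have "int ?D = int (?D - 1) + 1" using card_G by simp
  ultimately have "int (?D - 1) * w x \<le> int (?D - 1) * w x + w x" by (simp only: distrib_right mult_1)
  then show False using neg by linarith
qed

lemma prolong_pos_imp_av_less_1:
  assumes M: "is_subfield M" "range \<iota> \<subseteq> M" and w: "prolongs v \<iota> M w e"
    and x: "x \<in> M" "x \<noteq> 0" "0 < w x"
  shows "av x < 1"
proof (rule ccontr)
  assume "\<not> ?thesis"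
  then have "av (inverse x) \<le> 1" by (simp add: N.A_inverse inverse_le_1_iff)
  then have "0 \<le> w (inverse x)"
    using av_le_1_imp_prolong_nonneg[OF M w, of "inverse x"] x by (auto simp: subfield_closed[OF M(1)])
  then show False using valuation_power(2)[OF M(1) _ x(1,2), of w] w x by (auto simp: prolongs_def)
qed

text \<open>So far positivity of \<open>w\<close> is known to imply \<open>av < 1\<close>, which
  says nothing about units. But the powers of a unit times a fixed uniformizer of K have positive
  valuation, so these powers stay bounded under \<open>av\<close>; the same holds for the
  inverse.\<close>

lemma prolong_zero_imp_av_eq_1:
  assumes M: "is_subfield M" "range \<iota> \<subseteq> M" and w: "prolongs v \<iota> M w e"
    and x: "x \<in> M" "x \<noteq> 0" "w x = 0"
  shows "av x = 1"
proof -
  have dv: "discrete_valuation_on M w" and e: "0 < e" "\<And>c. c \<noteq> 0 \<Longrightarrow> w (\<iota> c) = int e * v c"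
    using w by (auto simp: prolongs_def)
  have wmult: "w (x * y) = w x + w y" if "x \<in> M" "x \<noteq> 0" "y \<in> M" "y \<noteq> 0" for x y
    using dv that unfolding discrete_valuation_on_def by blast
  obtain t where t: "t \<noteq> 0" "nv t = 1 / 2" using ex_nv[of "-1"] by (auto simp: power_int_minus)
  have "v t = 1"
  proof -
    have "nv t \<le> 2 powi (- 1)" "\<not> nv t < 2 powi (- 1)" using t by (simp_all add: power_int_minus)
    then show ?thesis using t(1) unfolding nv_le_iff nv_less_iff by auto
  qed
  have le: "av y \<le> 1" if y: "y \<in> M" "y \<noteq> 0" "w y = 0" for y
  proof (rule ccontr)
    assume gt: "\<not> av y \<le> 1"
    have tM: "\<iota> t \<in> M" using M by auto
    have "0 < w (y ^ j * \<iota> t)" for j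
      using y t e \<open>v t = 1\<close> tM
      by (subst wmult) (auto simp: valuation_power[OF M(1) dv] subfield_closed[OF M(1)])
    then have less: "av (y ^ j * \<iota> t) < 1" for j
      using y t tM by (intro prolong_pos_imp_av_less_1[OF M w]) (auto simp: subfield_closed[OF M(1)])
    have pos: "0 < av (\<iota> t)" using t by (simp add: av_\<iota>)
    obtain j where "1 / av (\<iota> t) < av y ^ j" using real_arch_pow[of "av y" "1 / av (\<iota> t)"] gt by auto
    then show False using less[of j] pos by (simp add: N.A_mult N.A_power field_simps)
  qed
  have "av (inverse x) \<le> 1"
    using x by (intro le) (auto simp: subfield_closed[OF M(1)] valuation_power[OF M(1) dv])
  then have "av x \<le> 0 \<or> 1 \<le> av x" by (simp add: N.A_inverse inverse_le_1_iff)
  then have "1 \<le> av x" using x(2) N.A_pos_iff[of x] by linarith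
  with le[OF x] show ?thesis by simp
qed

subsection \<open>Powers of a uniformizer\<close>

text \<open>On K this is \<open>- card G\<close> times the valuation. Thus
  \<open>e * lg z = - card G\<close> says that \<open>z ^ e\<close> has the absolute value of a
  uniformizer of K: z has ramification index e.\<close>

definition lg :: "'n \<Rightarrow> real" where
  "lg x = log 2 (av x)"

lemma lg_mult: "x \<noteq> 0 \<Longrightarrow> y \<noteq> 0 \<Longrightarrow> lg (x * y) = lg x + lg y"
  by (simp add: lg_def N.A_mult log_mult)

lemma lg_power: "x \<noteq> 0 \<Longrightarrow> lg (x ^ n) = n * lg x"
  by (simp add: lg_def N.A_power log_nat_power)

lemma lg_\<iota>: "c \<noteq> 0 \<Longrightarrow> lg (\<iota> c) = - (real (card G) * v c)"
proof -
  assume c: "c \<noteq> 0"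
  have "log 2 (2 powi (- v c)) = - real_of_int (v c)"
    by (simp add: powr_real_of_int'[symmetric])
  then show ?thesis using c by (simp add: lg_def av_\<iota> nv_values log_nat_power)
qed

text \<open>Multiplied by e and divided by \<open>- card G\<close>, the logarithm of the term
  becomes \<open>e * v c + i\<close>, and its remainder modulo e recovers i.\<close>

lemma power_terms_distinct:
  assumes "0 < e" "z \<noteq> 0" "real e * lg z = - real (card G)"
    and "i < e" "j < e" "c \<noteq> 0" "c' \<noteq> 0" "av (\<iota> c * z ^ i) = av (\<iota> c' * z ^ j)"
  shows "i = j"
proof -
  have "lg (\<iota> c * z ^ i) = lg (\<iota> c' * z ^ j)" using assms(8) by (simp add: lg_def)
  then have "- (real (card G) * v c) + i * lg z = - (real (card G) * v c') + j * lg z"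
    using assms by (simp add: lg_mult lg_power lg_\<iota>)
  then have "real e * (- (real (card G) * v c) + i * lg z) = real e * (- (real (card G) * v c') + j * lg z)"
    by simp
  then have "real i * (real e * lg z) - real e * (real (card G) * v c)
      = real j * (real e * lg z) - real e * (real (card G) * v c')"
    by (simp add: algebra_simps)
  then have "real (card G) * (real e * v c + i) = real (card G) * (real e * v c' + j)"
    unfolding assms(3) by (simp add: algebra_simps)
  then have "real e * v c + i = real e * v c' + j" using card_G by simp
  then have "real_of_int (int e * v c + int i) = real_of_int (int e * v c' + int j)" by simp
  then have "int e * v c + int i = int e * v c' + int j" by (simp only: of_int_eq_iff)
  then have "(int e * v c + int i) mod int e = (int e * v c' + int j) mod int e" by simp
  then show ?thesis using assms(4,5) by simp
qed

lemma power_sum_ge: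
  assumes "0 < e" "z \<noteq> 0" "real e * lg z = - real (card G)" "i < e"
  shows "av (\<iota> (c i) * z ^ i) \<le> av (\<Sum>i<e. \<iota> (c i) * z ^ i)"
proof (rule N.A_sum_distinct_ge[where f = "\<lambda>i. \<iota> (c i) * z ^ i"])
  fix i j assume "i \<in> {..<e}" "j \<in> {..<e}" "i \<noteq> j" "\<iota> (c i) * z ^ i \<noteq> 0" "\<iota> (c j) * z ^ j \<noteq> 0"
  then show "av (\<iota> (c i) * z ^ i) \<noteq> av (\<iota> (c j) * z ^ j)"
    using power_terms_distinct[OF assms(1-3), of i j "c i" "c j"] by auto
qed (use assms in auto)

text \<open>Every term of a vanishing combination is bounded by the sum, hence by 0.\<close>

lemma powers_independent:
  assumes "0 < e" "z \<noteq> 0" "real e * lg z = - real (card G)"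
  shows "inj_on (\<lambda>i. z ^ i) {..<e}" "V.independent ((\<lambda>i. z ^ i) ` {..<e})"
proof -
  show inj: "inj_on (\<lambda>i. z ^ i) {..<e}"
    by (rule inj_onI) (use power_terms_distinct[OF assms, of _ _ 1 1] in auto)
  show "V.independent ((\<lambda>i. z ^ i) ` {..<e})"
  proof (subst V.independent_explicit_finite_subsets, intro allI impI ballI)
    fix T u t assume T: "T \<subseteq> (\<lambda>i. z ^ i) ` {..<e}" "finite T" "(\<Sum>t\<in>T. \<iota> (u t) * t) = 0" "t \<in> T"
    define c where "c i = (if z ^ i \<in> T then u (z ^ i) else 0)" for i
    have "(\<Sum>i<e. \<iota> (c i) * z ^ i) = (\<Sum>t\<in>(\<lambda>i. z ^ i) ` {..<e}. \<iota> (if t \<in> T then u t else 0) * t)"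
      by (subst sum.reindex[OF inj]) (simp add: c_def)
    also have "\<dots> = (\<Sum>t\<in>T. \<iota> (u t) * t)"
      using T by (intro sum.mono_neutral_cong_right) auto
    finally have z: "(\<Sum>i<e. \<iota> (c i) * z ^ i) = 0" using T by simp
    obtain i where i: "i < e" "t = z ^ i" using T by auto
    have "av (\<iota> (c i) * z ^ i) \<le> 0" using power_sum_ge[OF assms i(1), of c] z by simp
    then have "\<iota> (c i) * z ^ i = 0" using N.A_nonneg[of "\<iota> (c i) * z ^ i"] by (metis N.A_eq_0_iff antisym)
    then show "u t = 0" using assms(2) i T(4) by (simp add: c_def)
  qed
qed

lemma span_powers:
  assumes "0 < e" "z \<noteq> 0" "real e * lg z = - real (card G)"
  shows "V.span ((\<lambda>i. z ^ i) ` {..<e}) = {x. \<exists>c. x = (\<Sum>i<e. \<iota> (c i) * z ^ i)}"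
proof -
  have inj: "inj_on (\<lambda>i. z ^ i) {..<e}" by (rule powers_independent(1)[OF assms])
  let ?f = "\<lambda>c. \<Sum>i<e. \<iota> (c i) * z ^ i"
  let ?g = "\<lambda>u. \<Sum>t\<in>(\<lambda>i. z ^ i) ` {..<e}. \<iota> (u t) * t"
  have f: "\<exists>u. ?f c = ?g u" for c
    by (intro exI[of _ "\<lambda>t. c (the_inv_into {..<e} (\<lambda>i. z ^ i) t)"], subst sum.reindex[OF inj])
       (auto simp: the_inv_into_f_f[OF inj] intro!: sum.cong)
  have g: "\<exists>c. ?g u = ?f c" for u
    by (intro exI[of _ "\<lambda>i. u (z ^ i)"], subst sum.reindex[OF inj]) simp
  have "range ?g = {x. \<exists>c. x = ?f c}"
  proof (rule equalityI; rule subsetI)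
    fix x assume "x \<in> range ?g"
    then obtain u where "x = ?g u" by blast
    moreover obtain c where "?g u = ?f c" using g[of u] by (elim exE)
    ultimately have "x = ?f c" by (rule trans)
    then show "x \<in> {x. \<exists>c. x = ?f c}" by blast
  next
    fix x assume "x \<in> {x. \<exists>c. x = ?f c}"
    then obtain c where "x = ?f c" by blast
    moreover obtain u where "?f c = ?g u" using f[of c] by (elim exE)
    ultimately have "x = ?g u" by (rule trans)
    then show "x \<in> range ?g" by blast
  qed
  moreover have "V.span ((\<lambda>i. z ^ i) ` {..<e}) = range ?g"
    by (rule V.span_finite) simp
  ultimately show ?thesis by simp
qed

text \<open>Passes from the unspecified prolongation to \<open>av\<close>. The powers of an element
  of valuation 1 are independent and as numerous as the degree, so they span.\<close>

lemma totally_ramified_uniformizer: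
  assumes M: "is_subfield M" "range \<iota> \<subseteq> M" and tr: "totally_ramified v \<iota> M"
  obtains z where "z \<in> M" "z \<noteq> 0" "real (ext_degree \<iota> M) * lg z = - real (card G)"
    "0 < ext_degree \<iota> M" "M = V.span ((\<lambda>i. z ^ i) ` {..<ext_degree \<iota> M})"
proof -
  let ?n = "ext_degree \<iota> M"
  obtain w where w: "prolongs v \<iota> M w ?n" using tr by (auto simp: totally_ramified_def)
  have dv: "discrete_valuation_on M w" and e: "0 < ?n" "\<And>c. c \<noteq> 0 \<Longrightarrow> w (\<iota> c) = int ?n * v c"
    using w by (auto simp: prolongs_def)
  have wmult: "w (x * y) = w x + w y" if "x \<in> M" "x \<noteq> 0" "y \<in> M" "y \<noteq> 0" for x y
    using dv that unfolding discrete_valuation_on_def by blast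
  have "1 \<in> w ` (M - {0})" using dv by (auto simp: discrete_valuation_on_def)
  then obtain z where z: "z \<in> M" "z \<noteq> 0" "w z = 1" by (metis DiffE imageE singletonI)
  \<comment> \<open>With \<open>v t = - 1\<close> the product \<open>z ^ ?n * \<iota> t\<close> is a
    unit for the prolongation, and units are what the comparison with \<open>av\<close> carries over
    exactly.\<close>
  obtain t where t: "t \<noteq> 0" "nv t = 2 powi 1" using ex_nv[of 1] by auto
  then have vt: "v t = - 1"
  proof -
    have "nv t \<le> 2 powi (- (- 1))" "\<not> nv t < 2 powi (- (- 1))" using t by simp_all
    then show ?thesis using t(1) unfolding nv_le_iff nv_less_iff by auto
  qed
  have tM: "\<iota> t \<in> M" using M by auto
  have "w (z ^ ?n * \<iota> t) = 0"
    using z t tM by (subst wmult) (auto simp: e vt valuation_power[OF M(1) dv] subfield_closed[OF M(1)])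
  then have "av (z ^ ?n * \<iota> t) = 1"
    using z t tM by (intro prolong_zero_imp_av_eq_1[OF M w]) (auto simp: subfield_closed[OF M(1)])
  then have "lg (z ^ ?n * \<iota> t) = 0" by (simp add: lg_def)
  then have lgz: "real ?n * lg z = - real (card G)"
    using z t by (simp add: lg_mult lg_power lg_\<iota> vt)
  let ?S = "(\<lambda>i. z ^ i) ` {..<?n}"
  have ind: "V.independent ?S" and card: "card ?S = ?n"
    using powers_independent[OF e(1) z(2) lgz] by (auto simp: card_image)
  have sub: "?S \<subseteq> M" using z by (auto simp: subfield_closed[OF M(1)])
  have "M \<subseteq> V.span ?S"
    using FV.card_ge_dim_independent[OF sub ind] card by (simp add: ext_degree_def)
  with intermediate_span[OF M sub] have "M = V.span ?S" by blast
  with z lgz e(1) that show thesis by blast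
qed

lemma totally_ramified_residue:
  assumes "0 < e" "z \<noteq> 0" "real e * lg z = - real (card G)"
    and "x \<in> V.span ((\<lambda>i. z ^ i) ` {..<e})" "av x \<le> 1"
  shows "\<exists>c. nv c \<le> 1 \<and> N.cong x (\<iota> c)"
proof -
  obtain c where c: "x = (\<Sum>i<e. \<iota> (c i) * z ^ i)"
    using assms(4) unfolding span_powers[OF assms(1-3)] by blast
  have le: "av (\<iota> (c i) * z ^ i) \<le> 1" if "i < e" for i
    using power_sum_ge[OF assms(1-3) that, of c] assms(5) c by simp
  have less: "av (\<iota> (c i) * z ^ i) < 1" if "i < e" "i \<noteq> 0" for i
  proof (cases "c i = 0")
    case False
    \<comment> \<open>The number 1 is itself the term with exponent 0, so no term with another
      exponent has absolute value 1.\<close>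
    have "av (\<iota> (c i) * z ^ i) \<noteq> av (\<iota> 1 * z ^ 0)"
      using power_terms_distinct[OF assms(1-3), of i 0 "c i" 1] that assms(1) False by auto
    then show ?thesis using le[OF that(1)] by simp
  qed simp
  have "nv (c 0) ^ card G \<le> 1" using le[of 0] assms(1) by (simp add: av_\<iota>)
  then have "nv (c 0) \<le> 1" using card_G by (meson not_le one_less_power)
  moreover have "N.cong x (\<iota> (c 0))"
  proof -
    have "{..<e} = insert 0 {1..<e}" using assms(1) by auto
    then have "x - \<iota> (c 0) = (\<Sum>i\<in>{1..<e}. \<iota> (c i) * z ^ i)" by (simp add: c)
    also have "av \<dots> < 1" by (rule N.A_sum_less) (auto intro: less)
    finally show ?thesis by (simp add: N.cong_def)
  qed
  ultimately show ?thesis by blast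
qed

section \<open>Recognising total ramification by residues\<close>

lemma lg_le_iff: "x \<noteq> 0 \<Longrightarrow> y \<noteq> 0 \<Longrightarrow> av x \<le> av y \<longleftrightarrow> lg x \<le> lg y"
  by (simp add: lg_def)

lemma ex_nv_half: "\<exists>t. t \<noteq> 0 \<and> nv t = 1 / 2 \<and> v t = 1"
proof -
  obtain t where t: "t \<noteq> 0" "nv t = 2 powi (- 1)" using ex_nv[of "-1"] by auto
  then have "nv t \<le> 2 powi (- 1)" "\<not> nv t < 2 powi (- 1)" by simp_all
  then have "v t = 1" using t(1) unfolding nv_le_iff nv_less_iff by auto
  with t show ?thesis by (auto simp: power_int_minus)
qed

text \<open>If every integral element is congruent to one of the base field, then every element is
  approximated by a \<open>K\<close>-combination of powers of a uniformizer; completeness turns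
  approximation into equality.\<close>

lemma span_powers_eq:
  assumes E: "is_subfield E" "range \<iota> \<subseteq> E"
    and res: "\<And>x. x \<in> E \<Longrightarrow> av x \<le> 1 \<Longrightarrow> \<exists>c. N.cong x (\<iota> c)"
    and z: "0 < e" "z \<in> E" "z \<noteq> 0" "real e * lg z = - real (card G)"
    and vals: "\<And>x. x \<in> E \<Longrightarrow> x \<noteq> 0 \<Longrightarrow> \<exists>k::int. lg x = k * lg z"
  shows "V.span ((\<lambda>i. z ^ i) ` {..<e}) = E"
proof
  let ?V = "V.span ((\<lambda>i. z ^ i) ` {..<e})"
  note cl = subfield_closed[OF E(1)]
  show sub: "?V \<subseteq> E" using z(2) by (intro intermediate_span[OF E]) (auto simp: cl)
  obtain t where t: "t \<noteq> 0" "v t = 1" using ex_nv_half by blast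
  have lgz: "lg z < 0" 
    using z(1,4) card_G by (smt (verit) mult_nonneg_nonneg of_nat_0_less_iff of_nat_0_le_iff)
  have step: "\<exists>y\<in>?V. av (x - y) < av x" if x: "x \<in> E" "x \<noteq> 0" for x
  proof -
    obtain k :: int where k: "lg x = k * lg z" using vals[OF x] by blast
    \<comment> \<open>Division of k by e with remainder: since \<open>z ^ e\<close> and
      \<open>\<iota> t\<close> have the same absolute value,
      \<open>\<iota> (t powi a) * z ^ i\<close> has that of \<open>x\<close>, and the quotient is a
      unit with a residue in K.\<close>
    define i where "i = nat (k mod int e)"
    define a where "a = k div int e"
    have i: "i < e" "int i = k mod int e" using z(1) by (simp_all add: i_def nat_less_iff)
    define s where "s = \<iota> (t powi a)"
    have s: "s \<in> E" "s \<noteq> 0" using E(2) t by (auto simp: s_def)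
    have vt: "v (t powi a) = a"
    proof -
      have pow: "v (t ^ m) = int m" for m
      proof (induction m)
        case 0
        then show ?case using v_mult[of 1 1] by simp
      qed (use t v_mult[of t] in simp)
      have "v (inverse y) = - v y" if "y \<noteq> 0" for y
        using v_mult[of y "inverse y"] v_mult[of 1 1] that by simp
      then show ?thesis using pow t by (auto simp: power_int_def power_inverse)
    qed
    have "lg (s * z ^ i) = - (real (card G) * a) + i * lg z"
      using s z t by (simp add: lg_mult lg_power) (simp add: s_def lg_\<iota> vt)
    also have "\<dots> = (real_of_int (a * int e + int i)) * lg z"
      using z(4) by (simp add: algebra_simps)
    also have "a * int e + int i = k" by (simp add: a_def i(2))
    finally have lgeq: "lg (s * z ^ i) = lg x" using k by simp
    have sz: "s * z ^ i \<in> E" "s * z ^ i \<noteq> 0" using s z by (auto simp: cl)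
    have av: "av (s * z ^ i) = av x"
      using lg_le_iff[of "s * z ^ i" x] lg_le_iff[of x "s * z ^ i"] lgeq sz x by auto
    have "x / (s * z ^ i) \<in> E" using sz x by (auto simp: cl)
    moreover have "av (x / (s * z ^ i)) = 1" using av x by (simp add: N.A_divide)
    ultimately obtain c where "N.cong (x / (s * z ^ i)) (\<iota> c)" using res by fastforce
    then have "av (x / (s * z ^ i) - \<iota> c) * av (s * z ^ i) < 1 * av (s * z ^ i)"
      using sz unfolding N.cong_def by (intro mult_strict_right_mono) auto
    moreover have "(x / (s * z ^ i) - \<iota> c) * (s * z ^ i) = x - \<iota> (c * t powi a) * z ^ i"
      using sz(2) by (simp add: left_diff_distrib s_def \<iota>_mult)
    ultimately have "av (x - \<iota> (c * t powi a) * z ^ i) < av x"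
      by (metis N.A_mult av mult_1)
    moreover have "\<iota> (c * t powi a) * z ^ i \<in> ?V"
      using i by (intro V.span_scale V.span_base) auto
    ultimately show ?thesis by blast
  qed
  \<comment> \<open>The values of \<open>av\<close> are powers of 2, so a strict decrease is at
    least a halving; this makes the successive approximations converge.\<close>
  have halve: "av x \<le> av y / 2" if "av x < av y" for x y
  proof (cases "x = 0")
    case False
    have "0 < av y" using that N.A_nonneg[of x] by linarith
    then have "y \<noteq> 0" by simp
    then have y: "knr y \<noteq> 0" and x: "knr x \<noteq> 0" using False by (auto simp: knr_eq_0_iff)
    have "2 powi (- v (knr x)) < (2 :: real) powi (- v (knr y))"
      using that x y by (simp add: av_def nv_values)
    then have "2 powi (- v (knr x)) \<le> (2 :: real) powi (- v (knr y) - 1)"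
      by (simp add: two_powi_less_iff two_powi_le_iff)
    then show ?thesis using x y by (simp add: av_def nv_values power_int_diff)
  qed simp
  have approx: "\<exists>y\<in>?V. av (x - y) \<le> av x * (1 / 2) ^ m" if x: "x \<in> E" for x m
  proof (induction m)
    case 0
    then show ?case by (intro bexI[of _ 0]) (auto simp: V.span_zero)
  next
    case (Suc m)
    then obtain y where y: "y \<in> ?V" "av (x - y) \<le> av x * (1 / 2) ^ m" by blast
    show ?case
    proof (cases "x = y")
      case True
      then show ?thesis using y by (intro bexI[of _ y]) auto
    next
      case False
      have "x - y \<in> E" using x y sub by (auto simp: cl)
      then obtain u where u: "u \<in> ?V" "av (x - y - u) < av (x - y)" using step[of "x - y"] False by auto
      have "av (x - (y + u)) \<le> av (x - y) / 2" using halve[OF u(2)] by (simp add: diff_diff_eq)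
      then show ?thesis using y u by (intro bexI[of _ "y + u"]) (auto intro: V.span_add)
    qed
  qed
  show "E \<subseteq> ?V"
  proof
    fix x assume x: "x \<in> E"
    have "\<exists>c. av (x - (\<Sum>i<e. \<iota> (c i) * z ^ i)) \<le> av x * (1 / 2) ^ m" for m
      using approx[OF x, of m] unfolding span_powers[OF z(1,3,4)] by blast
    then obtain c where c: "\<And>m. av (x - (\<Sum>i<e. \<iota> (c m i) * z ^ i)) \<le> av x * (1 / 2) ^ m" by metis
    define Y where "Y m = (\<Sum>i<e. \<iota> (c m i) * z ^ i)" for m
    have Ydiff: "av (Y m - Y m') \<le> av x * (1 / 2) ^ k" if "k \<le> m" "k \<le> m'" for m m' k
    proof -
      have "(1 / 2 :: real) ^ m \<le> (1 / 2) ^ k" "(1 / 2 :: real) ^ m' \<le> (1 / 2) ^ k"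
        using that by (auto intro: power_decreasing)
      then have "av (x - Y m) \<le> av x * (1 / 2) ^ k" "av (x - Y m') \<le> av x * (1 / 2) ^ k"
        using c[of m] c[of m'] unfolding Y_def by (meson N.A_nonneg mult_left_mono order_trans)+
      then show ?thesis using N.A_diff_le[of "x - Y m'" "x - Y m"] by (auto simp: max_def split: if_splits)
    qed
    have "\<exists>l. (\<lambda>m. nv (c m i - l)) \<longlonglongrightarrow> 0" if i: "i < e" for i
    proof (rule complete)
      fix d :: real assume d: "0 < d"
      \<comment> \<open>Dictated by the estimate below: the power \<open>card G\<close> enters
        because \<open>av\<close> restricts to that power of \<open>nv\<close>, and
        \<open>av x + 1\<close> replaces \<open>av x\<close> to avoid dividing by 0.\<close>
      let ?b = "d ^ card G * av z ^ i / (av x + 1)"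
      have x1: "0 < av x + 1" using N.A_nonneg[of x] by linarith
      have "0 < ?b" using d z(3) x1 by simp
      then obtain k where k: "(1 / 2) ^ k < ?b" using real_arch_pow_inv[of ?b "1 / 2"] by auto
      have "nv (c m i - c m' i) < d" if "k \<le> m" "k \<le> m'" for m m'
      proof -
        have "Y m - Y m' = (\<Sum>i<e. \<iota> (c m i - c m' i) * z ^ i)"
          by (simp add: Y_def \<iota>_diff left_diff_distrib sum_subtractf)
        then have "av (\<iota> (c m i - c m' i) * z ^ i) \<le> av (Y m - Y m')"
          using power_sum_ge[OF z(1,3,4) i, of "\<lambda>i. c m i - c m' i"] by simp
        also have "\<dots> \<le> av x * (1 / 2) ^ k" by (rule Ydiff[OF that])
        also have "\<dots> \<le> (av x + 1) * (1 / 2) ^ k" by (intro mult_right_mono) auto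
        also have "\<dots> < (av x + 1) * ?b" using k x1 by (intro mult_strict_left_mono)
        also have "\<dots> = d ^ card G * av z ^ i" using x1 by simp
        finally have "nv (c m i - c m' i) ^ card G * av z ^ i < d ^ card G * av z ^ i"
          by (simp only: N.A_mult N.A_power av_\<iota>)
        then have "nv (c m i - c m' i) ^ card G < d ^ card G" using z(3) by (simp add: mult_less_cancel_right)
        then show ?thesis using d by (meson less_imp_le power_less_imp_less_base)
      qed
      then show "\<exists>N. \<forall>m\<ge>N. \<forall>m'\<ge>N. nv (c m i - c m' i) < d" by blast
    qed
    then obtain l where l: "\<And>i. i < e \<Longrightarrow> (\<lambda>m. nv (c m i - l i)) \<longlonglongrightarrow> 0" by metis
    define y where "y = (\<Sum>i<e. \<iota> (l i) * z ^ i)"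
    have bound: "av (x - y) \<le> av x * (1 / 2) ^ m + (\<Sum>i<e. nv (c m i - l i) ^ card G * av z ^ i)" for m
    proof -
      have "Y m - y = (\<Sum>i<e. \<iota> (c m i - l i) * z ^ i)"
        by (simp add: Y_def y_def \<iota>_diff left_diff_distrib sum_subtractf)
      also have "av \<dots> \<le> (\<Sum>i<e. nv (c m i - l i) ^ card G * av z ^ i)"
      proof (rule N.A_sum_le)
        fix i assume "i \<in> {..<e}"
        then have "nv (c m i - l i) ^ card G * av z ^ i \<le> (\<Sum>i<e. nv (c m i - l i) ^ card G * av z ^ i)"
          by (intro member_le_sum) auto
        then show "av (\<iota> (c m i - l i) * z ^ i) \<le> (\<Sum>i<e. nv (c m i - l i) ^ card G * av z ^ i)"
          by (simp only: N.A_mult N.A_power av_\<iota>)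
      qed (auto intro!: sum_nonneg)
      finally have 1: "av (Y m - y) \<le> (\<Sum>i<e. nv (c m i - l i) ^ card G * av z ^ i)" .
      have 2: "av (x - Y m) \<le> av x * (1 / 2) ^ m" using c by (simp add: Y_def)
      have "av (x - y) \<le> max (av (x - Y m)) (av (Y m - y))"
        using N.A_add_le[of "x - Y m" "Y m - y"] by simp
      also have "\<dots> \<le> av (x - Y m) + av (Y m - y)" by (simp add: max_def)
      finally show ?thesis using 1 2 by linarith
    qed
    have "(\<lambda>m. av x * (1 / 2) ^ m + (\<Sum>i<e. nv (c m i - l i) ^ card G * av z ^ i))
        \<longlonglongrightarrow> av x * 0 + (\<Sum>i<e. 0 ^ card G * av z ^ i)"
      by (intro tendsto_intros l LIMSEQ_realpow_zero) auto
    then have "(\<lambda>m. av x * (1 / 2) ^ m + (\<Sum>i<e. nv (c m i - l i) ^ card G * av z ^ i)) \<longlonglongrightarrow> 0"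
      using card_G by (simp add: zero_power)
    from LIMSEQ_le_const[OF this, of "av (x - y)"] have "av (x - y) \<le> 0" using bound by blast
    then have "x = y" using N.A_nonneg[of "x - y"] N.A_eq_0_iff[of "x - y"] by simp
    then show "x \<in> ?V" unfolding span_powers[OF z(1,3,4)] y_def by blast
  qed
qed

text \<open>The valuation of the norm, restricted to E and divided by the generator g of its value
  group, is the normalised prolongation, with index \<open>card G\<close> divided by g. Equality of
  this index with the degree comes from \<open>span_powers_eq\<close>.\<close>

lemma totally_ramifiedI:
  assumes E: "is_subfield E" "range \<iota> \<subseteq> E"
    and res: "\<And>x. x \<in> E \<Longrightarrow> av x \<le> 1 \<Longrightarrow> \<exists>c. N.cong x (\<iota> c)"
  shows "totally_ramified v \<iota> E"
proof -
  note cl = subfield_closed[OF E(1)]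
  let ?d = "card G"
  define W where "W x = v (knr x)" for x
  have Wmult: "W (x * y) = W x + W y" if "x \<noteq> 0" "y \<noteq> 0" for x y
    using that by (simp add: W_def knr_mult v_mult knr_eq_0_iff)
  have avW: "av x = 2 powi (- W x)" if "x \<noteq> 0" for x
    using that by (simp add: av_def W_def nv_values knr_eq_0_iff)
  have lgW: "lg x = - real_of_int (W x)" if "x \<noteq> 0" for x
    using that by (simp add: lg_def avW powr_real_of_int'[symmetric])
  have W\<iota>: "W (\<iota> c) = int ?d * v c" if "c \<noteq> 0" for c
  proof -
    have "real_of_int (W (\<iota> c)) = real_of_int (int ?d * v c)" 
      using lgW[of "\<iota> c"] lg_\<iota>[OF that] that by simp
    then show ?thesis by (simp only: of_int_eq_iff)
  qed
  have W1: "W 1 = 0" using Wmult[of 1 1] by simp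
  have Winv: "W (inverse x) = - W x" if "x \<noteq> 0" for x
    using Wmult[of x "inverse x"] that W1 by simp
  have Wpow: "W (x ^ m) = int m * W x" if "x \<noteq> 0" for x m
    by (induction m) (auto simp: W1 Wmult that algebra_simps)
  have Wpowi: "W (x powi k) = k * W x" if "x \<noteq> 0" for x k
    using that by (auto simp: power_int_def Wpow Winv)
  obtain t where t: "t \<noteq> 0" "v t = 1" using ex_nv_half by blast
  \<comment> \<open>The positive values of \<open>W\<close> on E. A uniformizer of K provides one,
    and division with remainder shows that the least generates all values.\<close>
  define P where "P m \<longleftrightarrow> 0 < m \<and> (\<exists>x\<in>E. x \<noteq> 0 \<and> W x = int m)" for m
  have "\<iota> t \<in> E" using E(2) by auto
  then have "P ?d" using W\<iota>[OF t(1)] t card_G by (auto simp: P_def intro!: bexI[of _ "\<iota> t"])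
  define g where "g = (LEAST m. P m)"
  have "P g" unfolding g_def by (rule LeastI) fact
  then obtain z where g: "0 < g" and z: "z \<in> E" "z \<noteq> 0" "W z = int g" by (auto simp: P_def)
  have gdvd: "int g dvd W x" if x: "x \<in> E" "x \<noteq> 0" for x
  proof (rule ccontr)
    assume "\<not> int g dvd W x"
    then have "W x mod int g \<noteq> 0" by (simp add: dvd_eq_mod_eq_0)
    moreover have "0 \<le> W x mod int g" using g by simp
    ultimately have m: "0 < W x mod int g" by linarith
    let ?y = "x * z powi (- (W x div int g))"
    have "W ?y = W x - W x div int g * int g" using x z by (simp add: Wmult Wpowi)
    also have "\<dots> = W x mod int g" by (simp add: minus_div_mult_eq_mod)
    finally have "W ?y = int (nat (W x mod int g))" using m by simp
    moreover have "?y \<in> E" "?y \<noteq> 0" using x z by (auto simp: cl)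
    ultimately have "P (nat (W x mod int g))"
      using m unfolding P_def by (intro conjI bexI[of _ ?y]) auto
    then have "g \<le> nat (W x mod int g)" unfolding g_def by (rule Least_le)
    moreover have "W x mod int g < int g" using g by simp
    ultimately show False using m by linarith
  qed
  have "int g dvd int ?d" using gdvd[of "\<iota> t"] \<open>\<iota> t \<in> E\<close> t W\<iota>[OF t(1)] by simp
  then obtain e where e: "?d = g * e" by (auto elim: dvdE)
  have e0: "0 < e" using e card_G by (cases e) auto
  define w where "w x = W x div int g" for x
  have gw: "W x = int g * w x" if "x \<in> E" "x \<noteq> 0" for x
    using gdvd[OF that] by (simp add: w_def)
  have dv: "discrete_valuation_on E w"
    unfolding discrete_valuation_on_def
  proof (intro conjI ballI impI)
    have "k \<in> w ` (E - {0})" for k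
      using z g by (intro image_eqI[of _ _ "z powi k"]) (auto simp: w_def Wpowi cl)
    then show "w ` (E - {0}) = UNIV" by blast
  next
    fix x y assume xy: "x \<in> E - {0}" "y \<in> E - {0}"
    then have "int g * w (x * y) = int g * (w x + w y)"
      using gw[of "x * y"] gw[of x] gw[of y] by (simp add: cl Wmult algebra_simps)
    then show "w (x * y) = w x + w y" using g by simp
    assume "x + y \<noteq> 0"
    then have "2 powi (- W (x + y)) \<le> max (2 powi (- W x)) (2 powi (- W y) :: real)"
      using N.A_add_le[of x y] xy by (simp add: avW)
    then have "min (W x) (W y) \<le> W (x + y)" by (simp add: le_max_iff_disj two_powi_le_iff min_le_iff_disj)
    then show "min (w x) (w y) \<le> w (x + y)"
      using g by (auto simp: w_def min_le_iff_disj intro: zdiv_mono1)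
  qed
  have prol: "prolongs v \<iota> E w e"
    unfolding prolongs_def
  proof (intro conjI allI impI dv e0)
    fix c :: 'k assume "c \<noteq> 0"
    then show "w (\<iota> c) = int e * v c" using g by (simp add: w_def W\<iota> e)
  qed
  have lgz: "real e * lg z = - real ?d" using z by (simp add: lgW e)
  have "V.span ((\<lambda>i. z ^ i) ` {..<e}) = E"
  proof (rule span_powers_eq[OF E res e0 z(1,2) lgz])
    fix x assume x: "x \<in> E" "x \<noteq> 0"
    show "\<exists>k::int. lg x = k * lg z"
      by (intro exI[of _ "w x"]) (use x z gw[OF x] in \<open>simp add: lgW\<close>)
  qed
  moreover from powers_independent[OF e0 z(2) lgz]
  have "V.independent ((\<lambda>i. z ^ i) ` {..<e})" "card ((\<lambda>i. z ^ i) ` {..<e}) = e" by (auto simp: card_image)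
  ultimately have "ext_degree \<iota> E = e" "finite_ext \<iota> E"
    unfolding ext_degree_def finite_ext_def using V.dim_eq_card[of "(\<lambda>i. z ^ i) ` {..<e}" E]
    by (auto simp: V.span_span intro!: exI[of _ "(\<lambda>i. z ^ i) ` {..<e}"])
  with prol show ?thesis by (auto simp: totally_ramified_def)
qed

end

section \<open>The Galois action on residues\<close>

context nonarch_abs
begin

lemma cong_cancel:
  assumes "z * x \<doteq> z * y" "A z = 1"
  shows "x \<doteq> y"
proof -
  have "A z * A (x - y) < 1" using assms(1) by (simp add: cong_def A_mult[symmetric] right_diff_distrib)
  then show ?thesis using assms(2) by (simp add: cong_def)
qed

text \<open>When all \<open>f g\<close> share the leading term of \<open>y\<close>, the product
  behaves like the power (1 + yX) to the exponent \<open>card S\<close>.\<close>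

lemma coeff_prod_cong_binomial:
  assumes "finite S" "y \<noteq> 0" "\<And>g. g \<in> S \<Longrightarrow> f g / y \<doteq> 1"
  shows "coeff (\<Prod>g\<in>S. [:1, f g:]) j / y ^ j \<doteq> of_nat (card S choose j)"
  using assms(1,3)
proof (induction S arbitrary: j rule: finite_induct)
  case empty
  then show ?case by (cases j) simp_all
next
  case (insert g S)
  let ?P = "\<Prod>g\<in>S. [:1, f g:]"
  have P: "(\<Prod>g\<in>insert g S. [:1, f g:]) = ?P + pCons 0 (Polynomial.smult (f g) ?P)"
    using insert.hyps by simp
  have IH: "coeff ?P j / y ^ j \<doteq> of_nat (card S choose j)" for j using insert by auto
  show ?case
  proof (cases j)
    case 0
    then show ?thesis using IH[of 0] unfolding P by simp
  next
    case (Suc i)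
    have "coeff (\<Prod>g\<in>insert g S. [:1, f g:]) j / y ^ j
        = coeff ?P j / y ^ j + (f g / y) * (coeff ?P i / y ^ i)"
      unfolding P Suc by (simp add: add_divide_distrib)
    also have "\<dots> \<doteq> of_nat (card S choose j) + 1 * of_nat (card S choose i)"
      using insert.prems by (intro cong_add cong_mult IH A_of_nat_le_1) auto
    also have "\<dots> = of_nat (card (insert g S) choose j)"
      using insert.hyps by (simp add: Suc)
    finally show ?thesis .
  qed
qed

end

context local_galois
begin

lemma av_\<iota>_le_1_iff: "av (\<iota> c) \<le> 1 \<longleftrightarrow> nv c \<le> 1"
proof (cases "nv c \<le> 1")
  case True
  then show ?thesis by (simp add: av_\<iota> power_le_one)
next
  case False
  then have "1 < nv c ^ card G" using card_G by (intro one_less_power) auto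
  with False show ?thesis by (simp add: av_\<iota>)
qed

lemma av_\<iota>_less_1_iff: "av (\<iota> c) < 1 \<longleftrightarrow> nv c < 1"
proof (cases "nv c < 1")
  case True
  then have "nv c ^ card G \<le> nv c ^ 1" using card_G by (intro power_decreasing) auto
  with True show ?thesis by (simp add: av_\<iota>)
next
  case False
  then have "1 \<le> nv c ^ card G" by (intro one_le_power) simp
  with False show ?thesis unfolding av_\<iota> by (metis not_less)
qed

lemma \<iota>_cong_iff: "N.cong (\<iota> x) (\<iota> y) \<longleftrightarrow> K.cong x y"
  by (simp add: N.cong_def K.cong_def \<iota>_diff[symmetric] av_\<iota>_less_1_iff)

lemma G_cong: "g \<in> G \<Longrightarrow> N.cong x y \<Longrightarrow> N.cong (g x) (g y)"
  by (simp add: N.cong_def G_diff[symmetric] av_G)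

section \<open>The residue field of K inside that of N\<close>

definition Q :: nat where
  "Q = card (carrier K.residue_ring)"

lemma Q_prime_power:
  obtains p s where "prime p" "0 < s" "Q = p ^ s" "av (of_nat p) < 1"
proof -
  obtain p s where ps: "prime p" "0 < s" "Q = p ^ s" "nv (of_nat p) < 1"
    using K.card_residue_ring_prime_power[OF finite_residue] unfolding Q_def by metis
  then have "av (of_nat p) < 1" using av_\<iota>_less_1_iff[of "of_nat p"] by (simp add: \<iota>_of_nat)
  with ps that show thesis by blast
qed

lemma Q_gt_1: "1 < Q"
  by (rule Q_prime_power) (metis one_less_power prime_gt_1_nat)

lemma fermat_\<iota>: "nv c \<le> 1 \<Longrightarrow> N.cong (\<iota> c ^ Q) (\<iota> c)"
  using K.fermat[OF finite_residue, of c] by (simp add: Q_def \<iota>_power[symmetric] \<iota>_cong_iff)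

text \<open>Representatives of the nonzero residues of K already supply Q - 1 roots of unity of
  order dividing Q - 1. A unit incongruent to all of them would be one root too many.\<close>

lemma frobenius_fixed:
  assumes x: "av x \<le> 1" "N.cong (x ^ Q) x"
  shows "\<exists>c. nv c \<le> 1 \<and> N.cong x (\<iota> c)"
proof (rule ccontr)
  assume no: "\<not> ?thesis"
  have root: "N.cong (y ^ (Q - 1)) 1" if "av y = 1" "N.cong (y ^ Q) y" for y
  proof (rule N.cong_cancel[OF _ that(1)])
    have "y * y ^ (Q - 1) = y ^ Q" using Q_gt_1 by (metis less_imp_le_nat less_one not_less power_eq_if order_less_trans)
    then show "N.cong (y * y ^ (Q - 1)) (y * 1)" using that(2) by simp
  qed
  have x1: "av x = 1"
  proof (rule ccontr)
    assume "av x \<noteq> 1"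
    then have "N.cong x (\<iota> 0)" using x(1) by (simp add: N.cong_0_iff)
    then show False using no by (metis K.A_0 zero_le_one)
  qed
  define R where "R = K.rep ` (carrier K.residue_ring - {K.res 0})"
  have rep: "K.res (K.rep X) = X" if X: "X \<in> carrier K.residue_ring" for X
  proof -
    obtain y where "X = K.res y" using X by (auto simp: K.residue_ring_carrier)
    then show ?thesis using K.rep_res[of y] by (simp add: K.res_eq_iff)
  qed
  have R1: "nv c = 1" if c: "c \<in> R" for c
  proof -
    obtain X where X: "X \<in> carrier K.residue_ring" "X \<noteq> K.res 0" "c = K.rep X"
      using c unfolding R_def by blast
    then have "K.res c \<in> carrier K.residue_ring" "K.res c \<noteq> K.res 0" by (simp_all add: rep)
    then show ?thesis using K.res_eq_iff[of c 0] K.cong_0_iff[of c] by (auto simp: K.res_in_carrier_iff)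
  qed
  have inj: "x = y" if "x \<in> R" "y \<in> R" "K.cong x y" for x y
  proof -
    obtain X Y where "X \<in> carrier K.residue_ring" "x = K.rep X" "Y \<in> carrier K.residue_ring" "y = K.rep Y"
      using \<open>x \<in> R\<close> \<open>y \<in> R\<close> unfolding R_def by blast
    then show ?thesis using that(3) K.res_eq_iff[of x y] rep by metis
  qed
  have "inj_on K.rep (carrier K.residue_ring)" using rep by (metis inj_onI)
  then have "inj_on K.rep (carrier K.residue_ring - {K.res 0})" by (rule inj_on_subset) blast
  then have "card R = card (carrier K.residue_ring - {K.res 0})" unfolding R_def by (rule card_image)
  also have "\<dots> = Q - 1"
  proof -
    have "K.res 0 \<in> carrier K.residue_ring" by (simp add: K.res_in_carrier_iff)
    then show ?thesis unfolding Q_def by (rule card_Diff_singleton)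
  qed
  finally have cR: "card R = Q - 1" .
  have finR: "finite R" unfolding R_def using finite_residue by simp
  have no': "\<not> N.cong x (\<iota> c)" if "c \<in> R" for c
    using no R1[OF that] by (metis order_refl)
  then have notin: "x \<notin> \<iota> ` R" using N.cong_refl by blast
  have "card (insert x (\<iota> ` R)) = Suc (card (\<iota> ` R))" using finR notin by simp
  also have "card (\<iota> ` R) = Q - 1" using \<iota>_inj cR by (metis card_image inj_on_subset subset_UNIV)
  finally have "card (insert x (\<iota> ` R)) = Q" using Q_gt_1 by simp
  moreover have "card (insert x (\<iota> ` R)) \<le> Q - 1"
  proof (rule N.card_roots_of_unity_le[OF finite_residue_N])
    show "Q - 1 \<noteq> 0" using Q_gt_1 by simp
    have *: "av (\<iota> c) = 1" if "c \<in> R" for c using R1[OF that] by (simp add: av_\<iota>)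
    fix y assume y: "y \<in> insert x (\<iota> ` R)"
    have "av y = 1" using y x1 * by auto
    then show "av y \<le> 1" by simp
    have "N.cong (\<iota> c ^ Q) (\<iota> c)" if "c \<in> R" for c using fermat_\<iota>[of c] R1[OF that] by simp
    then have "N.cong (y ^ Q) y" using y x(2) by blast
    then show "N.cong (y ^ (Q - 1)) 1" by (rule root[OF \<open>av y = 1\<close>])
    fix z assume z: "z \<in> insert x (\<iota> ` R)" and yz: "N.cong y z"
    consider "y = x" "z = x" | c where "y = x" "z = \<iota> c" "c \<in> R" | c where "z = x" "y = \<iota> c" "c \<in> R"
      | c c' where "y = \<iota> c" "z = \<iota> c'" "c \<in> R" "c' \<in> R"
      using y z by blast
    then show "y = z"
    proof cases
      case (2 c)
      then show ?thesis using no'[of c] yz by simp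
    next
      case (3 c)
      then show ?thesis using no'[of c] N.cong_sym[OF yz] by simp
    next
      case (4 c c')
      then show ?thesis using inj[of c c'] yz by (simp add: \<iota>_cong_iff)
    qed simp
  qed
  ultimately show False using Q_gt_1 by simp
qed

text \<open>A map on N that induces an endomorphism of its residue field over that of K. Elements of
  \<open>G\<close> and the Q-power map, which is no automorphism of N, are thereby treated
  alike.\<close>

definition residue_endo :: "('n \<Rightarrow> 'n) \<Rightarrow> bool" where
  "residue_endo \<psi> \<longleftrightarrow>
     (\<forall>x y. av x \<le> 1 \<and> av y \<le> 1 \<longrightarrow> av (\<psi> x) \<le> 1 \<and> (N.cong x y \<longrightarrow> N.cong (\<psi> x) (\<psi> y)) \<and>
        N.cong (\<psi> (x + y)) (\<psi> x + \<psi> y) \<and> N.cong (\<psi> (x * y)) (\<psi> x * \<psi> y)) \<and>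
     (\<forall>c. nv c \<le> 1 \<longrightarrow> N.cong (\<psi> (\<iota> c)) (\<iota> c))"

lemma residue_endo_G: "g \<in> G \<Longrightarrow> residue_endo g"
  by (auto simp: residue_endo_def av_G G_add G_mult G_\<iota> G_cong)

lemma residue_endo_frobenius: "residue_endo (\<lambda>x. x ^ Q)"
proof -
  obtain p s where p: "prime p" "Q = p ^ s" "av (of_nat p) < 1" using Q_prime_power by blast
  have "N.cong ((x + y) ^ Q) (x ^ Q + y ^ Q)" if "av x \<le> 1" "av y \<le> 1" for x y
    unfolding p(2) by (rule N.frobenius_add[OF p(1,3) that])
  then show ?thesis
    by (auto simp: residue_endo_def N.integral_power N.cong_power power_mult_distrib fermat_\<iota>)
qed

end

section \<open>The extension L and the conjugates of its uniformizer\<close>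

locale totally_ramified_ext = local_galois v \<iota> for v :: "'k::field \<Rightarrow> int" and \<iota> :: "'k \<Rightarrow> 'n::field" +
  fixes L :: "'n set" and \<pi> :: 'n and n :: nat
  assumes L: "is_subfield L" "range \<iota> \<subseteq> L"
    and n: "0 < n"
    and \<pi>: "\<pi> \<in> L" "\<pi> \<noteq> 0" "real n * lg \<pi> = - real (card G)"
    and L_span: "L = V.span ((\<lambda>i. \<pi> ^ i) ` {..<n})"
begin

lemma residue_L: "x \<in> L \<Longrightarrow> av x \<le> 1 \<Longrightarrow> \<exists>c. nv c \<le> 1 \<and> N.cong x (\<iota> c)"
  by (rule totally_ramified_residue[OF n \<pi>(2,3), folded L_span])

text \<open>The powers of \<open>\<pi>\<close> span L, so the stabiliser of \<open>\<pi>\<close> is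
  the Galois group of N over L, and conjugates of \<open>\<pi>\<close> can stand for conjugate
  fields.\<close>

lemma fixes_L:
  assumes "h \<in> G" "h \<pi> = \<pi>" "y \<in> L"
  shows "h y = y"
proof -
  have "L = {x. \<exists>c. x = (\<Sum>i<n. \<iota> (c i) * \<pi> ^ i)}"
    using L_span span_powers[OF n \<pi>(2,3)] by (rule trans)
  with assms(3) have "y \<in> {x. \<exists>c. x = (\<Sum>i<n. \<iota> (c i) * \<pi> ^ i)}" by (simp only:)
  then obtain c where "y = (\<Sum>i<n. \<iota> (c i) * \<pi> ^ i)" by (elim CollectE exE)
  then show ?thesis using assms by (simp add: G_sum G_mult G_\<iota> G_power)
qed

definition X :: "'n set" where
  "X = (\<lambda>g. g \<pi>) ` G"

lemma finite_X: "finite X"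
  by (simp add: X_def finite_G)

lemma G_X: "h \<in> G \<Longrightarrow> bij_betw h X X"
proof -
  have sub: "h ` X \<subseteq> X" if "h \<in> G" for h
    unfolding X_def using G_comp[OF that] by (auto simp: image_iff) (metis comp_apply)
  assume h: "h \<in> G"
  have "inj_on h X" using G_inj[OF h] by (auto intro: inj_onI)
  then show ?thesis using sub[OF h] finite_X by (simp add: bij_betw_def endo_inj_surj)
qed

text \<open>Lagrange interpolation through the conjugates of \<open>\<pi>\<close>, applied to \<open>y\<close> and to \<open>1\<close>.\<close>

lemma fixed_in_L:
  assumes fixed: "\<And>h. h \<in> G \<Longrightarrow> h \<pi> = \<pi> \<Longrightarrow> h y = y"
  shows "y \<in> L"
proof -
  define D where "D = (\<Prod>x\<in>X - {\<pi>}. \<pi> - x)"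
  have piX: "\<pi> \<in> X" using G_id by (auto simp: X_def)
  have in_L: "y * D \<in> L" if fixed: "\<And>h. h \<in> G \<Longrightarrow> h \<pi> = \<pi> \<Longrightarrow> h y = y" for y
  proof -
    \<comment> \<open>A representative of the coset carrying \<open>\<pi>\<close> to
      \<open>x\<close>. The value \<open>\<gamma> x y\<close> does not depend on the choice, since
      the stabiliser of \<open>\<pi>\<close> fixes \<open>y\<close>.\<close>
    define \<gamma> where "\<gamma> x = (SOME g. g \<in> G \<and> g \<pi> = x)" for x
    have \<gamma>: "\<gamma> x \<in> G" "\<gamma> x \<pi> = x" if "x \<in> X" for x
    proof -
      have "\<exists>g. g \<in> G \<and> g \<pi> = x" using that by (auto simp: X_def)
      from someI_ex[OF this] show "\<gamma> x \<in> G" "\<gamma> x \<pi> = x" unfolding \<gamma>_def by blast+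
    qed
    have same: "g y = g' y" if "g \<in> G" "g' \<in> G" "g \<pi> = g' \<pi>" for g g'
    proof -
      have "(inv_into UNIV g' \<circ> g) y = y"
        using that by (intro fixed G_comp G_inv) auto
      then have "g' (inv_into UNIV g' (g y)) = g' y" by simp
      then show ?thesis using that by simp
    qed
    define P where "P x = (\<Prod>x'\<in>X - {x}. [:- x', 1:])" for x
    \<comment> \<open>Lagrange interpolation without its denominators, so the value at
      \<open>\<pi>\<close> is \<open>y * D\<close>. Automorphisms permute nodes and prescribed
      values together, so the coefficients lie in K.\<close>
    define F where "F = (\<Sum>x\<in>X. Polynomial.smult (\<gamma> x y) (P x))"
    have "coeff F k \<in> range \<iota>" for k
    proof (rule fixed_by_G)
      fix h assume h: "h \<in> G"
      have hP: "map_poly h (P x) = P (h x)" if "x \<in> X" for x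
      proof -
        have bij: "bij_betw h (X - {x}) (X - {h x})"
        proof -
          have "h ` (X - {x}) = h ` X - {h x}" using G_inj[OF h] by auto
          then show ?thesis using G_X[OF h] by (simp add: bij_betw_def inj_on_diff)
        qed
        have "map_poly h (P x) = (\<Prod>x'\<in>X - {x}. [:- h x', 1:])"
          unfolding P_def map_poly_G_prod[OF h] by (simp add: map_poly_pCons h G_uminus)
        also have "\<dots> = P (h x)"
          unfolding P_def by (rule prod.reindex_bij_betw[OF bij, of "\<lambda>x. [:- x, 1:]"])
        finally show ?thesis .
      qed
      have "h (coeff F k) = (\<Sum>x\<in>X. h (\<gamma> x y) * h (coeff (P x) k))"
        by (simp add: F_def coeff_sum h G_sum G_mult)
      also have "\<dots> = (\<Sum>x\<in>X. \<gamma> (h x) y * coeff (P (h x)) k)"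
      proof (rule sum.cong[OF refl])
        fix x assume x: "x \<in> X"
        have hx: "h x \<in> X" using G_X[OF h] x by (auto dest: bij_betwE)
        have "(h \<circ> \<gamma> x) y = \<gamma> (h x) y"
          by (rule same[OF G_comp[OF h \<gamma>(1)[OF x]] \<gamma>(1)[OF hx]]) (simp add: \<gamma>(2)[OF x] \<gamma>(2)[OF hx])
        moreover have "h (coeff (P x) k) = coeff (P (h x)) k"
          using hP[OF x] h by (metis G_0 coeff_map_poly)
        ultimately show "h (\<gamma> x y) * h (coeff (P x) k) = \<gamma> (h x) y * coeff (P (h x)) k" by simp
      qed
      also have "\<dots> = (\<Sum>x\<in>X. \<gamma> x y * coeff (P x) k)"
        by (rule sum.reindex_bij_betw[OF G_X[OF h], of "\<lambda>x. \<gamma> x y * coeff (P x) k"])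
      also have "\<dots> = coeff F k" by (simp add: F_def coeff_sum)
      finally show "h (coeff F k) = coeff F k" .
    qed
    then have "coeff F i \<in> L" for i using L(2) by blast
    then have "poly F \<pi> \<in> L"
      unfolding poly_altdef using \<pi>(1)
      by (intro subfield_sum[OF L(1)] subfield_closed(5)[OF L(1)] subfield_closed(9)[OF L(1)])
    moreover have "poly F \<pi> = (\<Sum>x\<in>X. if x = \<pi> then y * D else 0)"
      unfolding F_def poly_sum
    proof (rule sum.cong[OF refl])
      fix x assume x: "x \<in> X"
      show "poly (Polynomial.smult (\<gamma> x y) (P x)) \<pi> = (if x = \<pi> then y * D else 0)"
      proof (cases "x = \<pi>")
        case True
        then show ?thesis using fixed[of "\<gamma> \<pi>"] \<gamma>[OF piX] by (simp add: P_def poly_prod D_def)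
      next
        case False
        then have "(\<Prod>x'\<in>X - {x}. \<pi> - x') = 0" using piX finite_X by (intro prod_zero) auto
        then show ?thesis using False by (simp add: P_def poly_prod)
      qed
    qed
    ultimately show ?thesis using piX finite_X by simp
  qed
  have "D \<in> L" using in_L[of 1] by simp
  moreover have "y * D \<in> L" using fixed by (rule in_L)
  ultimately have "y * D / D \<in> L" by (intro subfield_closed(8)[OF L(1)])
  moreover have "D \<noteq> 0" using finite_X by (auto simp: D_def)
  ultimately show ?thesis by simp
qed

text \<open>Since \<open>L\<close> has the residue field of \<open>K\<close>, the characteristic polynomial of a generator \<open>a\<close> of
  the residue field of \<open>N\<close> over \<open>L\<close> reduces to a polynomial over that of \<open>K\<close>, so \<open>\<psi> a\<close> is
  again one of its roots.\<close>

lemma residue_endo_lift: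
  assumes \<psi>: "residue_endo \<psi>"
  shows "\<exists>h\<in>G. h \<pi> = \<pi> \<and> (\<forall>x. av x \<le> 1 \<longrightarrow> N.cong (h x) (\<psi> x))"
proof -
  have \<psi>_int: "av (\<psi> x) \<le> 1" if "av x \<le> 1" for x using \<psi> that by (auto simp: residue_endo_def)
  have \<psi>_cong: "N.cong (\<psi> x) (\<psi> y)" if "av x \<le> 1" "av y \<le> 1" "N.cong x y" for x y
    using \<psi> that by (auto simp: residue_endo_def)
  have \<psi>_add: "N.cong (\<psi> (x + y)) (\<psi> x + \<psi> y)" and \<psi>_mult: "N.cong (\<psi> (x * y)) (\<psi> x * \<psi> y)"
    if "av x \<le> 1" "av y \<le> 1" for x y
    using \<psi> that by (auto simp: residue_endo_def)
  have \<psi>_\<iota>: "N.cong (\<psi> (\<iota> c)) (\<iota> c)" if "nv c \<le> 1" for c using \<psi> that by (auto simp: residue_endo_def)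
  have \<psi>_0: "N.cong (\<psi> 0) 0" using \<psi>_\<iota>[of 0] by simp
  have \<psi>_power: "N.cong (\<psi> (x ^ k)) (\<psi> x ^ k)" if x: "av x \<le> 1" for x k
  proof (induction k)
    case 0
    then show ?case using \<psi>_\<iota>[of 1] by simp
  next
    case (Suc k)
    have "N.cong (\<psi> (x ^ Suc k)) (\<psi> x * \<psi> (x ^ k))"
      using \<psi>_mult[of x "x ^ k"] x by (simp add: N.integral_power)
    also have "N.cong \<dots> (\<psi> x * \<psi> x ^ k)"
      using x Suc by (intro N.cong_mult) (auto intro: \<psi>_int N.integral_power)
    finally show ?case by simp
  qed
  have \<psi>_sum: "N.cong (\<psi> (sum f S)) (\<Sum>i\<in>S. \<psi> (f i))" if "\<And>i. i \<in> S \<Longrightarrow> av (f i) \<le> 1"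
    for f and S :: "nat set"
    using that
  proof (induction S rule: infinite_finite_induct)
    case (insert i S)
    have "N.cong (\<psi> (f i + sum f S)) (\<psi> (f i) + \<psi> (sum f S))"
      using insert.prems by (intro \<psi>_add N.A_sum_le) auto
    also have "N.cong \<dots> (\<psi> (f i) + (\<Sum>i\<in>S. \<psi> (f i)))"
      using insert by (intro N.cong_add) auto
    finally show ?case using insert.hyps by simp
  qed (auto simp: \<psi>_0)
  obtain a where a: "av a = 1" "\<And>x. av x = 1 \<Longrightarrow> \<exists>i. N.cong x (a ^ i)"
    using N.units_cyclic[OF finite_residue_N] by blast
  define H where "H = {h \<in> G. h \<pi> = \<pi>}"
  have finH: "finite H" unfolding H_def using finite_G by simp
  let ?P = "cpoly H a" and ?m = "card H"
  have P_L: "coeff ?P k \<in> L" for k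
  proof (rule fixed_in_L)
    fix h assume h: "h \<in> G" "h \<pi> = \<pi>"
    have "inv_into UNIV h \<pi> = \<pi>" using h by (metis G_inv_left)
    then have "bij_betw (\<lambda>g. h \<circ> g) H H"
      using h G_inv[OF h(1)]
      by (intro bij_betwI[where g = "\<lambda>g. inv_into UNIV h \<circ> g"]) (auto intro: G_comp simp: H_def fun_eq_iff)
    with h show "h (coeff ?P k) = coeff ?P k" by (intro cpoly_fixed)
  qed
  have P_int: "av (coeff ?P k) \<le> 1" for k using a(1) by (intro cpoly_integral) (auto simp: H_def)
  from residue_L[OF P_L P_int] obtain d where d: "\<And>k. nv (d k) \<le> 1" "\<And>k. N.cong (coeff ?P k) (\<iota> (d k))"
    by metis
  have red: "N.cong (poly ?P y) (\<Sum>i\<le>?m. \<iota> (d i) * y ^ i)" if "av y \<le> 1" for y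
    unfolding poly_altdef degree_cpoly using that d
    by (intro N.cong_sum N.cong_mult N.integral_power) (auto simp: av_\<iota>_le_1_iff)
  have "poly ?P a = 0" using finH G_id by (auto simp: poly_cpoly H_def)
  then have "N.cong (\<Sum>i\<le>?m. \<iota> (d i) * a ^ i) 0" using red[of a] a(1) N.cong_sym by simp
  moreover have int: "av (\<iota> (d i) * a ^ i) \<le> 1" for i
    using a(1) d(1)[of i] by (intro N.integral_mult N.integral_power) (auto simp: av_\<iota>_le_1_iff)
  ultimately have "N.cong (\<psi> (\<Sum>i\<le>?m. \<iota> (d i) * a ^ i)) (\<psi> 0)"
    by (intro \<psi>_cong N.A_sum_le) auto
  then have z: "N.cong (\<psi> (\<Sum>i\<le>?m. \<iota> (d i) * a ^ i)) 0" using \<psi>_0 N.cong_trans by blast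
  have "N.cong (poly ?P (\<psi> a)) (\<Sum>i\<le>?m. \<iota> (d i) * \<psi> a ^ i)"
    using a(1) by (intro red \<psi>_int) simp
  also have "N.cong \<dots> (\<Sum>i\<le>?m. \<psi> (\<iota> (d i) * a ^ i))"
  proof (rule N.cong_sum)
    fix i
    have "N.cong (\<psi> (\<iota> (d i) * a ^ i)) (\<psi> (\<iota> (d i)) * \<psi> (a ^ i))"
      using a(1) d(1)[of i] by (intro \<psi>_mult N.integral_power) (auto simp: av_\<iota>_le_1_iff)
    also have "N.cong \<dots> (\<iota> (d i) * \<psi> a ^ i)"
      using a(1) d(1)[of i]
      by (intro N.cong_mult \<psi>_\<iota> \<psi>_power N.integral_power \<psi>_int) (auto simp: av_\<iota>_le_1_iff)
    finally show "N.cong (\<iota> (d i) * \<psi> a ^ i) (\<psi> (\<iota> (d i) * a ^ i))" by (rule N.cong_sym)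
  qed
  also have "N.cong \<dots> (\<psi> (\<Sum>i\<le>?m. \<iota> (d i) * a ^ i))"
    by (rule N.cong_sym[OF \<psi>_sum]) (rule int)
  also note z
  finally have "N.cong (\<Prod>h\<in>H. \<psi> a - h a) 0" by (simp add: poly_cpoly)
  moreover have "av (\<psi> a - h a) \<le> 1" if "h \<in> H" for h
  proof -
    have "av (h a) = 1" "av (\<psi> a) \<le> 1" using a(1) that \<psi>_int[of a] by (auto simp: H_def av_G)
    then show ?thesis using N.A_diff_le[of "\<psi> a" "h a"] by simp
  qed
  \<comment> \<open>The maximal ideal is prime, so one of the integral factors lies in it.\<close>
  ultimately obtain h where h: "h \<in> H" "N.cong (\<psi> a - h a) 0" using N.cong_prod_0D by blast
  then have hG: "h \<in> G" "h \<pi> = \<pi>" and ha: "N.cong (h a) (\<psi> a)"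
    by (auto simp: H_def N.cong_def N.A_diff_commute)
  \<comment> \<open>Units are powers of \<open>a\<close> up to congruence, so agreement at
    \<open>a\<close> spreads to them; nonunits are congruent to 0.\<close>
  have "N.cong (h x) (\<psi> x)" if x: "av x \<le> 1" for x
  proof (cases "av x = 1")
    case True
    then obtain i where i: "N.cong x (a ^ i)" using a(2) by blast
    have "N.cong (h x) (h (a ^ i))" by (rule G_cong[OF hG(1) i])
    also have "h (a ^ i) = h a ^ i" using hG by (simp add: G_power)
    also have "N.cong \<dots> (\<psi> a ^ i)" using ha a(1) by (intro N.cong_power \<psi>_int) auto
    also have "N.cong \<dots> (\<psi> (a ^ i))" using a(1) by (intro N.cong_sym[OF \<psi>_power]) simp
    also have "N.cong \<dots> (\<psi> x)"
      using a(1) x i by (intro \<psi>_cong N.cong_sym[OF i]) (auto simp: N.integral_power)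
    finally show ?thesis .
  next
    case False
    then have "N.cong x 0" using x by (simp add: N.cong_0_iff)
    then have "N.cong (h x) (h 0)" "N.cong (\<psi> x) (\<psi> 0)"
      using G_cong[OF hG(1)] x by (auto intro!: \<psi>_cong)
    moreover have "h 0 = 0" using hG(1) by simp
    ultimately show ?thesis using \<psi>_0 by (metis N.cong_sym N.cong_trans)
  qed
  with hG show ?thesis by blast
qed

subsection \<open>Elements inducing the Frobenius\<close>

definition T :: "('n \<Rightarrow> 'n) set" where
  "T = {t \<in> G. \<forall>x. av x \<le> 1 \<longrightarrow> N.cong (t x) (x ^ Q)}"

text \<open>Raising to the power Q commutes with every automorphism.\<close>

lemma T_conj:
  assumes "t \<in> T" "g \<in> G"
  shows "inv_into UNIV g \<circ> t \<circ> g \<in> T"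
proof -
  have t: "t \<in> G" using assms by (simp add: T_def)
  have "N.cong ((inv_into UNIV g \<circ> t \<circ> g) x) (x ^ Q)" if "av x \<le> 1" for x
  proof -
    have "N.cong (t (g x)) (g x ^ Q)" using assms that by (auto simp: T_def av_G)
    then have "N.cong (inv_into UNIV g (t (g x))) (inv_into UNIV g (g x ^ Q))"
      by (rule G_cong[OF G_inv[OF assms(2)]])
    then show ?thesis using assms(2) by (simp add: G_power[OF G_inv[OF assms(2)]])
  qed
  then show ?thesis using assms(2) t by (simp add: T_def G_comp G_inv)
qed

text \<open>If g carries \<open>\<pi>\<close> to x, the lifting lemma gives h fixing
  \<open>\<pi>\<close> with the residue action of the inverse of g. Then g after h still carries
  \<open>\<pi>\<close> to x and acts trivially on residues.\<close>

lemma ex_inertia: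
  assumes "x \<in> X"
  obtains i where "i \<in> G" "i \<pi> = x" "\<And>y. av y \<le> 1 \<Longrightarrow> N.cong (i y) y"
proof -
  obtain g where g: "g \<in> G" "x = g \<pi>" using assms by (auto simp: X_def)
  obtain h where h: "h \<in> G" "h \<pi> = \<pi>" "\<And>y. av y \<le> 1 \<Longrightarrow> N.cong (h y) (inv_into UNIV g y)"
    using residue_endo_lift[OF residue_endo_G[OF G_inv[OF g(1)]]] by blast
  have "N.cong ((g \<circ> h) y) y" if "av y \<le> 1" for y
    using G_cong[OF g(1) h(3)[OF that]] g(1) by simp
  with g h that[of "g \<circ> h"] show thesis by (simp add: G_comp)
qed

lemma inertia_comp_T:
  assumes "i \<in> G" "\<And>y. av y \<le> 1 \<Longrightarrow> N.cong (i y) y" "t \<in> T"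
  shows "i \<circ> t \<in> T" "inv_into UNIV i \<circ> t \<in> T"
proof -
  have t: "t \<in> G" "\<And>x. av x \<le> 1 \<Longrightarrow> N.cong (t x) (x ^ Q)" using assms(3) by (auto simp: T_def)
  have "N.cong (i (t x)) (x ^ Q)" if "av x \<le> 1" for x
    using assms(2)[of "t x"] t(2)[OF that] that N.cong_trans by (simp add: av_G[OF t(1)])
  then show "i \<circ> t \<in> T" using assms t by (simp add: T_def G_comp)
  have "N.cong (inv_into UNIV i (t x)) (x ^ Q)" if "av x \<le> 1" for x
  proof -
    have "N.cong (inv_into UNIV i (i (t x))) (inv_into UNIV i (t x))"
      using assms(2)[of "t x"] that by (intro G_cong[OF G_inv[OF assms(1)]]) (simp add: av_G[OF t(1)])
    then have "N.cong (inv_into UNIV i (t x)) (t x)" using assms(1) by (simp add: N.cong_sym)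
    then show ?thesis using t(2)[OF that] N.cong_trans by blast
  qed
  then show "inv_into UNIV i \<circ> t \<in> T" using assms t by (simp add: T_def G_comp G_inv)
qed

lemma ex_T_fixing: "\<exists>t\<in>T. t \<pi> = \<pi>"
  using residue_endo_lift[OF residue_endo_frobenius] by (auto simp: T_def)

text \<open>Hence a function of g that depends only on \<open>g \<pi>\<close> takes all its values
  on T.\<close>

lemma ex_T_conjugate:
  assumes "x \<in> X"
  shows "\<exists>t\<in>T. t \<pi> = x"
proof -
  obtain i where i: "i \<in> G" "i \<pi> = x" "\<And>y. av y \<le> 1 \<Longrightarrow> N.cong (i y) y" using ex_inertia[OF assms] by blast
  obtain t where "t \<in> T" "t \<pi> = \<pi>" using ex_T_fixing by blast
  then show ?thesis using i inertia_comp_T(1)[OF i(1,3)] by (intro bexI[of _ "i \<circ> t"]) auto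
qed

text \<open>The elements of \<open>T\<close> have one fixed point in \<open>X\<close> on average, so if none of them has two
  then each has one.\<close>

lemma T_fixed_point:
  assumes unique: "\<And>t x y. t \<in> T \<Longrightarrow> x \<in> X \<Longrightarrow> y \<in> X \<Longrightarrow> t x = x \<Longrightarrow> t y = y \<Longrightarrow> x = y"
    and "t \<in> T"
  shows "\<exists>x\<in>X. t x = x"
proof -
  have finT: "finite T" by (rule finite_subset[OF _ finite_G]) (auto simp: T_def)
  define F where "F x = {t \<in> T. t x = x}" for x
  define R where "R x = {t \<in> T. t \<pi> = x}" for x
  have cF: "card (F x) = card (F \<pi>)" if x: "x \<in> X" for x
  proof -
    obtain g where g: "g \<in> G" "x = g \<pi>" using x by (auto simp: X_def)
    have ig: "inv_into UNIV g \<in> G" by (rule G_inv[OF g(1)])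
    have iig: "inv_into UNIV (inv_into UNIV g) = g" using G_bij[OF g(1)] by (rule inv_inv_eq)
    have "bij_betw (\<lambda>t. inv_into UNIV g \<circ> t \<circ> g) (F x) (F \<pi>)"
    proof (rule bij_betwI[where g = "\<lambda>t. g \<circ> t \<circ> inv_into UNIV g"])
      show "(\<lambda>t. inv_into UNIV g \<circ> t \<circ> g) \<in> F x \<rightarrow> F \<pi>"
        using g T_conj by (auto simp: F_def)
      show "(\<lambda>t. g \<circ> t \<circ> inv_into UNIV g) \<in> F \<pi> \<rightarrow> F x"
        using g T_conj[OF _ ig] unfolding iig by (auto simp: F_def)
    qed (use g in \<open>auto simp: fun_eq_iff\<close>)
    then show ?thesis by (rule bij_betw_same_card)
  qed
  have cR: "card (R x) = card (F \<pi>)" if x: "x \<in> X" for x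
  proof -
    obtain i where i: "i \<in> G" "i \<pi> = x" "\<And>y. av y \<le> 1 \<Longrightarrow> N.cong (i y) y" using ex_inertia[OF x] by blast
    have "bij_betw (\<lambda>t. i \<circ> t) (F \<pi>) (R x)"
    proof (rule bij_betwI[where g = "\<lambda>t. inv_into UNIV i \<circ> t"])
      show "(\<lambda>t. i \<circ> t) \<in> F \<pi> \<rightarrow> R x"
        using i inertia_comp_T(1)[OF i(1,3)] by (auto simp: F_def R_def)
      show "(\<lambda>t. inv_into UNIV i \<circ> t) \<in> R x \<rightarrow> F \<pi>"
        using i inertia_comp_T(2)[OF i(1,3)] by (auto simp: F_def R_def)
    qed (use i in \<open>auto simp: fun_eq_iff\<close>)
    then show ?thesis by (rule bij_betw_same_card[symmetric])
  qed
  \<comment> \<open>Sorting T by the image of \<open>\<pi>\<close> gives \<open>card X\<close>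
    classes of size \<open>card (F \<pi>)\<close>, which is also the size of each
    \<open>F x\<close>. When the sets \<open>F x\<close> are disjoint, they therefore exhaust
    T.\<close>
  have "T = (\<Union>x\<in>X. R x)" by (auto simp: R_def X_def T_def)
  then have "card T = card (\<Union>x\<in>X. R x)" by (rule arg_cong)
  also have "\<dots> = (\<Sum>x\<in>X. card (R x))"
    using finite_X finT by (intro card_UN_disjoint) (auto simp: R_def)
  also have "\<dots> = (\<Sum>x\<in>X. card (F x))" by (rule sum.cong) (simp_all add: cR cF)
  also have "\<dots> = card (\<Union>x\<in>X. F x)"
    using finite_X finT unique by (subst card_UN_disjoint) (auto simp: F_def)
  finally have "card (\<Union>x\<in>X. F x) = card T" by simp
  then have "(\<Union>x\<in>X. F x) = T" using finT by (intro card_subset_eq) (auto simp: F_def)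
  then show ?thesis using \<open>t \<in> T\<close> by (auto simp: F_def)
qed

end

section \<open>The tame character\<close>

context totally_ramified_ext
begin

lemma prod_G_coeff:
  "coeff (\<Prod>g\<in>G. [:1, g x:]) k \<in> range \<iota>"
proof (rule fixed_by_G)
  fix h assume h: "h \<in> G"
  let ?P = "\<Prod>g\<in>G. [:1, g x:]"
  have "map_poly h ?P = (\<Prod>g\<in>G. [:1, (h \<circ> g) x:])"
    unfolding map_poly_G_prod[OF h] by (simp add: map_poly_pCons h)
  also have "\<dots> = ?P"
    by (rule prod.reindex_bij_betw[OF G_reindex(1)[OF h], of "\<lambda>g. [:1, g x:]"])
  finally have eq: "map_poly h ?P = ?P" .
  have "h (coeff ?P k) = coeff (map_poly h ?P) k" by (rule coeff_map_poly[symmetric]) (simp add: h)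
  then show "h (coeff ?P k) = coeff ?P k" unfolding eq .
qed

text \<open>If \<open>d\<close> divides \<open>n\<close> and \<open>Q - 1\<close>, put \<open>\<rho> = \<pi> ^ (n div d)\<close>.  Modulo the maximal ideal,
  \<open>g \<mapsto> g \<rho> / \<rho>\<close> is a homomorphism to the \<open>d\<close>-th roots of unity of the residue field of \<open>K\<close>, whose
  kernel contains every stabiliser of a conjugate of \<open>\<pi>\<close>.\<close>

lemma tame_character_trivial:
  assumes d: "d dvd n" "d dvd Q - 1"
    and fixed_point: "\<And>t. t \<in> T \<Longrightarrow> \<exists>x\<in>X. t x = x"
    and g: "g \<in> G"
  shows "N.cong (g (\<pi> ^ (n div d)) / \<pi> ^ (n div d)) 1"
proof -
  define \<rho> where "\<rho> = \<pi> ^ (n div d)"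
  define r where "r g = g \<rho> / \<rho>" for g
  have \<rho>0: "\<rho> \<noteq> 0" using \<pi> by (simp add: \<rho>_def)
  have av_r: "av (r g) = 1" if "g \<in> G" for g
    using that \<rho>0 by (simp add: r_def N.A_divide av_G)
  have \<rho>d: "\<rho> ^ d = \<pi> ^ n" using d(1) by (simp add: \<rho>_def power_mult[symmetric])
  obtain t where t: "t \<noteq> 0" "v t = 1" using ex_nv_half by blast
  \<comment> \<open>A unit of L, so its residue lies in K and is fixed by \<open>G\<close>; since
    \<open>\<iota> t\<close> is fixed as well, \<open>r g ^ d = g u / u\<close> is congruent to
    1.\<close>
  define u where "u = \<pi> ^ n / \<iota> t"
  have uL: "u \<in> L" using \<pi>(1) L(2) by (auto simp: u_def intro!: subfield_closed[OF L(1)])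
  have u0: "u \<noteq> 0" using \<pi>(2) t by (simp add: u_def)
  have \<pi>u: "\<pi> ^ n = u * \<iota> t" using t by (simp add: u_def)
  have "lg (u * \<iota> t) = lg u + lg (\<iota> t)" using u0 t by (intro lg_mult) auto
  then have "lg u = 0" using \<pi>(2,3) t by (simp add: \<pi>u[symmetric] lg_power lg_\<iota>)
  moreover have "lg 1 = 0" by (simp add: lg_def)
  ultimately have avu: "av u = 1" using u0 lg_le_iff[of u 1] lg_le_iff[of 1 u] by simp
  have r_d: "N.cong (r g ^ d) 1" if g: "g \<in> G" for g
  proof -
    obtain c where c: "N.cong u (\<iota> c)" using residue_L[OF uL] avu by auto
    have "N.cong (g u) (\<iota> c)" using G_cong[OF g c] g by (simp add: G_\<iota>)
    then have "N.cong (g u) u" using c N.cong_sym N.cong_trans by blast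
    moreover have "r g ^ d = g u / u"
    proof -
      have "r g ^ d = g (\<pi> ^ n) / \<pi> ^ n" by (simp add: r_def power_divide G_power[OF g, symmetric] \<rho>d)
      then show ?thesis using t g by (simp add: \<pi>u G_mult G_\<iota>)
    qed
    moreover have "u * (g u / u) = g u" "u * 1 = u" using u0 by auto
    ultimately show ?thesis using N.cong_cancel[of u "g u / u" 1] avu by simp
  qed
  have r_K: "\<exists>c. N.cong (r g) (\<iota> c)" if g: "g \<in> G" for g
  proof -
    obtain k where k: "Q - 1 = d * k" using d(2) by blast
    have "r g ^ Q = r g * (r g ^ d) ^ k"
      using Q_gt_1 by (metis k less_imp_le_nat less_one not_less power_eq_if power_mult order_less_trans)
    also have "N.cong \<dots> (r g * 1 ^ k)"
      using av_r[OF g] by (intro N.cong_mult N.cong_power r_d g) auto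
    finally show ?thesis using frobenius_fixed[of "r g"] av_r[OF g] by auto
  qed
  \<comment> \<open>An automorphism fixes residues of K, so applying g to \<open>r h\<close> changes
    nothing modulo the maximal ideal and the cocycle \<open>r\<close> becomes a
    homomorphism.\<close>
  have r_comp: "N.cong (r (g \<circ> h)) (r g * r h)" if g: "g \<in> G" and h: "h \<in> G" for g h
  proof -
    have "r (g \<circ> h) = g (r h) * r g" using g \<rho>0 by (simp add: r_def G_divide)
    moreover obtain c where c: "N.cong (r h) (\<iota> c)" using r_K[OF h] by blast
    then have "N.cong (g (r h)) (\<iota> c)" using G_cong[OF g c] g by (simp add: G_\<iota>)
    then have "N.cong (g (r h)) (r h)" using c N.cong_sym N.cong_trans by blast
    then have "N.cong (g (r h) * r g) (r h * r g)"
      using av_r[OF g] av_r[OF h] by (intro N.cong_mult) auto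
    ultimately show ?thesis by (simp add: mult.commute)
  qed
  have r_T: "N.cong (r t) 1" if t: "t \<in> T" for t
  proof -
    obtain g where g: "g \<in> G" "t (g \<pi>) = g \<pi>" using fixed_point[OF t] by (auto simp: X_def)
    have tG: "t \<in> G" using t by (simp add: T_def)
    define s where "s = inv_into UNIV g \<circ> t \<circ> g"
    have s: "s \<in> G" using g tG by (auto simp: s_def intro!: G_comp G_inv)
    have "s \<pi> = \<pi>" using g by (simp add: s_def)
    then have "s \<rho> = \<rho>" using s by (simp add: \<rho>_def G_power)
    then have rs: "r s = 1" using \<rho>0 by (simp add: r_def)
    \<comment> \<open>The values of \<open>r\<close> commute, so conjugate elements have congruent
      values, and \<open>s\<close> fixes \<open>\<rho>\<close>.\<close>
    have "g \<circ> s = t \<circ> g" using g(1) by (simp add: s_def fun_eq_iff)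
    then have "N.cong (r t * r g) (r g * r s)"
      using r_comp[OF g(1) s] r_comp[OF tG g(1)] N.cong_sym N.cong_trans by metis
    then have "N.cong (r g * r t) (r g * 1)" by (simp add: rs mult.commute)
    then show ?thesis by (rule N.cong_cancel) (rule av_r[OF g(1)])
  qed
  obtain t where t: "t \<in> T" "t \<pi> = g \<pi>" using ex_T_conjugate[of "g \<pi>"] g by (auto simp: X_def)
  have "t \<rho> = g \<rho>" using t g by (simp add: \<rho>_def G_power T_def)
  then have "r g = r t" by (simp add: r_def)
  then have "N.cong (r g) 1" using r_T[OF t(1)] by simp
  then show ?thesis by (simp add: r_def \<rho>_def)
qed

text \<open>Here \<open>p ^ a\<close> is the exact power of the residue characteristic dividing \<open>card G\<close>: the elementary
  symmetric function of degree \<open>p ^ a\<close> of the conjugates of \<open>\<rho>\<close> has the same absolute value as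
  \<open>\<rho> ^ p ^ a\<close>, because the binomial coefficient \<open>card G choose p ^ a\<close> is a unit.\<close>

lemma tame_part_trivial:
  assumes d: "d dvd n" "d dvd Q - 1"
    and triv: "\<And>g. g \<in> G \<Longrightarrow> N.cong (g (\<pi> ^ (n div d)) / \<pi> ^ (n div d)) 1"
  shows "d = 1"
proof -
  define \<rho> where "\<rho> = \<pi> ^ (n div d)"
  have \<rho>0: "\<rho> \<noteq> 0" using \<pi> by (simp add: \<rho>_def)
  obtain p s where p: "prime p" "0 < s" "Q = p ^ s" "av (of_nat p) < 1" using Q_prime_power by blast
  have d0: "d \<noteq> 0" using d(1) n by auto
  obtain a m where am: "card G = p ^ a * m" "\<not> p dvd m"
    using multiplicity_decompose'[of "card G" p] card_G p(1) by (metis less_numeral_extra(3) not_prime_unit)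
  let ?j = "p ^ a"
  have "0 < m" using am card_G by (cases m) auto
  \<comment> \<open>The divisibility count behind Sylow's theorem: choosing \<open>p ^ a\<close> out
    of \<open>p ^ a * m\<close> elements leaves exactly the factors p of m.\<close>
  then have "multiplicity p (card G choose ?j) = multiplicity p m"
    unfolding am(1) by (rule const_p_fac) (rule p(1))
  also have "\<dots> = 0" using am(2) by (rule not_dvd_imp_multiplicity_0)
  finally have mult: "multiplicity p (card G choose ?j) = 0" .
  have "?j \<le> card G" using am(1) \<open>0 < m\<close> by simp
  then have "card G choose ?j \<noteq> 0" by simp
  then have "\<not> p dvd (card G choose ?j)"
    using mult p(1) by (metis multiplicity_eq_zero_iff not_prime_unit)
  then have unit: "av (of_nat (card G choose ?j)) = 1" by (rule N.A_of_nat_eq_1[OF p(1,4)])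
  define e where "e = coeff (\<Prod>g\<in>G. [:1, g \<rho>:]) ?j"
  have "N.cong (e / \<rho> ^ ?j) (of_nat (card G choose ?j))"
    unfolding e_def using triv by (intro N.coeff_prod_cong_binomial finite_G \<rho>0) (simp add: \<rho>_def)
  then have "av (e / \<rho> ^ ?j) = 1" using unit by (rule N.cong_unit)
  then have av_e: "av e = av (\<rho> ^ ?j)" using \<rho>0 by (simp add: N.A_divide)
  obtain c where c: "e = \<iota> c" using prod_G_coeff[of \<rho> ?j] by (auto simp: e_def)
  have c0: "c \<noteq> 0" using av_e \<rho>0 by (auto simp: c)
  have "lg (\<iota> c) = lg (\<rho> ^ ?j)" using av_e by (simp add: c lg_def)
  then have "- (real (card G) * v c) = real ?j * (real (n div d) * lg \<pi>)"
    using c0 \<rho>0 \<pi>(2) by (simp add: lg_\<iota> lg_power) (simp add: \<rho>_def lg_power)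
  \<comment> \<open>Multiplication by d turns \<open>n div d\<close> back into n, where the
    logarithm of \<open>\<pi>\<close> is known. What remains is
    \<open>d * v c = p ^ a\<close>.\<close>
  then have "real d * - (real (card G) * v c) = real d * (real ?j * (real (n div d) * lg \<pi>))" by simp
  also have "\<dots> = real ?j * (real (d * (n div d)) * lg \<pi>)" by simp
  also have "d * (n div d) = n" using d(1) by simp
  also have "real n * lg \<pi> = - real (card G)" by (rule \<pi>(3))
  finally have "real (card G) * (real d * v c) = real (card G) * real ?j" by (simp add: algebra_simps)
  then have "real d * v c = real ?j" using card_G by simp
  then have "real_of_int (int d * v c) = real_of_int (int ?j)" by simp
  then have "int d * v c = int ?j" by (simp only: of_int_eq_iff)
  then have "d dvd ?j" by (metis dvd_triv_left int_dvd_int_iff)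
  have "coprime d p"
  proof (rule ccontr)
    assume "\<not> coprime d p"
    then have "p dvd d" using p(1) by (metis coprime_commute prime_imp_coprime)
    then have "p dvd Q - 1" using d(2) by (rule dvd_trans)
    moreover have "p dvd Q" using p by (simp add: dvd_power)
    ultimately have "p dvd 1" using Q_gt_1 by (metis dvd_diffD1 less_imp_le_nat)
    then show False using p(1) by (simp add: prime_nat_iff)
  qed
  then have "coprime d ?j" by (simp add: coprime_power_right_iff)
  with \<open>d dvd ?j\<close> show "d = 1" by (metis coprime_absorb_left nat_dvd_1_iff_1)
qed

text \<open>\<open>t\<close> fixes L and its conjugate pointwise, hence their compositum, while
  acting on residues as the Q-power map. So every residue of the compositum is fixed by that map and
  comes from K.\<close>

lemma compositum_totally_ramified:
  assumes t: "t \<in> T" "t \<pi> = \<pi>" "t (\<sigma> \<pi>) = \<sigma> \<pi>" and \<sigma>: "\<sigma> \<in> G"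
  shows "totally_ramified v \<iota> (compositum L (\<sigma> ` L))"
proof (rule totally_ramifiedI)
  let ?E = "compositum L (\<sigma> ` L)"
  have tG: "t \<in> G" using t by (simp add: T_def)
  show "is_subfield ?E"
    unfolding compositum_def is_subfield_def by auto
  show "range \<iota> \<subseteq> ?E" using L(2) unfolding compositum_def by blast
  have "is_subfield {x. t x = x}"
    using tG by (auto simp: is_subfield_def G_diff G_mult G_inverse)
  moreover have "L \<subseteq> {x. t x = x}" using fixes_L[OF tG t(2)] by blast
  moreover have "\<sigma> ` L \<subseteq> {x. t x = x}"
  proof -
    have "t (\<sigma> y) = \<sigma> y" if y: "y \<in> L" for y
    proof -
      have "(inv_into UNIV \<sigma> \<circ> t \<circ> \<sigma>) y = y"
        by (rule fixes_L[OF G_comp[OF G_comp[OF G_inv[OF \<sigma>] tG] \<sigma>] _ y]) (simp add: t(3) \<sigma>)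
      then have "\<sigma> (inv_into UNIV \<sigma> (t (\<sigma> y))) = \<sigma> y" by simp
      then show ?thesis using \<sigma> by simp
    qed
    then show ?thesis by blast
  qed
  ultimately have E_fixed: "?E \<subseteq> {x. t x = x}" unfolding compositum_def by blast
  fix x assume x: "x \<in> ?E" "av x \<le> 1"
  then have "N.cong (t x) (x ^ Q)" using t(1) by (simp add: T_def)
  moreover have "t x = x" using x E_fixed by blast
  ultimately show "\<exists>c. N.cong x (\<iota> c)" using frobenius_fixed[OF x(2)] N.cong_sym by metis
qed

end

theorem theorem2p1:
  fixes v :: "'k::field \<Rightarrow> int" and \<iota> :: "'k \<Rightarrow> 'n::field" and L :: "'n set" and n q :: nat
  assumes "local_field_ext v \<iota> L"
    and "finite_ext \<iota> L" and "separable_ext \<iota> L"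
    and "galois_closure \<iota> L"
    and "exceptional v \<iota> L"
    and "n = ext_degree \<iota> L"
    and "q = card (residue_field UNIV v)"
  shows "gcd n (q - 1) = 1"
proof -
  interpret local_galois v \<iota>
    using assms(1,4) by unfold_locales (auto simp: local_field_ext_def galois_closure_def)
  have L: "is_subfield L" "range \<iota> \<subseteq> L"
    using assms(1) by (auto simp: local_field_ext_def intermediate_field_def)
  have tr: "totally_ramified v \<iota> L" using assms(5) by (simp add: exceptional_def)
  obtain \<pi> where \<pi>: "\<pi> \<in> L" "\<pi> \<noteq> 0" "real n * lg \<pi> = - real (card G)" "0 < n"
    "L = V.span ((\<lambda>i. \<pi> ^ i) ` {..<n})"
    using totally_ramified_uniformizer[OF L tr] unfolding assms(6) by blast
  interpret totally_ramified_ext v \<iota> L \<pi> n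
    by unfold_locales (fact L \<pi>)+
  have q: "q = Q" using assms(7) by (simp add: Q_def residue_field_eq)
  show ?thesis
  proof (rule ccontr)
    let ?d = "gcd n (q - 1)"
    assume d1: "?d \<noteq> 1"
    have d: "?d dvd n" "?d dvd Q - 1" unfolding q by simp_all
    have "\<not> (\<forall>t\<in>T. \<exists>x\<in>X. t x = x)"
    proof
      assume "\<forall>t\<in>T. \<exists>x\<in>X. t x = x"
      then have "N.cong (g (\<pi> ^ (n div ?d)) / \<pi> ^ (n div ?d)) 1" if "g \<in> G" for g
        using that by (intro tame_character_trivial[OF d]) auto
      then have "?d = 1" by (rule tame_part_trivial[OF d])
      with d1 show False ..
    qed
    then obtain t x y where t: "t \<in> T" and x: "x \<in> X" "t x = x" and y: "y \<in> X" "t y = y" and "x \<noteq> y"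
      using T_fixed_point by metis
    obtain g h where g: "g \<in> G" "x = g \<pi>" and h: "h \<in> G" "y = h \<pi>"
      using x(1) y(1) by (auto simp: X_def)
    \<comment> \<open>Exceptionality speaks of L and one conjugate, so the pair of fixed points x, y
      is moved by the inverse of g to \<open>\<pi>\<close> and \<open>\<sigma> \<pi>\<close>, and t
      is conjugated accordingly.\<close>
    define \<sigma> where "\<sigma> = inv_into UNIV g \<circ> h"
    have \<sigma>: "\<sigma> \<in> G" unfolding \<sigma>_def by (intro G_comp G_inv g h)
    have "\<sigma> \<pi> \<noteq> \<pi>"
    proof
      assume "\<sigma> \<pi> = \<pi>"
      then have "g (inv_into UNIV g (h \<pi>)) = g \<pi>" by (simp add: \<sigma>_def)
      then show False using g h \<open>x \<noteq> y\<close> by simp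
    qed
    then have "\<sigma> \<notin> Gal L UNIV" using \<pi>(1) by (auto simp: Gal_def)
    moreover have "totally_ramified v \<iota> (compositum L (\<sigma> ` L))"
    proof (rule compositum_totally_ramified[OF T_conj[OF t g(1)] _ _ \<sigma>])
      show "(inv_into UNIV g \<circ> t \<circ> g) \<pi> = \<pi>" using g x by simp
      show "(inv_into UNIV g \<circ> t \<circ> g) (\<sigma> \<pi>) = \<sigma> \<pi>" using g h y by (simp add: \<sigma>_def)
    qed
    ultimately show False using assms(5) \<sigma> by (auto simp: exceptional_def)
  qed
qed

end
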